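(* Let $n\ge3$ and let $F\in\mathbb{R}[x,y]$ be a polynomial of degree $n-1$. Suppose that the system $$\frac{dx}{dt}=-x\left(F(x,y)+y\frac{\partial F}{\partial y}\right),\qquad \frac{dy}{dt}=y\left(F(x,y)+x\frac{\partial F}{\partial x}\right)$$ has $\left[\frac{n^2-1}{2}\right]$ centers and that its configuration of centers is $(i_1;i_2;i_3;i_4)$, normalized so that $i_1=\min\{i_1,i_2,i_3,i_4\}$ and $i_2\le i_4$. Then the following statements hold. (i) $i_j\ne0$ for $j=2,3,4$. (ii) $\min\{i_1+i_3,\,i_2+i_4\}\ge n-1$ if $n$ is odd, and $\min\{i_1+i_3,\,i_2+i_4\}\ge n-2$ if $n$ is even. (iii) If $i_1=0$, then $i_2\ge\left[\frac{n-1}{2}\right]$, and $i_3\ge n-2$ when $n$ is even, $i_3\ge n-1$ when $n$ is odd. (iv) $\left[\frac{n^2+4}{8}\right]\le\max\{i_1,i_2,i_3,i_4\}\le\left[\frac{n^2-2n+2}{2}\right]$ and $i_1\le\left[\frac{n^2-1}{8}\right]$. (v) If there exists $j\in\{1,2,3,4\}$ such that $i_j=\left[\frac{n^2-2n+2}{2}\right]$, then $$(i_1;i_2;i_3;i_4)=\left(0;\left[\tfrac{n-1}{2}\right];\left[\tfrac{n^2-2n+2}{2}\right];\left[\tfrac{n-1}{2}\right]\right).$$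
   Context: The system is Hamiltonian with Hamiltonian $H(x,y)=xyF(x,y)$; the lines $x=0$ and $y=0$ are invariant, so all centers lie in the open quadrants of $\mathbb{R}^2$. A center is a critical point having a neighborhood filled with periodic orbits except for the point itself. $[\cdot]$ denotes the integer part. The system has configuration $(i_1;i_2;i_3;i_4)$ of centers if it has exactly $i_j$ centers in the interior of the $j$-th quadrant, $j=1,2,3,4$ (quadrants numbered counterclockwise in the usual way). Configurations are considered up to equivalence: two configurations are equivalent if one is transformed to the other by a composition of the maps $(x,y)\mapsto(-x,y)$, $(x,y)\mapsto(x,-y)$, $(x,y)\mapsto(y,x)$. Every configuration is equivalent to one with $i_1=\min\{i_1,i_2,i_3,i_4\}$ and $i_2\le i_4$. *)

theory Defs
  imports "HOL-Analysis.Analysis" "HOL-Computational_Algebra.Polynomial"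
begin

section \<open>Real bivariate polynomials\<close>

text \<open>
  A polynomial in \<open>\<real>[x,y]\<close> is an element of \<open>\<real>[x][y]\<close>: the coefficient of \<open>x^i y^j\<close> in \<open>F\<close> is
  \<^term>\<open>coeff (coeff F j) i\<close>.
\<close>

definition eval2 :: "real poly poly \<Rightarrow> real \<Rightarrow> real \<Rightarrow> real" where
  "eval2 F x y = poly (poly F [:y:]) x"

definition partial_x :: "real poly poly \<Rightarrow> real poly poly" where
  "partial_x F = map_poly pderiv F"

definition partial_y :: "real poly poly \<Rightarrow> real poly poly" where
  "partial_y F = pderiv F"

text \<open>The inserted \<open>0\<close> only affects the zero polynomial.\<close>

definition total_degree2 :: "real poly poly \<Rightarrow> nat" where
  "total_degree2 F = Max (insert 0 {i + j |i j. coeff (coeff F j) i \<noteq> 0})"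


section \<open>Planar vector fields and centers\<close>

text \<open>The range of a nonconstant periodic solution; equilibria are not periodic orbits.\<close>

definition periodic_orbit :: "(real \<times> real \<Rightarrow> real \<times> real) \<Rightarrow> (real \<times> real) set \<Rightarrow> bool" where
  "periodic_orbit X \<Gamma> \<longleftrightarrow>
    (\<exists>\<gamma> :: real \<Rightarrow> real \<times> real. \<exists>T > 0.
       (\<forall>t. (\<gamma> has_vector_derivative X (\<gamma> t)) (at t)) \<and>
       (\<forall>t. \<gamma> (t + T) = \<gamma> t) \<and>
       (\<exists>t. \<gamma> t \<noteq> \<gamma> 0) \<and>
       \<Gamma> = range \<gamma>)"

definition is_center :: "(real \<times> real \<Rightarrow> real \<times> real) \<Rightarrow> real \<times> real \<Rightarrow> bool" where
  "is_center X p \<longleftrightarrow>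
    X p = 0 \<and>
    (\<exists>U \<O>. p \<in> interior U \<and> (\<forall>\<Gamma>\<in>\<O>. periodic_orbit X \<Gamma>) \<and> U - {p} = \<Union>\<O>)"

definition centers :: "(real \<times> real \<Rightarrow> real \<times> real) \<Rightarrow> (real \<times> real) set" where
  "centers X = {p. is_center X p}"


section \<open>The Kolmogorov system with Hamiltonian \<open>x y F(x,y)\<close>\<close>

definition kolmogorov_field :: "real poly poly \<Rightarrow> real \<times> real \<Rightarrow> real \<times> real" where
  "kolmogorov_field F = (\<lambda>(x, y).
     (- x * (eval2 F x y + y * eval2 (partial_y F) x y),
      y * (eval2 F x y + x * eval2 (partial_x F) x y)))"


section \<open>Configurations of centers\<close>

type_synonym configuration = "nat \<times> nat \<times> nat \<times> nat"

text \<open>Meaningful only when \<^term>\<open>centers X\<close> is finite, since infinite sets have \<^const>\<open>card\<close> \<open>0\<close>.\<close>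

definition configuration_of :: "(real \<times> real \<Rightarrow> real \<times> real) \<Rightarrow> configuration" where
  "configuration_of X =
    (card (centers X \<inter> {0<..} \<times> {0<..}),
     card (centers X \<inter> {..<0} \<times> {0<..}),
     card (centers X \<inter> {..<0} \<times> {..<0}),
     card (centers X \<inter> {0<..} \<times> {..<0}))"

text \<open>
  The map \<open>(x,y) \<mapsto> (-x,y)\<close> exchanges quadrants 1, 2 and quadrants 3, 4; \<open>(x,y) \<mapsto> (x,-y)\<close>
  exchanges 1, 4 and 2, 3; \<open>(x,y) \<mapsto> (y,x)\<close> exchanges 2, 4 and fixes 1 and 3.
\<close>

inductive config_equiv :: "configuration \<Rightarrow> configuration \<Rightarrow> bool" where
  refl: "config_equiv c c"
| reflect_x: "config_equiv c (i1, i2, i3, i4) \<Longrightarrow> config_equiv c (i2, i1, i4, i3)"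
| reflect_y: "config_equiv c (i1, i2, i3, i4) \<Longrightarrow> config_equiv c (i4, i3, i2, i1)"
| swap: "config_equiv c (i1, i2, i3, i4) \<Longrightarrow> config_equiv c (i1, i4, i3, i2)"

end

theory Submission
  imports Defs "HOL-Computational_Algebra.Fundamental_Theorem_Algebra"
begin

text \<open>
  Put \<open>D = n - 1\<close>, \<open>P = F + y F\<^sub>y\<close> and \<open>Q = F + x F\<^sub>x\<close>.  The Hamiltonian \<open>H = x y F\<close> has \<open>H\<^sub>x = y Q\<close> and
  \<open>H\<^sub>y = x P\<close>, so away from the axes its critical points are the common zeros of \<open>P\<close> and \<open>Q\<close>, and
  there its Hessian determinant is \<open>- x y J\<close> with \<open>J\<close> the Jacobian of \<open>(P, Q)\<close>.  A nondegenerate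
  extremum therefore has \<open>J < 0\<close> in quadrants 1 and 3, and \<open>J > 0\<close> in quadrants 2 and 4.

  Reduction to nondegenerate extrema.  A center \<open>p\<close> is isolated in its level set of \<open>H\<close>
  (\<open>center_isolated_in_level\<close>): otherwise periodic orbits on that level come arbitrarily close to \<open>p\<close>,
  one of them lies in a small square around \<open>p\<close>, and inside that orbit \<open>H\<close> has a critical point other
  than \<open>p\<close>, which is impossible near a center.  Since \<open>H\<close> vanishes on both
  axes, no center lies on them; and every center is a strict extremum.  A strict extremum leaves an
  extremum nearby when \<open>F\<close> is perturbed slightly, and by Sard's theorem the perturbation can be chosen
  so that all critical points off the axes are nondegenerate (\<open>perturb_to_nondegenerate\<close>).  So upper
  bounds for nondegenerate extrema of generic \<open>F\<close>, quadrant by quadrant, bound the numbers of centers.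

  Counting.  The Bezoutian \<open>K(X, Y)\<close> of \<open>P\<close> and \<open>Q\<close> is a polynomial in two points of total degree at
  most \<open>2 D - 2\<close> that vanishes at pairs of distinct common zeros and equals \<open>J\<close> on the diagonal.  Give
  real weights \<open>\<mu>\<close> to the points of a set on which \<open>J > 0\<close>, such that \<open>\<mu>\<close> annihilates all monomials of
  degree below \<open>d\<close>.  The sum of \<open>\<mu>(p) \<mu>(q) K(p, q)\<close> over all pairs is the sum of \<open>\<mu>(p)\<^sup>2 J(p)\<close>, but it
  sees only the terms of \<open>K\<close> of degree at least \<open>d\<close> in both points.  If what it sees is not positive,
  then \<open>\<mu> = 0\<close>, so the set has at most as many points as there are conditions, \<open>d (d + 1) / 2\<close>
  (\<open>card_le_of_kernel\<close>).

  \<^item> For \<open>K\<close> times a linear form and \<open>d = D\<close> nothing is left.  Hence at most \<open>D (D + 1) / 2\<close> extrema lie in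
    each of the four open half planes bounded by an axis.

  \<^item> For \<open>K\<close> with \<open>d = D - 1\<close>, and for \<open>- x y' K\<close> with \<open>d = D\<close>, one bihomogeneous part is left.  If the
    leading form of \<open>F\<close> is the product of the linear factors \<open>y - t\<^sub>i x\<close> (up to a constant), and \<open>L\<^sub>i\<close> is
    that form divided by \<open>y - t\<^sub>i x\<close>, then this part of \<open>K\<close> is \<open>(D + 2) (\<Sum>i. t\<^sub>i L\<^sub>i(X) L\<^sub>i(Y))\<close>
    (\<open>bez_top\<close>).  One more real condition for each pair of conjugate roots, and in the case of \<open>K\<close> also
    one for each real root of the wrong sign, make the corresponding quadratic form nonpositive.  With
    \<open>u\<close> conjugate pairs and \<open>r\<close> real roots of that sign, there are at most \<open>D (D + 1) / 2 + u\<close> extrema,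
    and at most \<open>D (D - 1) / 2 + u + r\<close> of them in two opposite quadrants.  As \<open>2 u + r \<le> D\<close>, the number
    of all extrema plus the number of those in two opposite quadrants is at most \<open>D (D + 1)\<close>.

  If there are as many as \<open>[(n\<^sup>2 - 1) / 2]\<close> centers, these upper bounds also give lower bounds for the
  complementary quadrants: two adjacent quadrants hold at least \<open>[D / 2]\<close> centers, two opposite ones at
  least \<open>2 [D / 2]\<close>.  All the claims follow by arithmetic (\<open>extremal_configuration\<close>).
\<close>

section \<open>Kernels in two points and a dimension count\<close>

text \<open>
  The polynomials in \<open>(X, Y)\<close> all of whose monomials have a degree in \<open>X\<close> and a degree in \<open>Y\<close> that
  together satisfy \<open>\<Phi>\<close>.  Keeping \<open>\<Phi>\<close> arbitrary allows for bounds on the total degree as well as for the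
  disjunctions \<open>a < d \<or> b < d\<close> that describe what annihilating weights do not see.
\<close>

inductive kernel_span ::
  "(nat \<Rightarrow> nat \<Rightarrow> bool) \<Rightarrow> (real \<times> real \<Rightarrow> real \<times> real \<Rightarrow> complex) \<Rightarrow> bool" for \<Phi> where
  zero: "kernel_span \<Phi> (\<lambda>X Y. 0)"
| monomial: "\<Phi> (a + b) (c + d) \<Longrightarrow>
    kernel_span \<Phi> (\<lambda>X Y. z * (of_real (fst X) ^ a * of_real (snd X) ^ b) *
                   (of_real (fst Y) ^ c * of_real (snd Y) ^ d))"
| add: "kernel_span \<Phi> K \<Longrightarrow> kernel_span \<Phi> K' \<Longrightarrow> kernel_span \<Phi> (\<lambda>X Y. K X Y + K' X Y)"

lemma kernel_span_weaken:
  assumes "kernel_span \<Phi> K" "\<And>a b. \<Phi> a b \<Longrightarrow> \<Psi> a b"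
  shows "kernel_span \<Psi> K"
  using assms by (induction rule: kernel_span.induct) (auto intro: kernel_span.intros)

lemma kernel_span_sum:
  assumes "\<And>i. i \<in> I \<Longrightarrow> kernel_span \<Phi> (K i)"
  shows "kernel_span \<Phi> (\<lambda>X Y. \<Sum>i\<in>I. K i X Y)"
  using assms by (induction I rule: infinite_finite_induct) (auto intro: kernel_span.intros)

lemma kernel_span_mult_monomial:
  assumes "kernel_span \<Psi> K" "\<And>a' b'. \<Psi> a' b' \<Longrightarrow> \<Theta> (a + b + a') (c + d + b')"
  shows "kernel_span \<Theta> (\<lambda>X Y. (z * (of_real (fst X) ^ a * of_real (snd X) ^ b) *
                   (of_real (fst Y) ^ c * of_real (snd Y) ^ d)) * K X Y)"
  using assms(1)
proof induction
  case (monomial a' b' c' d' z')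
  have "kernel_span \<Theta> (\<lambda>X Y. (z * z') * (of_real (fst X) ^ (a+a') * of_real (snd X) ^ (b+b')) *
                   (of_real (fst Y) ^ (c+c') * of_real (snd Y) ^ (d+d')))"
    using assms(2)[OF monomial] by (intro kernel_span.monomial) (simp add: algebra_simps)
  then show ?case by (simp add: power_add algebra_simps)
qed (auto simp: distrib_left intro: kernel_span.intros)

lemma kernel_span_mult:
  assumes "kernel_span \<Phi> K" "kernel_span \<Psi> K'"
    and "\<And>a b a' b'. \<Phi> a b \<Longrightarrow> \<Psi> a' b' \<Longrightarrow> \<Theta> (a + a') (b + b')"
  shows "kernel_span \<Theta> (\<lambda>X Y. K X Y * K' X Y)"
  using assms(1)
proof induction
  case (monomial a b c d z)
  then show ?case using kernel_span_mult_monomial[OF assms(2)] assms(3) by blast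
qed (auto simp: distrib_right intro: kernel_span.intros)

lemma kernel_span_cmult:
  assumes "kernel_span \<Phi> K"
  shows "kernel_span \<Phi> (\<lambda>X Y. z * K X Y)"
  using kernel_span_mult_monomial[OF assms, of \<Phi> 0 0 0 0 z] by simp

lemma kernel_span_diff:
  assumes "kernel_span \<Phi> K" "kernel_span \<Phi> K'"
  shows "kernel_span \<Phi> (\<lambda>X Y. K X Y - K' X Y)"
  using kernel_span.add[OF assms(1) kernel_span_cmult[OF assms(2), of "-1"]] by simp

definition exponents :: "nat \<Rightarrow> (nat \<times> nat) set" where
  "exponents d = {(i, j). i + j < d}"

lemma exponents_Suc: "exponents (Suc d) = exponents d \<union> (\<lambda>k. (d - k, k)) ` {..d}"
  by (force simp: exponents_def image_iff)

lemma exponents_Suc_disjoint: "exponents d \<inter> (\<lambda>k. (d - k, k)) ` {..d} = {}"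
  by (auto simp: exponents_def)

lemma inj_antidiagonal: "inj_on (\<lambda>k. (d - k, k)) A"
  by (auto simp: inj_on_def)

lemma finite_exponents [simp]: "finite (exponents d)"
  by (induction d) (simp_all add: exponents_Suc, simp add: exponents_def)

lemma card_exponents: "card (exponents d) = d * (d + 1) div 2"
proof (induction d)
  case (Suc d)
  have "card (exponents (Suc d)) = card (exponents d) + Suc d"
    unfolding exponents_Suc by (subst card_Un_disjoint) (use exponents_Suc_disjoint in \<open>auto simp: card_image inj_antidiagonal\<close>)
  with Suc show ?case by simp
qed (simp add: exponents_def)

lemma sum_exponents_Suc:
  "(\<Sum>(i,j)\<in>exponents (Suc d). g i j) = (\<Sum>(i,j)\<in>exponents d. g i j) + (\<Sum>k\<le>d. g (d - k) k)"
  for g :: "nat \<Rightarrow> nat \<Rightarrow> 'a::comm_monoid_add"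
  unfolding exponents_Suc
  by (subst sum.union_disjoint) (use exponents_Suc_disjoint in \<open>auto simp: sum.reindex inj_antidiagonal\<close>)

text \<open>
  A homogeneous linear system with more unknowns than equations has a nontrivial solution; the proof
  eliminates one unknown for each equation.
\<close>

lemma exists_annihilating_weights:
  fixes g :: "'k \<Rightarrow> 'a \<Rightarrow> real"
  assumes "finite K" "finite S" "card K < card S"
  shows "\<exists>\<mu>. (\<exists>p\<in>S. \<mu> p \<noteq> 0) \<and> (\<forall>k\<in>K. (\<Sum>p\<in>S. \<mu> p * g k p) = 0)"
  using assms
proof (induction K arbitrary: S g rule: finite_induct)
  case empty
  then have "S \<noteq> {}" by auto
  then show ?case by (intro exI[of _ "\<lambda>_. 1"]) auto
next
  case (insert k K)
  show ?case
  proof (cases "\<forall>p\<in>S. g k p = 0")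
    case True
    have "card K < card S" using insert by simp
    from insert.IH[OF insert.prems(1) this, of g] obtain l where
      "\<exists>p\<in>S. l p \<noteq> 0" "\<forall>k\<in>K. (\<Sum>p\<in>S. l p * g k p) = 0" by blast
    with True show ?thesis by (intro exI[of _ l]) simp
  next
    case False
    then obtain p0 where p0: "p0 \<in> S" "g k p0 \<noteq> 0" by blast
    \<comment> \<open>Subtracting a multiple of the equation for \<open>k\<close> removes the unknown at \<open>p0\<close>.\<close>
    define g' where "g' j p = g j p - g j p0 / g k p0 * g k p" for j p
    have "card K < card (S - {p0})" using insert p0 by simp
    from insert.IH[OF _ this, of g'] insert.prems obtain l where
      l: "\<exists>p\<in>S-{p0}. l p \<noteq> 0" "\<forall>j\<in>K. (\<Sum>p\<in>S-{p0}. l p * g' j p) = 0" by auto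
    define s where "s = (\<Sum>p\<in>S-{p0}. l p * g k p)"
    \<comment> \<open>The weight at \<open>p0\<close> is determined by the eliminated equation.\<close>
    define l' where "l' = l(p0 := - s / g k p0)"
    have split: "(\<Sum>p\<in>S. l' p * g j p) = - s / g k p0 * g j p0 + (\<Sum>p\<in>S-{p0}. l p * g j p)" for j
      using p0 insert.prems by (subst sum.remove[of S p0]) (auto simp: l'_def intro!: sum.cong)
    have "(\<Sum>p\<in>S. l' p * g j p) = 0" if "j \<in> insert k K" for j
    proof (cases "j = k")
      case True then show ?thesis using p0 split[of k] by (simp add: s_def)
    next
      case False
      then have "0 = (\<Sum>p\<in>S-{p0}. l p * g' j p)" using l that by auto
      also have "\<dots> = (\<Sum>p\<in>S-{p0}. l p * g j p) - g j p0 / g k p0 * s"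
        by (simp add: g'_def s_def algebra_simps sum_subtractf sum_distrib_left)
      finally show ?thesis using split[of j] by simp
    qed
    moreover have "\<exists>p\<in>S. l' p \<noteq> 0" using l(1) by (auto simp: l'_def)
    ultimately show ?thesis by blast
  qed
qed

definition annihilates :: "nat \<Rightarrow> (real \<times> real) set \<Rightarrow> (real \<times> real \<Rightarrow> real) \<Rightarrow> bool" where
  "annihilates d S \<mu> \<longleftrightarrow> (\<forall>a b. a + b < d \<longrightarrow> (\<Sum>p\<in>S. \<mu> p * (fst p ^ a * snd p ^ b)) = 0)"

lemma annihilates_complex:
  assumes "annihilates d S \<mu>" "a + b < d"
  shows "(\<Sum>p\<in>S. of_real (\<mu> p) * (of_real (fst p) ^ a * of_real (snd p) ^ b)) = (0::complex)"
proof -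
  have "(\<Sum>p\<in>S. of_real (\<mu> p) * (of_real (fst p) ^ a * of_real (snd p) ^ b)) =
      complex_of_real (\<Sum>p\<in>S. \<mu> p * (fst p ^ a * snd p ^ b))" by simp
  with assms show ?thesis by (simp add: annihilates_def)
qed

lemma kernel_span_pairing_zero:
  assumes "kernel_span (\<lambda>a b. a < d \<or> b < d) K" "annihilates d S \<mu>"
  shows "(\<Sum>p\<in>S. \<Sum>q\<in>S. of_real (\<mu> p) * of_real (\<mu> q) * K p q) = 0"
  using assms(1)
proof induction
  case (monomial a b c e z)
  have "(\<Sum>p\<in>S. \<Sum>q\<in>S. of_real (\<mu> p) * of_real (\<mu> q) *
      (z * (of_real (fst p) ^ a * of_real (snd p) ^ b) * (of_real (fst q) ^ c * of_real (snd q) ^ e))) =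
    z * (\<Sum>p\<in>S. of_real (\<mu> p) * (of_real (fst p) ^ a * of_real (snd p) ^ b)) *
      (\<Sum>q\<in>S. of_real (\<mu> q) * (of_real (fst q) ^ c * of_real (snd q) ^ e))"
    unfolding mult.assoc[of z] unfolding sum_product unfolding sum_distrib_left
    by (intro sum.cong HOL.refl) (simp only: mult_ac)
  with monomial annihilates_complex[OF assms(2)] show ?case by auto
qed (simp_all add: distrib_left sum.distrib)

text \<open>
  A kernel that is diagonal on \<open>S\<close> with positive entries is a positive definite form in the weights on
  \<open>S\<close>.  Its positive index of inertia \<open>card S\<close> cannot exceed the codimension of a subspace on which the
  form is nonpositive.  Here the subspace is cut out by the monomials of degree below \<open>d\<close> and by the
  further conditions \<open>h v\<close>.
\<close>

lemma card_le_of_kernel: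
  fixes h :: "'v \<Rightarrow> real \<times> real \<Rightarrow> real"
  assumes "finite S" "finite V"
    and off: "\<And>p q. p \<in> S \<Longrightarrow> q \<in> S \<Longrightarrow> p \<noteq> q \<Longrightarrow> K p q = 0"
    and diag: "\<And>p. p \<in> S \<Longrightarrow> Re (K p p) > 0"
    and form: "\<And>\<mu>. annihilates d S \<mu> \<Longrightarrow> (\<And>v. v \<in> V \<Longrightarrow> (\<Sum>p\<in>S. \<mu> p * h v p) = 0) \<Longrightarrow>
        Re (\<Sum>p\<in>S. \<Sum>q\<in>S. of_real (\<mu> p) * of_real (\<mu> q) * K p q) \<le> 0"
  shows "card S \<le> d * (d + 1) div 2 + card V"
proof (rule ccontr)
  assume "\<not> ?thesis"
  then have less: "card (exponents d <+> V) < card S"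
    by (simp add: card_Plus assms card_exponents)
  define g where "g k p = (case k of Inl (a, b) \<Rightarrow> fst p ^ a * snd p ^ b | Inr v \<Rightarrow> h v p)"
    for k :: "nat \<times> nat + 'v" and p
  obtain l where l: "\<exists>p\<in>S. l p \<noteq> 0" "\<forall>k\<in>exponents d <+> V. (\<Sum>p\<in>S. l p * g k p) = 0"
    using exists_annihilating_weights[OF _ \<open>finite S\<close> less] assms(2) by (metis finite_Plus finite_exponents)
  have "annihilates d S l"
    unfolding annihilates_def
  proof (intro allI impI)
    fix a b :: nat assume "a + b < d"
    then have "Inl (a, b) \<in> exponents d <+> V" by (auto simp: exponents_def)
    with l(2) have "(\<Sum>p\<in>S. l p * g (Inl (a, b)) p) = 0" by blast
    then show "(\<Sum>p\<in>S. l p * (fst p ^ a * snd p ^ b)) = 0" by (simp add: g_def)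
  qed
  moreover have "(\<Sum>p\<in>S. l p * h v p) = 0" if "v \<in> V" for v
  proof -
    have "Inr v \<in> exponents d <+> V" using that by auto
    with l(2) have "(\<Sum>p\<in>S. l p * g (Inr v) p) = 0" by blast
    then show ?thesis by (simp add: g_def)
  qed
  ultimately have "Re (\<Sum>p\<in>S. \<Sum>q\<in>S. of_real (l p) * of_real (l q) * K p q) \<le> 0"
    by (rule form)
  also have "(\<Sum>p\<in>S. \<Sum>q\<in>S. of_real (l p) * of_real (l q) * K p q) =
      (\<Sum>p\<in>S. of_real (l p) * of_real (l p) * K p p)"
  proof (rule sum.cong[OF HOL.refl])
    fix p assume p: "p \<in> S"
    have "(\<Sum>q\<in>S. of_real (l p) * of_real (l q) * K p q) =
        (\<Sum>q\<in>S. if q = p then of_real (l p) * of_real (l p) * K p p else 0)"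
      using off p by (intro sum.cong) auto
    then show "(\<Sum>q\<in>S. of_real (l p) * of_real (l q) * K p q) = of_real (l p) * of_real (l p) * K p p"
      using p \<open>finite S\<close> by simp
  qed
  finally have "(\<Sum>p\<in>S. (l p)\<^sup>2 * Re (K p p)) \<le> 0"
    by (simp add: power2_eq_square)
  moreover have "(\<Sum>p\<in>S. (l p)\<^sup>2 * Re (K p p)) > 0"
  proof -
    obtain p where "p \<in> S" "l p \<noteq> 0" using l by blast
    then show ?thesis using \<open>finite S\<close> diag
      by (intro sum_pos2[of S p]) (auto simp: less_imp_le zero_less_mult_iff)
  qed
  ultimately show False by simp
qed

section \<open>Divided differences\<close>

text \<open>
  Divided differences of the monomial \<open>x\<^sup>i y\<^sup>j\<close> along the path from \<open>X\<close> over \<open>(fst Y, snd X)\<close> to \<open>Y\<close>.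
  They are given by recursion, not as quotients, because they are needed on the diagonal as well, where
  they become partial derivatives.
\<close>

primrec dd1 :: "nat \<Rightarrow> nat \<Rightarrow> real \<times> real \<Rightarrow> real \<times> real \<Rightarrow> complex" where
  "dd1 0 j X Y = 0"
| "dd1 (Suc i) j X Y = of_real (fst X) * dd1 i j X Y + of_real (fst Y) ^ i * of_real (snd X) ^ j"

primrec dd2 :: "nat \<Rightarrow> nat \<Rightarrow> real \<times> real \<Rightarrow> real \<times> real \<Rightarrow> complex" where
  "dd2 i 0 X Y = 0"
| "dd2 i (Suc j) X Y = of_real (snd X) * dd2 i j X Y + of_real (fst Y) ^ i * of_real (snd Y) ^ j"

lemma dd1_eq: "of_real (fst X - fst Y) * dd1 i j X Y =
    (of_real (fst X) ^ i - of_real (fst Y) ^ i) * of_real (snd X) ^ j"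
proof (induction i)
  case (Suc i)
  have "of_real (fst X - fst Y) * dd1 (Suc i) j X Y = of_real (fst X) * (of_real (fst X - fst Y) * dd1 i j X Y)
      + of_real (fst X - fst Y) * of_real (fst Y) ^ i * of_real (snd X) ^ j"
    by (simp add: algebra_simps)
  then show ?case unfolding Suc by (simp add: algebra_simps)
qed simp

lemma dd2_eq: "of_real (snd X - snd Y) * dd2 i j X Y =
    of_real (fst Y) ^ i * (of_real (snd X) ^ j - of_real (snd Y) ^ j)"
proof (induction j)
  case (Suc j)
  have "of_real (snd X - snd Y) * dd2 i (Suc j) X Y = of_real (snd X) * (of_real (snd X - snd Y) * dd2 i j X Y)
      + of_real (snd X - snd Y) * of_real (fst Y) ^ i * of_real (snd Y) ^ j"
    by (simp add: algebra_simps)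
  then show ?case unfolding Suc by (simp add: algebra_simps)
qed simp

lemma dd1_diag: "dd1 i j X X = of_nat i * of_real (fst X) ^ (i - 1) * of_real (snd X) ^ j"
proof (induction i)
  case (Suc i)
  then show ?case by (cases i) (simp_all add: algebra_simps)
qed simp

lemma dd2_diag: "dd2 i j X X = of_real (fst X) ^ i * (of_nat j * of_real (snd X) ^ (j - 1))"
proof (induction j)
  case (Suc j)
  then show ?case by (cases j) (simp_all add: algebra_simps)
qed simp

lemma dd1_Suc_right: "dd1 i (Suc j) X Y = of_real (snd X) * dd1 i j X Y"
  by (induction i) (simp_all add: algebra_simps)

lemma dd2_Suc_left: "dd2 (Suc i) j X Y = of_real (fst Y) * dd2 i j X Y"
  by (induction j) (simp_all add: algebra_simps)

lemma kernel_span_dd1: "kernel_span (\<lambda>a b. a + b < i + j) (dd1 i j)"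
proof (induction i)
  case (Suc i)
  have "kernel_span (\<lambda>a b. a + b < Suc i + j) (\<lambda>X Y. of_real (fst X) * dd1 i j X Y)"
    using kernel_span_mult_monomial[OF Suc, of "\<lambda>a b. a + b < Suc i + j" 1 0 0 0 1] by simp
  moreover have "kernel_span (\<lambda>a b. a + b < Suc i + j) (\<lambda>X Y. of_real (fst Y) ^ i * of_real (snd X) ^ j)"
    using kernel_span.monomial[of "\<lambda>a b. a + b < Suc i + j" 0 j i 0 1] by (simp add: mult.commute)
  ultimately show ?case by (simp add: kernel_span.add)
qed (simp add: kernel_span.zero)

lemma kernel_span_dd2: "kernel_span (\<lambda>a b. a + b < i + j) (dd2 i j)"
proof (induction j)
  case (Suc j)
  have "kernel_span (\<lambda>a b. a + b < i + Suc j) (\<lambda>X Y. of_real (snd X) * dd2 i j X Y)"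
    using kernel_span_mult_monomial[OF Suc, of "\<lambda>a b. a + b < i + Suc j" 0 1 0 0 1] by simp
  moreover have "kernel_span (\<lambda>a b. a + b < i + Suc j) (\<lambda>X Y. of_real (fst Y) ^ i * of_real (snd Y) ^ j)"
    using kernel_span.monomial[of "\<lambda>a b. a + b < i + Suc j" 0 0 i j 1] by simp
  ultimately show ?case by (simp add: kernel_span.add)
qed (simp add: kernel_span.zero)

text \<open>
  Polynomials of degree at most \<open>D\<close> in two variables are represented by arbitrary coefficient functions,
  of which only the values at \<open>i + j \<le> D\<close> matter; \<open>P\<close> and \<open>Q\<close> are then obtained by rescaling coefficients.
\<close>

definition bip :: "nat \<Rightarrow> (nat \<Rightarrow> nat \<Rightarrow> real) \<Rightarrow> real \<Rightarrow> real \<Rightarrow> real" where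
  "bip D c x y = (\<Sum>(i,j)\<in>exponents (Suc D). c i j * (x ^ i * y ^ j))"

definition bip_x :: "nat \<Rightarrow> (nat \<Rightarrow> nat \<Rightarrow> real) \<Rightarrow> real \<Rightarrow> real \<Rightarrow> real" where
  "bip_x D c x y = (\<Sum>(i,j)\<in>exponents (Suc D). c i j * (of_nat i * x ^ (i - 1) * y ^ j))"

definition bip_y :: "nat \<Rightarrow> (nat \<Rightarrow> nat \<Rightarrow> real) \<Rightarrow> real \<Rightarrow> real \<Rightarrow> real" where
  "bip_y D c x y = (\<Sum>(i,j)\<in>exponents (Suc D). c i j * (x ^ i * (of_nat j * y ^ (j - 1))))"

definition bdd1 :: "nat \<Rightarrow> (nat \<Rightarrow> nat \<Rightarrow> real) \<Rightarrow> real \<times> real \<Rightarrow> real \<times> real \<Rightarrow> complex" where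
  "bdd1 D c X Y = (\<Sum>(i,j)\<in>exponents (Suc D). of_real (c i j) * dd1 i j X Y)"

definition bdd2 :: "nat \<Rightarrow> (nat \<Rightarrow> nat \<Rightarrow> real) \<Rightarrow> real \<times> real \<Rightarrow> real \<times> real \<Rightarrow> complex" where
  "bdd2 D c X Y = (\<Sum>(i,j)\<in>exponents (Suc D). of_real (c i j) * dd2 i j X Y)"

lemma bdd_eq:
  "of_real (fst X - fst Y) * bdd1 D c X Y + of_real (snd X - snd Y) * bdd2 D c X Y =
   of_real (bip D c (fst X) (snd X) - bip D c (fst Y) (snd Y))"
proof -
  have "of_real (fst X - fst Y) * bdd1 D c X Y + of_real (snd X - snd Y) * bdd2 D c X Y =
    (\<Sum>(i,j)\<in>exponents (Suc D). of_real (c i j) *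
       (of_real (fst X - fst Y) * dd1 i j X Y + of_real (snd X - snd Y) * dd2 i j X Y))"
    unfolding bdd1_def bdd2_def sum_distrib_left sum.distrib[symmetric]
    by (intro sum.cong) (auto simp: algebra_simps)
  also have "\<dots> = (\<Sum>(i,j)\<in>exponents (Suc D). of_real (c i j) *
       (of_real (fst X) ^ i * of_real (snd X) ^ j - of_real (fst Y) ^ i * of_real (snd Y) ^ j))"
    by (intro sum.cong) (auto simp only: dd1_eq dd2_eq, simp add: algebra_simps)
  also have "\<dots> = of_real (bip D c (fst X) (snd X) - bip D c (fst Y) (snd Y))"
    unfolding bip_def of_real_diff of_real_sum sum_subtractf[symmetric]
    by (intro sum.cong) (auto simp: algebra_simps)
  finally show ?thesis .
qed

lemma bdd_diag:
  "bdd1 D c X X = of_real (bip_x D c (fst X) (snd X))"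
  "bdd2 D c X X = of_real (bip_y D c (fst X) (snd X))"
  by (auto simp: bdd1_def bdd2_def bip_x_def bip_y_def dd1_diag dd2_diag intro!: sum.cong)

section \<open>Binary forms\<close>

text \<open>
  The homogenization of a univariate polynomial \<open>\<phi>\<close> to a form of degree \<open>m\<close> in \<open>x\<close> and \<open>y\<close>, with \<open>y / x\<close>
  in the place of the variable.
\<close>

definition form :: "nat \<Rightarrow> complex poly \<Rightarrow> real \<times> real \<Rightarrow> complex" where
  "form m \<phi> X = (\<Sum>k\<le>m. coeff \<phi> k * (of_real (fst X) ^ (m - k) * of_real (snd X) ^ k))"

definition form_dd1 :: "nat \<Rightarrow> complex poly \<Rightarrow> real \<times> real \<Rightarrow> real \<times> real \<Rightarrow> complex" where
  "form_dd1 m \<phi> X Y = (\<Sum>k\<le>m. coeff \<phi> k * dd1 (m - k) k X Y)"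

definition form_dd2 :: "nat \<Rightarrow> complex poly \<Rightarrow> real \<times> real \<Rightarrow> real \<times> real \<Rightarrow> complex" where
  "form_dd2 m \<phi> X Y = (\<Sum>k\<le>m. coeff \<phi> k * dd2 (m - k) k X Y)"

lemma form_linear:
  "form m (\<phi> - \<psi>) X = form m \<phi> X - form m \<psi> X"
  "form_dd1 m (\<phi> - \<psi>) X Y = form_dd1 m \<phi> X Y - form_dd1 m \<psi> X Y"
  "form_dd2 m (\<phi> - \<psi>) X Y = form_dd2 m \<phi> X Y - form_dd2 m \<psi> X Y"
  "form m (smult z \<phi>) X = z * form m \<phi> X"
  "form_dd1 m (smult z \<phi>) X Y = z * form_dd1 m \<phi> X Y"
  "form_dd2 m (smult z \<phi>) X Y = z * form_dd2 m \<phi> X Y"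
  by (simp_all add: form_def form_dd1_def form_dd2_def algebra_simps sum_subtractf sum_distrib_left)

lemma form_sum:
  "form m (\<Sum>i\<in>I. \<phi> i) X = (\<Sum>i\<in>I. form m (\<phi> i) X)"
  "form_dd1 m (\<Sum>i\<in>I. \<phi> i) X Y = (\<Sum>i\<in>I. form_dd1 m (\<phi> i) X Y)"
  "form_dd2 m (\<Sum>i\<in>I. \<phi> i) X Y = (\<Sum>i\<in>I. form_dd2 m (\<phi> i) X Y)"
  unfolding form_def form_dd1_def form_dd2_def coeff_sum sum_distrib_right
  by (rule sum.swap)+

lemma form_Suc:
  assumes "degree \<psi> \<le> m"
  shows "form (Suc m) \<psi> X = of_real (fst X) * form m \<psi> X"
    and "form_dd1 (Suc m) \<psi> X Y =
      of_real (fst X) * form_dd1 m \<psi> X Y + form m \<psi> (fst Y, snd X)"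
    and "form_dd2 (Suc m) \<psi> X Y = of_real (fst Y) * form_dd2 m \<psi> X Y"
proof -
  have 0: "coeff \<psi> (Suc m) = 0" using assms by (simp add: coeff_eq_0)
  show "form (Suc m) \<psi> X = of_real (fst X) * form m \<psi> X"
    by (simp add: form_def 0 sum_distrib_left Suc_diff_le algebra_simps)
  show "form_dd1 (Suc m) \<psi> X Y =
      of_real (fst X) * form_dd1 m \<psi> X Y + form m \<psi> (fst Y, snd X)"
    by (simp add: form_def form_dd1_def 0 sum_distrib_left Suc_diff_le algebra_simps sum.distrib)
  show "form_dd2 (Suc m) \<psi> X Y = of_real (fst Y) * form_dd2 m \<psi> X Y"
    by (simp add: form_dd2_def 0 sum_distrib_left Suc_diff_le dd2_Suc_left algebra_simps)
qed

lemma form_pCons: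
  "form (Suc m) (pCons 0 \<psi>) X = of_real (snd X) * form m \<psi> X"
  "form_dd1 (Suc m) (pCons 0 \<psi>) X Y = of_real (snd X) * form_dd1 m \<psi> X Y"
  "form_dd2 (Suc m) (pCons 0 \<psi>) X Y = of_real (snd X) * form_dd2 m \<psi> X Y + form m \<psi> Y"
  by (simp_all add: form_def form_dd1_def form_dd2_def sum.atMost_Suc_shift sum_distrib_left
      dd1_Suc_right algebra_simps sum.distrib del: sum.atMost_Suc)

lemma kernel_span_form_dd:
  "kernel_span (\<lambda>a b. a + b < m) (form_dd1 m \<phi>)" "kernel_span (\<lambda>a b. a + b < m) (form_dd2 m \<phi>)"
proof -
  have "kernel_span (\<lambda>a b. a + b < m) (\<lambda>X Y. coeff \<phi> k * dd1 (m - k) k X Y)"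
       "kernel_span (\<lambda>a b. a + b < m) (\<lambda>X Y. coeff \<phi> k * dd2 (m - k) k X Y)" if "k \<le> m" for k
    using kernel_span_dd1[of "m - k" k] kernel_span_dd2[of "m - k" k] that by (auto intro: kernel_span_cmult)
  then show "kernel_span (\<lambda>a b. a + b < m) (form_dd1 m \<phi>)" "kernel_span (\<lambda>a b. a + b < m) (form_dd2 m \<phi>)"
    unfolding form_dd1_def form_dd2_def by (auto intro!: kernel_span_sum)
qed

lemma kernel_span_form:
  "kernel_span (\<lambda>a b. a = m \<and> b = 0) (\<lambda>X Y. form m \<phi> X)"
  "kernel_span (\<lambda>a b. a = 0 \<and> b = m) (\<lambda>X Y. form m \<phi> Y)"
proof -
  have "kernel_span (\<lambda>a b. a = m \<and> b = 0)
          (\<lambda>X Y. coeff \<phi> k * (of_real (fst X) ^ (m - k) * of_real (snd X) ^ k))"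
       "kernel_span (\<lambda>a b. a = 0 \<and> b = m)
          (\<lambda>X Y. coeff \<phi> k * (of_real (fst Y) ^ (m - k) * of_real (snd Y) ^ k))" if "k \<le> m" for k
    using kernel_span.monomial[of "\<lambda>a b. a = m \<and> b = 0" "m - k" k 0 0 "coeff \<phi> k"]
      kernel_span.monomial[of "\<lambda>a b. a = 0 \<and> b = m" 0 0 "m - k" k "coeff \<phi> k"] that by auto
  then show "kernel_span (\<lambda>a b. a = m \<and> b = 0) (\<lambda>X Y. form m \<phi> X)"
      "kernel_span (\<lambda>a b. a = 0 \<and> b = m) (\<lambda>X Y. form m \<phi> Y)"
    unfolding form_def by (auto intro!: kernel_span_sum)
qed

text \<open>
  This identity is the source of the diagonal shape of the Bezoutian.  For \<open>f = (y - t x) L\<close> the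
  Bezoutian of \<open>f\<close> and \<open>x L\<close> is \<open>- L(X) L(Y)\<close> up to terms that contain the factor \<open>y L(X)\<close>, or the factor
  \<open>x' L(Y)\<close>.  Those have degree \<open>m + 1\<close> in one of the points and thus degree below \<open>m\<close> in the other.
\<close>

lemma linear_factor:
  assumes "degree \<psi> \<le> m" "\<phi> = [:-t, 1:] * \<psi>"
  shows "form (Suc m) \<phi> X = (of_real (snd X) - t * of_real (fst X)) * form m \<psi> X"
    and "form_dd1 (Suc m) \<phi> X Y * form_dd2 (Suc m) \<psi> X Y -
         form_dd2 (Suc m) \<phi> X Y * form_dd1 (Suc m) \<psi> X Y =
       - (form m \<psi> X * form m \<psi> Y + of_real (snd X) * form_dd2 m \<psi> X Y * form m \<psi> X
          + form m \<psi> Y * of_real (fst Y) * form_dd1 m \<psi> X Y)"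
proof -
  have \<phi>: "\<phi> = pCons 0 \<psi> - smult t \<psi>" using assms by simp
  show "form (Suc m) \<phi> X = (of_real (snd X) - t * of_real (fst X)) * form m \<psi> X"
    unfolding \<phi> form_linear form_pCons form_Suc[OF assms(1)] by (simp add: algebra_simps)
  define Z where "Z = (fst Y, snd X)"
  define L1 where "L1 = form_dd1 m \<psi> X Y"
  define L2 where "L2 = form_dd2 m \<psi> X Y"
  have eq: "of_real (fst X - fst Y) * L1 = form m \<psi> X - form m \<psi> Z"
  proof -
    have "of_real (fst X - fst Y) * L1 = (\<Sum>k\<le>m. coeff \<psi> k * (of_real (fst X - fst Y) * dd1 (m - k) k X Y))"
      unfolding L1_def form_dd1_def by (simp add: sum_distrib_left algebra_simps)
    also have "\<dots> = form m \<psi> X - form m \<psi> Z"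
      unfolding dd1_eq form_def Z_def by (simp add: algebra_simps sum_subtractf)
    finally show ?thesis .
  qed
  have Z: "form m \<psi> Z = form m \<psi> X - of_real (fst X - fst Y) * L1" using eq by simp
  show "form_dd1 (Suc m) \<phi> X Y * form_dd2 (Suc m) \<psi> X Y -
         form_dd2 (Suc m) \<phi> X Y * form_dd1 (Suc m) \<psi> X Y =
       - (form m \<psi> X * form m \<psi> Y + of_real (snd X) * form_dd2 m \<psi> X Y * form m \<psi> X
          + form m \<psi> Y * of_real (fst Y) * form_dd1 m \<psi> X Y)"
    unfolding \<phi> form_linear form_pCons form_Suc[OF assms(1)] Z_def[symmetric]
      L1_def[symmetric] L2_def[symmetric] Z by (simp add: algebra_simps)
qed

section \<open>The Bezoutian of the equations for critical points\<close>

lemma bip_add: "bip D (\<lambda>i j. c i j + c' i j) x y = bip D c x y + bip D c' x y"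
  "bip_x D (\<lambda>i j. c i j + c' i j) x y = bip_x D c x y + bip_x D c' x y"
  "bip_y D (\<lambda>i j. c i j + c' i j) x y = bip_y D c x y + bip_y D c' x y"
  by (simp_all add: bip_def bip_x_def bip_y_def case_prod_unfold distrib_right sum.distrib)

text \<open>
  The coefficients of \<open>P = F + y F\<^sub>y\<close> and, below, of \<open>Q = F + x F\<^sub>x\<close>.
\<close>

definition coeff_P :: "(nat \<Rightarrow> nat \<Rightarrow> real) \<Rightarrow> nat \<Rightarrow> nat \<Rightarrow> real" where
  "coeff_P c i j = of_nat (Suc j) * c i j"

definition coeff_Q :: "(nat \<Rightarrow> nat \<Rightarrow> real) \<Rightarrow> nat \<Rightarrow> nat \<Rightarrow> real" where
  "coeff_Q c i j = of_nat (Suc i) * c i j"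

definition jac :: "nat \<Rightarrow> (nat \<Rightarrow> nat \<Rightarrow> real) \<Rightarrow> real \<Rightarrow> real \<Rightarrow> real" where
  "jac D c x y = bip_x D (coeff_P c) x y * bip_y D (coeff_Q c) x y
               - bip_y D (coeff_P c) x y * bip_x D (coeff_Q c) x y"

definition coeff_R :: "(nat \<Rightarrow> nat \<Rightarrow> real) \<Rightarrow> nat \<Rightarrow> nat \<Rightarrow> real" where
  "coeff_R c i j = coeff_P c i j + coeff_Q c i j"

text \<open>
  The Bezoutian of \<open>(P + Q, Q)\<close> instead of \<open>(P, Q)\<close>: the Jacobian and the zeros are the same, but by
  Euler's identity \<open>P + Q\<close> has a multiple of the leading form of \<open>F\<close> as its leading form.
\<close>

definition bez :: "nat \<Rightarrow> (nat \<Rightarrow> nat \<Rightarrow> real) \<Rightarrow> real \<times> real \<Rightarrow> real \<times> real \<Rightarrow> complex" where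
  "bez D c X Y = bdd1 D (coeff_R c) X Y * bdd2 D (coeff_Q c) X Y
               - bdd2 D (coeff_R c) X Y * bdd1 D (coeff_Q c) X Y"

lemma bez_diag: "bez D c X X = of_real (jac D c (fst X) (snd X))"
proof -
  have R: "coeff_R c = (\<lambda>i j. coeff_P c i j + coeff_Q c i j)" by (simp add: coeff_R_def fun_eq_iff)
  show ?thesis by (simp add: bez_def bdd_diag jac_def R bip_add algebra_simps)
qed

text \<open>
  At two distinct zeros the two rows of divided differences are orthogonal to the nonzero vector
  \<open>X - Y\<close>.
\<close>

lemma bez_off_diagonal:
  assumes "X \<noteq> Y"
    and "bip D (coeff_P c) (fst X) (snd X) = 0" "bip D (coeff_Q c) (fst X) (snd X) = 0"
    and "bip D (coeff_P c) (fst Y) (snd Y) = 0" "bip D (coeff_Q c) (fst Y) (snd Y) = 0"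
  shows "bez D c X Y = 0"
proof -
  define u v :: complex where "u = of_real (fst X - fst Y)" and "v = of_real (snd X - snd Y)"
  have R: "coeff_R c = (\<lambda>i j. coeff_P c i j + coeff_Q c i j)" by (simp add: coeff_R_def fun_eq_iff)
  have 1: "u * bdd1 D (coeff_R c) X Y + v * bdd2 D (coeff_R c) X Y = 0"
    unfolding u_def v_def bdd_eq by (simp add: R bip_add assms)
  have 2: "u * bdd1 D (coeff_Q c) X Y + v * bdd2 D (coeff_Q c) X Y = 0"
    unfolding u_def v_def bdd_eq by (simp add: assms)
  have "u * bez D c X Y = (u * bdd1 D (coeff_R c) X Y + v * bdd2 D (coeff_R c) X Y) * bdd2 D (coeff_Q c) X Y
     - bdd2 D (coeff_R c) X Y * (u * bdd1 D (coeff_Q c) X Y + v * bdd2 D (coeff_Q c) X Y)"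
    by (simp add: bez_def algebra_simps)
  moreover have "v * bez D c X Y = bdd1 D (coeff_R c) X Y * (u * bdd1 D (coeff_Q c) X Y + v * bdd2 D (coeff_Q c) X Y)
     - (u * bdd1 D (coeff_R c) X Y + v * bdd2 D (coeff_R c) X Y) * bdd1 D (coeff_Q c) X Y"
    by (simp add: bez_def algebra_simps)
  ultimately have "u * bez D c X Y = 0" "v * bez D c X Y = 0" unfolding 1 2 by simp_all
  moreover have "u \<noteq> 0 \<or> v \<noteq> 0" using assms(1) by (auto simp: u_def v_def prod_eq_iff)
  ultimately show ?thesis by auto
qed

lemma kernel_span_bdd: "kernel_span (\<lambda>a b. a + b < D) (bdd1 D c)" "kernel_span (\<lambda>a b. a + b < D) (bdd2 D c)"
proof -
  have "kernel_span (\<lambda>a b. a + b < D) (\<lambda>X Y. of_real (c (fst q) (snd q)) * dd1 (fst q) (snd q) X Y)"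
       "kernel_span (\<lambda>a b. a + b < D) (\<lambda>X Y. of_real (c (fst q) (snd q)) * dd2 (fst q) (snd q) X Y)"
    if "q \<in> exponents (Suc D)" for q
    using that
    by (auto intro!: kernel_span_cmult kernel_span_weaken[OF kernel_span_dd1] kernel_span_weaken[OF kernel_span_dd2] simp: exponents_def)
  then show "kernel_span (\<lambda>a b. a + b < D) (bdd1 D c)" "kernel_span (\<lambda>a b. a + b < D) (bdd2 D c)"
    unfolding bdd1_def bdd2_def case_prod_unfold by (auto intro!: kernel_span_sum)
qed

lemma kernel_span_bez: "kernel_span (\<lambda>a b. a + b < 2 * D - 1) (bez D c)"
  unfolding bez_def
  by (intro kernel_span_diff kernel_span_mult[OF kernel_span_bdd(1) kernel_span_bdd(2)] kernel_span_mult[OF kernel_span_bdd(2) kernel_span_bdd(1)])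
    linarith+

text \<open>
  The leading form of \<open>F\<close> at \<open>x = 1\<close>.
\<close>

definition top_poly :: "nat \<Rightarrow> (nat \<Rightarrow> nat \<Rightarrow> real) \<Rightarrow> complex poly" where
  "top_poly D c = (\<Sum>k\<le>D. monom (of_real (c (D - k) k)) k)"

lemma coeff_top_poly: "coeff (top_poly D c) k = (if k \<le> D then of_real (c (D - k) k) else 0)"
  by (simp add: top_poly_def coeff_sum sum.delta')

lemma degree_top_poly: "degree (top_poly D c) \<le> D"
  by (intro degree_le) (simp add: coeff_top_poly)

lemma bdd_split:
  assumes "D = Suc m"
  obtains l1 l2 where "kernel_span (\<lambda>a b. a + b < m) l1" "kernel_span (\<lambda>a b. a + b < m) l2"
    "\<And>X Y. bdd1 D c X Y = form_dd1 D (top_poly D c) X Y + l1 X Y"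
    "\<And>X Y. bdd2 D c X Y = form_dd2 D (top_poly D c) X Y + l2 X Y"
proof
  have "bdd1 m c X Y = (\<Sum>(i,j)\<in>exponents D. of_real (c i j) * dd1 i j X Y)"
       "bdd2 m c X Y = (\<Sum>(i,j)\<in>exponents D. of_real (c i j) * dd2 i j X Y)" for X Y
    by (simp_all add: bdd1_def bdd2_def assms)
  then show "bdd1 D c X Y = form_dd1 D (top_poly D c) X Y + bdd1 m c X Y"
    "bdd2 D c X Y = form_dd2 D (top_poly D c) X Y + bdd2 m c X Y" for X Y
    by (simp_all add: bdd1_def[of D] bdd2_def[of D] sum_exponents_Suc form_dd1_def form_dd2_def coeff_top_poly)
qed (rule kernel_span_bdd)+

lemma top_poly_R: "top_poly D (coeff_R c) = smult (of_nat (D + 2)) (top_poly D c)"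
  by (rule poly_eqI) (auto simp: coeff_top_poly coeff_R_def coeff_P_def coeff_Q_def of_nat_diff algebra_simps)

lemma top_poly_Q:
  "top_poly D (coeff_Q c) = smult (of_nat (Suc D)) (top_poly D c) - pCons 0 (pderiv (top_poly D c))"
proof (rule poly_eqI)
  fix k
  show "coeff (top_poly D (coeff_Q c)) k =
      coeff (smult (of_nat (Suc D)) (top_poly D c) - pCons 0 (pderiv (top_poly D c))) k"
    by (cases k) (auto simp: coeff_top_poly coeff_Q_def coeff_pderiv of_nat_diff algebra_simps coeff_eq_0)
qed

text \<open>
  The leading form splits over the complex numbers into the factors \<open>y - t\<^sub>i x\<close>.  The nonzero coefficient
  of \<open>y\<^sup>D\<close> excludes the factor \<open>x\<close>.
\<close>

locale split_top_form =
  fixes m :: nat and c :: "nat \<Rightarrow> nat \<Rightarrow> real" and t :: "nat \<Rightarrow> complex"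
  assumes c_nz: "c 0 (Suc m) \<noteq> 0"
    and split: "smult (of_real (c 0 (Suc m))) (\<Prod>i<Suc m. [:- t i, 1:]) = top_poly (Suc m) c"
begin

definition cofactor :: "nat \<Rightarrow> complex poly" where
  "cofactor i = smult (of_real (c 0 (Suc m))) (\<Prod>j\<in>{..<Suc m} - {i}. [:- t j, 1:])"

lemma top_poly_factor:
  assumes "i < Suc m"
  shows "top_poly (Suc m) c = [:- t i, 1:] * cofactor i"
  unfolding split[symmetric] cofactor_def using assms by (subst prod.remove[of _ i]) auto

lemma degree_cofactor: 
  assumes "i < Suc m" shows "degree (cofactor i) \<le> m"
proof -
  have "degree (cofactor i) = card ({..<Suc m} - {i})"
    unfolding cofactor_def using c_nz by (simp add: degree_prod_sum_eq)
  with assms show ?thesis by simp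
qed

lemma pderiv_top_poly: "pderiv (top_poly (Suc m) c) = (\<Sum>i<Suc m. cofactor i)"
proof -
  have "smult a (\<Sum>i\<in>I. f i) = (\<Sum>i\<in>I. smult a (f i))" for a :: complex and f I
    by (induction I rule: infinite_finite_induct) (simp_all add: smult_add_right)
  then show ?thesis
    unfolding split[symmetric] cofactor_def pderiv_smult pderiv_prod
    by (simp add: pderiv_pCons del: sum.lessThan_Suc prod.lessThan_Suc)
qed

text \<open>
  For a product \<open>f\<close> of factors \<open>y - t\<^sub>i x\<close> the derivative \<open>x f\<^sub>x\<close> is the sum of the \<open>- t\<^sub>i x L\<^sub>i\<close>, also when
  roots are repeated.
\<close>

lemma top_poly_Q_roots:
  "top_poly (Suc m) (coeff_Q c) = top_poly (Suc m) c - (\<Sum>i<Suc m. smult (t i) (cofactor i))"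
proof -
  have eq: "pCons 0 (cofactor i) = top_poly (Suc m) c + smult (t i) (cofactor i)" if "i < Suc m" for i
    using top_poly_factor[OF that] by simp
  have "pCons 0 (pderiv (top_poly (Suc m) c)) = [:0, 1:] * (\<Sum>i<Suc m. cofactor i)"
    unfolding pderiv_top_poly by simp
  also have "\<dots> = (\<Sum>i<Suc m. pCons 0 (cofactor i))"
    unfolding sum_distrib_left by (intro sum.cong) auto
  also have "\<dots> = (\<Sum>i<Suc m. top_poly (Suc m) c + smult (t i) (cofactor i))"
    by (intro sum.cong) (simp_all add: eq)
  also have "\<dots> = smult (of_nat (Suc m)) (top_poly (Suc m) c) + (\<Sum>i<Suc m. smult (t i) (cofactor i))"
    by (simp only: sum.distrib sum_constant card_lessThan) (simp add: of_nat_poly)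
  finally have "pCons 0 (pderiv (top_poly (Suc m) c)) =
      smult (of_nat (Suc m)) (top_poly (Suc m) c) + (\<Sum>i<Suc m. smult (t i) (cofactor i))" .
  moreover have "smult (of_nat (Suc (Suc m))) p = p + smult (of_nat (Suc m)) p" for p :: "complex poly"
    by (metis of_nat_Suc smult_1_left smult_add_left)
  ultimately show ?thesis unfolding top_poly_Q by (simp only: add_diff_add diff_self add_0_right) simp
qed

abbreviation L :: "nat \<Rightarrow> real \<times> real \<Rightarrow> complex" where
  "L i \<equiv> form m (cofactor i)"

text \<open>
  The leading parts of \<open>P + Q\<close> and \<open>Q\<close> are \<open>(D + 2) f\<close> and \<open>f + x f\<^sub>x\<close>, where the summand \<open>f\<close> contributes
  nothing to a Bezoutian with \<open>f\<close>.  So the leading part of the Bezoutian is a sum over the roots of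
  Bezoutians of \<open>f\<close> and \<open>x L\<^sub>i\<close>.
\<close>

lemma bez_top:
  obtains E where "kernel_span (\<lambda>a b. a < m \<or> b < m) E"
    "\<And>X Y. bez (Suc m) c X Y = of_nat (m + 3) * (\<Sum>i<Suc m. t i * L i X * L i Y) + E X Y"
proof -
  let ?D = "Suc m"
  let ?\<phi> = "top_poly ?D c" and ?\<rho> = "top_poly ?D (coeff_R c)" and ?\<chi> = "top_poly ?D (coeff_Q c)"
  obtain l1 l2 where l: "kernel_span (\<lambda>a b. a + b < m) l1" "kernel_span (\<lambda>a b. a + b < m) l2"
    "\<And>X Y. bdd1 ?D (coeff_R c) X Y = form_dd1 ?D ?\<rho> X Y + l1 X Y"
    "\<And>X Y. bdd2 ?D (coeff_R c) X Y = form_dd2 ?D ?\<rho> X Y + l2 X Y"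
    using bdd_split[OF HOL.refl] by blast
  obtain k1 k2 where k: "kernel_span (\<lambda>a b. a + b < m) k1" "kernel_span (\<lambda>a b. a + b < m) k2"
    "\<And>X Y. bdd1 ?D (coeff_Q c) X Y = form_dd1 ?D ?\<chi> X Y + k1 X Y"
    "\<And>X Y. bdd2 ?D (coeff_Q c) X Y = form_dd2 ?D ?\<chi> X Y + k2 X Y"
    using bdd_split[OF HOL.refl] by blast
  define E1 where "E1 X Y = (l1 X Y * bdd2 ?D (coeff_Q c) X Y + form_dd1 ?D ?\<rho> X Y * k2 X Y)
      - (l2 X Y * bdd1 ?D (coeff_Q c) X Y + form_dd2 ?D ?\<rho> X Y * k1 X Y)" for X Y
  have E1: "kernel_span (\<lambda>a b. a < m \<or> b < m) E1"
    unfolding E1_def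
    by (intro kernel_span_diff kernel_span.add
        kernel_span_mult[OF l(1) kernel_span_bdd(2)] kernel_span_mult[OF kernel_span_form_dd(1) k(2)]
        kernel_span_mult[OF l(2) kernel_span_bdd(1)] kernel_span_mult[OF kernel_span_form_dd(2) k(1)]) linarith+
  define G where "G i X Y = of_real (snd X) * form_dd2 m (cofactor i) X Y * L i X
        + L i Y * of_real (fst Y) * form_dd1 m (cofactor i) X Y" for i X Y
  have G: "kernel_span (\<lambda>a b. a < m \<or> b < m) (G i)" for i
  proof -
    have "kernel_span (\<lambda>a b. b < m) (\<lambda>X Y. of_real (snd X) * form_dd2 m (cofactor i) X Y)"
      using kernel_span_mult_monomial[OF kernel_span_form_dd(2), of m "\<lambda>a b. b < m" 0 1 0 0 1 "cofactor i"] by simp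
    then have 1: "kernel_span (\<lambda>a b. a < m \<or> b < m)
        (\<lambda>X Y. of_real (snd X) * form_dd2 m (cofactor i) X Y * L i X)"
      by (rule kernel_span_mult[OF _ kernel_span_form(1)]) auto
    have "kernel_span (\<lambda>a b. a < m) (\<lambda>X Y. of_real (fst Y) * form_dd1 m (cofactor i) X Y)"
      using kernel_span_mult_monomial[OF kernel_span_form_dd(1), of m "\<lambda>a b. a < m" 0 0 1 0 1 "cofactor i"] by simp
    then have "kernel_span (\<lambda>a b. a < m \<or> b < m)
        (\<lambda>X Y. L i Y * (of_real (fst Y) * form_dd1 m (cofactor i) X Y))"
      by (rule kernel_span_mult[OF kernel_span_form(2)]) auto
    with 1 show ?thesis unfolding G_def mult.assoc by (rule kernel_span.add)
  qed
  define E where "E X Y = of_nat (m + 3) * (\<Sum>i<Suc m. t i * G i X Y) + E1 X Y" for X Y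
  show ?thesis
  proof (rule that)
    show "kernel_span (\<lambda>a b. a < m \<or> b < m) E"
      unfolding E_def by (intro kernel_span.add E1 kernel_span_cmult kernel_span_sum G)
    fix X Y
    let ?f1 = "form_dd1 ?D ?\<phi> X Y" and ?f2 = "form_dd2 ?D ?\<phi> X Y"
    have det: "?f1 * form_dd2 ?D (cofactor i) X Y - ?f2 * form_dd1 ?D (cofactor i) X Y =
        - (L i X * L i Y + G i X Y)" if "i < Suc m" for i
      unfolding G_def using linear_factor(2)[OF degree_cofactor top_poly_factor, OF that that] by simp
    have "bez ?D c X Y = form_dd1 ?D ?\<rho> X Y * form_dd2 ?D ?\<chi> X Y
        - form_dd2 ?D ?\<rho> X Y * form_dd1 ?D ?\<chi> X Y + E1 X Y"
      unfolding bez_def E1_def l k by (simp add: algebra_simps)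
    also have "form_dd1 ?D ?\<rho> X Y * form_dd2 ?D ?\<chi> X Y
        - form_dd2 ?D ?\<rho> X Y * form_dd1 ?D ?\<chi> X Y =
      - of_nat (m + 3) * (?f1 * (\<Sum>i<Suc m. t i * form_dd2 ?D (cofactor i) X Y)
         - ?f2 * (\<Sum>i<Suc m. t i * form_dd1 ?D (cofactor i) X Y))"
      unfolding top_poly_R top_poly_Q_roots form_linear form_sum
      by (simp add: algebra_simps del: sum.lessThan_Suc)
    also have "?f1 * (\<Sum>i<Suc m. t i * form_dd2 ?D (cofactor i) X Y)
         - ?f2 * (\<Sum>i<Suc m. t i * form_dd1 ?D (cofactor i) X Y) =
       (\<Sum>i<Suc m. t i * (?f1 * form_dd2 ?D (cofactor i) X Y - ?f2 * form_dd1 ?D (cofactor i) X Y))"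
      unfolding sum_distrib_left sum_subtractf[symmetric] by (intro sum.cong) (auto simp: algebra_simps)
    also have "\<dots> = - (\<Sum>i<Suc m. t i * (L i X * L i Y + G i X Y))"
      unfolding sum_negf[symmetric] by (intro sum.cong HOL.refl) (simp add: det right_diff_distrib distrib_left)
    finally show "bez ?D c X Y = of_nat (m + 3) * (\<Sum>i<Suc m. t i * L i X * L i Y) + E X Y"
      unfolding E_def by (simp add: algebra_simps sum.distrib del: sum.lessThan_Suc)
  qed
qed

end

section \<open>Upper bounds for nondegenerate extrema\<close>

lemma form_top_poly_real:
  "form D (top_poly D c) X = of_real (\<Sum>k\<le>D. c (D - k) k * (fst X ^ (D - k) * snd X ^ k))"
  by (simp add: form_def coeff_top_poly)

lemma bip_Suc_split:
  "of_real (bip (Suc m) c (fst X) (snd X)) =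
   form (Suc m) (top_poly (Suc m) c) X + of_real (bip m c (fst X) (snd X))"
  unfolding form_top_poly_real by (simp add: bip_def sum_exponents_Suc[of _ "Suc m"] del: sum.atMost_Suc)

lemma annihilates_bip:
  assumes "annihilates (Suc D) S \<mu>"
  shows "(\<Sum>p\<in>S. \<mu> p * bip D c (fst p) (snd p)) = 0"
proof -
  have "(\<Sum>p\<in>S. \<mu> p * bip D c (fst p) (snd p)) =
      (\<Sum>(i,j)\<in>exponents (Suc D). c i j * (\<Sum>p\<in>S. \<mu> p * (fst p ^ i * snd p ^ j)))"
    unfolding bip_def sum_distrib_left case_prod_unfold
    by (subst sum.swap) (simp add: algebra_simps)
  also have "\<dots> = 0" using assms by (intro sum.neutral) (auto simp: exponents_def annihilates_def)
  finally show ?thesis .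
qed

context split_top_form
begin

abbreviation f_top :: "real \<times> real \<Rightarrow> complex" where
  "f_top \<equiv> form (Suc m) (top_poly (Suc m) c)"

lemma f_top_factor:
  assumes "i < Suc m"
  shows "f_top X = (of_real (snd X) - t i * of_real (fst X)) * L i X"
  by (rule linear_factor(1)[OF degree_cofactor top_poly_factor, OF assms assms])

lemma f_top_real: "cnj (f_top X) = f_top X"
  unfolding form_top_poly_real by simp

lemma cnj_root:
  assumes "i < Suc m" shows "cnj (t i) \<in> t ` {..<Suc m}"
proof -
  have root: "poly (top_poly (Suc m) c) z = 0 \<longleftrightarrow> z \<in> t ` {..<Suc m}" for z
    unfolding split[symmetric] using c_nz by (auto simp: poly_prod simp del: prod.lessThan_Suc)
  have "poly (top_poly (Suc m) c) (cnj (t i)) = cnj (poly (top_poly (Suc m) c) (t i))"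
    by (rule poly_cnj_real[symmetric]) (simp add: coeff_top_poly)
  moreover have "poly (top_poly (Suc m) c) (t i) = 0" using root assms by blast
  ultimately show ?thesis using root by simp
qed

text \<open>
  Off the line \<open>y = t\<^sub>i x\<close> the cofactor is a quotient of real numbers; on that line the claim follows by
  continuity.
\<close>

lemma L_real:
  assumes "i < Suc m" "Im (t i) = 0"
  shows "Im (L i X) = 0"
proof -
  define g where "g y = Im (L i (fst X, y))" for y
  have "continuous_on UNIV g" unfolding g_def form_def by (auto intro!: continuous_intros)
  then have "closed {y. g y = 0}"
    by (intro closed_Collect_eq) auto
  moreover have "- {Re (t i) * fst X} \<subseteq> {y. g y = 0}"
  proof clarify
    fix y assume y: "y \<noteq> Re (t i) * fst X"
    have t: "t i = of_real (Re (t i))" using assms(2) by (simp add: complex_eq_iff)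
    have "of_real (y - Re (t i) * fst X) * L i (fst X, y) = f_top (fst X, y)"
      using f_top_factor[OF assms(1), of "(fst X, y)"] t by (metis fst_conv of_real_diff of_real_mult snd_conv)
    moreover have "Im (f_top (fst X, y)) = 0" unfolding form_top_poly_real by simp
    ultimately have "(y - Re (t i) * fst X) * g y = 0" unfolding g_def by (metis Im_complex_of_real add_0 mult_zero_left
      times_complex.sel(2) Re_complex_of_real add.right_neutral)
    then show "g y = 0" using y by simp
  qed
  ultimately have "closure (- {Re (t i) * fst X}) \<subseteq> {y. g y = 0}" by (rule closure_minimal[rotated])
  then have "g (snd X) = 0" by (auto simp: closure_complement)
  then show ?thesis by (simp add: g_def)
qed

text \<open>
  A cofactor of a nonreal root is a function of the root alone, not of its index, wherever \<open>x \<noteq> 0\<close>.  This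
  makes it possible to impose one condition for each pair of conjugate roots without a bookkeeping of
  multiplicities.
\<close>

definition quot :: "complex \<Rightarrow> real \<times> real \<Rightarrow> complex" where
  "quot z X = f_top X / (of_real (snd X) - z * of_real (fst X))"

lemma L_eq_quot:
  assumes "i < Suc m" "Im (t i) \<noteq> 0" "fst X \<noteq> 0"
  shows "L i X = quot (t i) X"
proof -
  have "Im (of_real (snd X) - t i * of_real (fst X)) \<noteq> 0" using assms by simp
  then have "of_real (snd X) - t i * of_real (fst X) \<noteq> 0" by (metis zero_complex.sel(2))
  then show ?thesis unfolding quot_def f_top_factor[OF assms(1)] by simp
qed

lemma quot_cnj: "quot (cnj z) X = cnj (quot z X)"
  unfolding quot_def by (simp add: f_top_real)

definition upper :: "complex set" where
  "upper = {z \<in> t ` {..<Suc m}. Im z > 0}"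

lemma finite_upper: "finite upper" by (simp add: upper_def)

text \<open>
  Suppose that the form in the weights reduces to the sum over the roots of \<open>w(t\<^sub>i) \<Lambda>\<^sub>i\<^sup>2\<close>, where the linear
  functionals \<open>\<Lambda>\<^sub>i\<close> of conjugate roots are conjugate.  A root \<open>z\<close> in the upper half plane contributes a
  nonpositive real part as soon as \<open>csqrt (w z) \<Lambda>\<close> is purely imaginary, and then so does \<open>cnj z\<close>.  A real
  root contributes nothing positive if \<open>w(t\<^sub>i) \<le> 0\<close>; otherwise \<open>\<Lambda>\<^sub>i = 0\<close> is imposed.
\<close>

lemma card_le_of_top_form:
  fixes w :: "complex \<Rightarrow> complex" and g :: "real \<times> real \<Rightarrow> real"
  assumes "finite S" and x_nz: "\<And>p. p \<in> S \<Longrightarrow> fst p \<noteq> 0"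
    and w: "\<And>z. w (cnj z) = cnj (w z)"
    and off: "\<And>p q. p \<in> S \<Longrightarrow> q \<in> S \<Longrightarrow> p \<noteq> q \<Longrightarrow> K p q = 0"
    and diag: "\<And>p. p \<in> S \<Longrightarrow> Re (K p p) > 0"
    and form: "\<And>\<mu>. annihilates d S \<mu> \<Longrightarrow>
        (\<Sum>p\<in>S. \<Sum>q\<in>S. of_real (\<mu> p) * of_real (\<mu> q) * K p q) =
        of_nat (m + 3) * (\<Sum>i<Suc m. w (t i) * (\<Sum>p\<in>S. of_real (\<mu> p) * (of_real (g p) * L i p))\<^sup>2)"
  shows "card S \<le> d * (d + 1) div 2 +
    (card upper + card {i \<in> {..<Suc m}. Im (t i) = 0 \<and> Re (w (t i)) > 0})"
proof -
  define N where "N = {i \<in> {..<Suc m}. Im (t i) = 0 \<and> Re (w (t i)) > 0}"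
  define h where "h v p = (case v of Inl z \<Rightarrow> Re (csqrt (w z) * (of_real (g p) * quot z p))
      | Inr i \<Rightarrow> g p * Re (L i p))" for v p
  have "card S \<le> d * (d + 1) div 2 + card (upper <+> N)"
  proof (rule card_le_of_kernel[where K = K and h = h])
    show "finite (upper <+> N)" using finite_upper by (simp add: N_def)
    fix \<mu> assume k: "annihilates d S \<mu>" and h: "\<And>v. v \<in> upper <+> N \<Longrightarrow> (\<Sum>p\<in>S. \<mu> p * h v p) = 0"
    define M where "M i = (\<Sum>p\<in>S. of_real (\<mu> p) * (of_real (g p) * L i p))" for i
    have up: "Re (w z * (\<Sum>p\<in>S. of_real (\<mu> p) * (of_real (g p) * quot z p))\<^sup>2) \<le> 0"
      if "z \<in> upper" for z
    proof -
      let ?q = "\<Sum>p\<in>S. of_real (\<mu> p) * (of_real (g p) * quot z p)"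
      have "(\<Sum>p\<in>S. \<mu> p * h (Inl z) p) = 0" using h that by blast
      moreover have "(\<Sum>p\<in>S. \<mu> p * h (Inl z) p) = Re (csqrt (w z) * ?q)"
        by (simp add: h_def sum_distrib_left Re_sum algebra_simps)
      ultimately have "Re (csqrt (w z) * ?q) = 0" by simp
      moreover have "w z * ?q\<^sup>2 = (csqrt (w z) * ?q)\<^sup>2" by (simp add: power_mult_distrib)
      ultimately show ?thesis by (simp only: Re_power2) simp
    qed
    have "Re (w (t i) * (M i)\<^sup>2) \<le> 0" if i: "i < Suc m" for i
    proof -
      consider "Im (t i) > 0" | "Im (t i) < 0" | "Im (t i) = 0" by linarith
      then show ?thesis
      proof cases
        case 1
        then have "t i \<in> upper" using i by (auto simp: upper_def)
        moreover have "M i = (\<Sum>p\<in>S. of_real (\<mu> p) * (of_real (g p) * quot (t i) p))"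
          unfolding M_def using L_eq_quot[OF i] x_nz 1 by (intro sum.cong) auto
        ultimately show ?thesis using up by simp
      next
        case 2
        \<comment> \<open>The condition imposed for the conjugate root in the upper half plane serves for \<open>t i\<close> too.\<close>
    define z where "z = cnj (t i)"
        have tz: "t i = cnj z" by (simp add: z_def)
        have "z \<in> upper" using 2 cnj_root[OF i] by (auto simp: upper_def z_def)
        have "M i = (\<Sum>p\<in>S. of_real (\<mu> p) * (of_real (g p) * quot (t i) p))"
          unfolding M_def using L_eq_quot[OF i] x_nz 2 by (intro sum.cong) auto
        also have "\<dots> = cnj (\<Sum>p\<in>S. of_real (\<mu> p) * (of_real (g p) * quot z p))"
          by (simp add: tz quot_cnj)
        finally have "w (t i) * (M i)\<^sup>2 =
            cnj (w z * (\<Sum>p\<in>S. of_real (\<mu> p) * (of_real (g p) * quot z p))\<^sup>2)"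
          by (simp add: tz w)
        then show ?thesis using up[OF \<open>z \<in> upper\<close>] by (simp only: cnj.sel)
      next
        case 3
        have "w (t i) = cnj (w (t i))" using 3 w[of "t i"] by (metis complex_cnj_cancel_iff complex_eq_iff cnj.sel minus_zero)
        then have Imw: "Im (w (t i)) = 0" by (metis cnj.sel(2) equal_neg_zero)
        have ImM: "Im (M i) = 0" unfolding M_def using L_real[OF i 3] by (simp add: Im_sum)
        have ReM: "Re (M i) = (\<Sum>p\<in>S. \<mu> p * (g p * Re (L i p)))"
          unfolding M_def by (simp add: Re_sum)
        show ?thesis
        proof (cases "i \<in> N")
          case True
          then have "(\<Sum>p\<in>S. \<mu> p * h (Inr i) p) = 0" using h by blast
          then have "Re (M i) = 0" unfolding ReM by (simp add: h_def)
          then have "M i = 0" using ImM by (simp add: complex_eq_iff)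
          then show ?thesis by simp
        next
          case False
          then have "Re (w (t i)) \<le> 0" using i 3 by (auto simp: N_def)
          then show ?thesis using Imw ImM
            by (simp add: power2_eq_square mult_nonpos_nonneg)
        qed
      qed
    qed
    then have "Re (\<Sum>i<Suc m. w (t i) * (M i)\<^sup>2) \<le> 0"
      unfolding Re_sum by (intro sum_nonpos) auto
    then have "real (m + 3) * Re (\<Sum>i<Suc m. w (t i) * (M i)\<^sup>2) \<le> 0"
      by (intro mult_nonneg_nonpos) auto
    moreover have "Re (of_nat (m + 3) * z) = real (m + 3) * Re z" for z by (simp add: algebra_simps)
    ultimately show "Re (\<Sum>p\<in>S. \<Sum>q\<in>S. of_real (\<mu> p) * of_real (\<mu> q) * K p q) \<le> 0"
      unfolding form[OF k] M_def[symmetric] by metis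
  qed (use assms in auto)
  also have "card (upper <+> N) = card upper + card N"
    by (rule card_Plus) (use finite_upper in \<open>auto simp: N_def\<close>)
  finally show ?thesis unfolding N_def .
qed

end

text \<open>
  \<open>S\<close> is a set of nondegenerate extrema of \<open>x y F\<close> off the axes.
\<close>

locale nondegenerate_extrema = split_top_form +
  fixes S :: "(real \<times> real) set"
  assumes finite_S: "finite S"
    and P_zero: "p \<in> S \<Longrightarrow> bip (Suc m) (coeff_P c) (fst p) (snd p) = 0"
    and Q_zero: "p \<in> S \<Longrightarrow> bip (Suc m) (coeff_Q c) (fst p) (snd p) = 0"
    and hess_pos: "p \<in> S \<Longrightarrow> - (fst p * snd p) * jac (Suc m) c (fst p) (snd p) > 0"
begin

lemma bez_off: "p \<in> S \<Longrightarrow> q \<in> S \<Longrightarrow> p \<noteq> q \<Longrightarrow> bez (Suc m) c p q = 0"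
  by (rule bez_off_diagonal) (auto intro: P_zero Q_zero)

text \<open>
  The Bezoutian times a linear form has total degree at most \<open>2 D - 1\<close>, so each of its monomials has
  degree below \<open>D\<close> in one of the points.
\<close>

lemma card_half_plane:
  assumes "T \<subseteq> S"
    and pos: "\<And>p. p \<in> T \<Longrightarrow> (\<alpha> * fst p + \<beta> * snd p) * jac (Suc m) c (fst p) (snd p) > 0"
  shows "card T \<le> Suc m * (Suc m + 1) div 2"
proof -
  let ?K = "\<lambda>X Y. (of_real \<alpha> * of_real (fst X) + of_real \<beta> * of_real (snd X)) * bez (Suc m) c X Y"
  have span: "kernel_span (\<lambda>a b. a < Suc m \<or> b < Suc m) ?K"
  proof -
    have shift: "kernel_span (\<lambda>a b. a < Suc m \<or> b < Suc m)
        (\<lambda>X Y. (z * (of_real (fst X) ^ k * of_real (snd X) ^ l) *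
           (of_real (fst Y) ^ 0 * of_real (snd Y) ^ 0)) * bez (Suc m) c X Y)"
      if "k + l = 1" for k l z
      by (rule kernel_span_mult_monomial[OF kernel_span_bez]) (use that in arith)
    have "kernel_span (\<lambda>a b. a < Suc m \<or> b < Suc m) (\<lambda>X Y. (of_real \<alpha> * of_real (fst X)) * bez (Suc m) c X Y)"
      using shift[of 1 0 "of_real \<alpha>"]
      by simp
    moreover have "kernel_span (\<lambda>a b. a < Suc m \<or> b < Suc m) (\<lambda>X Y. (of_real \<beta> * of_real (snd X)) * bez (Suc m) c X Y)"
      using shift[of 0 1 "of_real \<beta>"]
      by simp
    ultimately show ?thesis unfolding distrib_right by (rule kernel_span.add)
  qed
  have "card T \<le> Suc m * (Suc m + 1) div 2 + card ({} :: nat set)"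
  proof (rule card_le_of_kernel[where K = ?K and h = "\<lambda>_ _. 0"])
    show "finite T" using assms(1) finite_S by (rule finite_subset)
    show "?K p q = 0" if "p \<in> T" "q \<in> T" "p \<noteq> q" for p q
      using bez_off[of p q] that subsetD[OF assms(1)] by auto
    show "Re (?K p p) > 0" if "p \<in> T" for p
      using pos[OF that] by (simp add: bez_diag)
    show "Re (\<Sum>p\<in>T. \<Sum>q\<in>T. of_real (\<mu> p) * of_real (\<mu> q) * ?K p q) \<le> 0"
      if "annihilates (Suc m) T \<mu>" for \<mu>
      using kernel_span_pairing_zero[OF span that] by simp
  qed auto
  then show ?thesis by simp
qed

text \<open>
  The case of the Bezoutian itself, with weights that annihilate degrees below \<open>D - 1\<close>.  The sign \<open>\<sigma>\<close>
  selects the pair of opposite quadrants.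
\<close>

lemma card_diagonal_quadrants:
  assumes "T \<subseteq> S" and pos: "\<And>p. p \<in> T \<Longrightarrow> \<sigma> * jac (Suc m) c (fst p) (snd p) > 0"
  shows "card T \<le> m * (m + 1) div 2 +
    (card upper + card {i \<in> {..<Suc m}. Im (t i) = 0 \<and> \<sigma> * Re (t i) > 0})"
proof -
  obtain E where E: "kernel_span (\<lambda>a b. a < m \<or> b < m) E"
    "\<And>X Y. bez (Suc m) c X Y = of_nat (m + 3) * (\<Sum>i<Suc m. t i * L i X * L i Y) + E X Y"
    using bez_top by blast
  have fT: "finite T" using assms(1) finite_S by (rule finite_subset)
  have "card T \<le> m * (m + 1) div 2 +
    (card upper + card {i \<in> {..<Suc m}. Im (t i) = 0 \<and> Re (of_real \<sigma> * t i) > 0})"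
  proof (rule card_le_of_top_form[where K = "\<lambda>X Y. of_real \<sigma> * bez (Suc m) c X Y" and g = "\<lambda>_. 1"
        and w = "\<lambda>z. of_real \<sigma> * z"])
    show "fst p \<noteq> 0" if "p \<in> T" for p using that hess_pos[of p] assms(1) by auto
    show "of_real \<sigma> * bez (Suc m) c p q = 0" if "p \<in> T" "q \<in> T" "p \<noteq> q" for p q
      using bez_off[of p q] that subsetD[OF assms(1)] by auto
    show "Re (of_real \<sigma> * bez (Suc m) c p p) > 0" if "p \<in> T" for p
      using pos[OF that] by (simp add: bez_diag)
    fix \<mu> assume k: "annihilates m T \<mu>"
    let ?M = "\<lambda>i. \<Sum>p\<in>T. of_real (\<mu> p) * (of_real 1 * L i p)"
    have "(\<Sum>p\<in>T. \<Sum>q\<in>T. of_real (\<mu> p) * of_real (\<mu> q) * (of_real \<sigma> * bez (Suc m) c p q)) =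
       of_real \<sigma> * ((\<Sum>p\<in>T. \<Sum>q\<in>T. \<Sum>i<Suc m. of_real (\<mu> p) * of_real (\<mu> q) * (of_nat (m + 3) * (t i * L i p * L i q)))
        + (\<Sum>p\<in>T. \<Sum>q\<in>T. of_real (\<mu> p) * of_real (\<mu> q) * E p q))"
      unfolding E(2) sum_distrib_left sum.distrib[symmetric] distrib_left
      by (simp add: mult_ac sum_distrib_left del: sum.lessThan_Suc)
    also have "(\<Sum>p\<in>T. \<Sum>q\<in>T. of_real (\<mu> p) * of_real (\<mu> q) * E p q) = 0"
      by (rule kernel_span_pairing_zero[OF E(1) k])
    also have "(\<Sum>p\<in>T. \<Sum>q\<in>T. \<Sum>i<Suc m. of_real (\<mu> p) * of_real (\<mu> q) * (of_nat (m + 3) * (t i * L i p * L i q)))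
        = (\<Sum>i<Suc m. \<Sum>p\<in>T. \<Sum>q\<in>T. of_real (\<mu> p) * of_real (\<mu> q) * (of_nat (m + 3) * (t i * L i p * L i q)))"
      by (subst sum.swap[of _ T "{..<Suc m}"], subst sum.swap[of _ "{..<Suc m}" T]) (rule HOL.refl)
    also have "\<dots> = (\<Sum>i<Suc m. of_nat (m + 3) * (t i * (?M i)\<^sup>2))"
      unfolding power2_eq_square sum_product unfolding sum_distrib_left
      by (intro sum.cong HOL.refl) (simp add: mult_ac)
    finally show "(\<Sum>p\<in>T. \<Sum>q\<in>T. of_real (\<mu> p) * of_real (\<mu> q) * (of_real \<sigma> * bez (Suc m) c p q)) =
        of_nat (m + 3) * (\<Sum>i<Suc m. of_real \<sigma> * t i * (?M i)\<^sup>2)"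
      by (simp add: sum_distrib_left mult_ac del: sum.lessThan_Suc)
  qed (use fT in auto)
  then show ?thesis by simp
qed

text \<open>
  The kernel \<open>- x y' K\<close> is \<open>- x y J > 0\<close> on the diagonal.  Its relevant part is a multiple of
  the sum of \<open>- t\<^sub>i (x L\<^sub>i)(X) (y L\<^sub>i)(Y)\<close>, and weights that annihilate degrees below \<open>D\<close> do not distinguish
  \<open>y L\<^sub>i\<close> from \<open>t\<^sub>i x L\<^sub>i\<close>: the difference is the leading form of \<open>F\<close>, which at zeros of \<open>P + Q\<close> agrees with a
  polynomial of lower degree.  So real roots enter with the coefficient \<open>- t\<^sub>i\<^sup>2 \<le> 0\<close> and need no condition.
\<close>

lemma card_all:
  "card S \<le> Suc m * (Suc m + 1) div 2 + card upper"
proof -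
  obtain E where E: "kernel_span (\<lambda>a b. a < m \<or> b < m) E"
    "\<And>X Y. bez (Suc m) c X Y = of_nat (m + 3) * (\<Sum>i<Suc m. t i * L i X * L i Y) + E X Y"
    using bez_top by blast
  let ?K = "\<lambda>X Y. - (of_real (fst X) * of_real (snd Y)) * bez (Suc m) c X Y"
  let ?E = "\<lambda>X Y. - (of_real (fst X) * of_real (snd Y)) * E X Y"
  have span: "kernel_span (\<lambda>a b. a < Suc m \<or> b < Suc m) ?E"
    using kernel_span_mult_monomial[OF E(1), of "\<lambda>a b. a < Suc m \<or> b < Suc m" 1 0 0 1 "-1"] by simp
  have "card S \<le> Suc m * (Suc m + 1) div 2 +
    (card upper + card {i \<in> {..<Suc m}. Im (t i) = 0 \<and> Re (- ((t i)\<^sup>2)) > 0})"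
  proof (rule card_le_of_top_form[where K = ?K and g = fst and w = "\<lambda>z. - (z\<^sup>2)"])
    show "fst p \<noteq> 0" if "p \<in> S" for p using that hess_pos[of p] by auto
    show "?K p q = 0" if "p \<in> S" "q \<in> S" "p \<noteq> q" for p q
      using that bez_off by auto
    show "Re (?K p p) > 0" if "p \<in> S" for p
      using hess_pos[OF that] by (simp add: bez_diag)
    fix \<mu> assume k: "annihilates (Suc m) S \<mu>"
    let ?X = "\<lambda>i. \<Sum>p\<in>S. of_real (\<mu> p) * (of_real (fst p) * L i p)"
    let ?Y = "\<lambda>i. \<Sum>p\<in>S. of_real (\<mu> p) * (of_real (snd p) * L i p)"
    have f0: "(\<Sum>p\<in>S. of_real (\<mu> p) * f_top p) = 0"
    proof -
      have "of_nat (m + 3) * f_top p = - of_real (bip m (coeff_R c) (fst p) (snd p))" if "p \<in> S" for p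
      proof -
        have R: "coeff_R c = (\<lambda>i j. coeff_P c i j + coeff_Q c i j)" by (simp add: coeff_R_def fun_eq_iff)
        have "bip (Suc m) (coeff_R c) (fst p) (snd p) = 0"
          unfolding R bip_add using P_zero Q_zero that by simp
        then have "0 = form (Suc m) (top_poly (Suc m) (coeff_R c)) p + of_real (bip m (coeff_R c) (fst p) (snd p))"
          using bip_Suc_split[of m "coeff_R c" p] by simp
        also have "form (Suc m) (top_poly (Suc m) (coeff_R c)) p = of_nat (m + 3) * f_top p"
          unfolding top_poly_R form_linear by (simp add: algebra_simps)
        finally show ?thesis by (simp add: eq_neg_iff_add_eq_0)
      qed
      then have "of_nat (m + 3) * (\<Sum>p\<in>S. of_real (\<mu> p) * f_top p) =
          - (\<Sum>p\<in>S. of_real (\<mu> p) * of_real (bip m (coeff_R c) (fst p) (snd p)))"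
        unfolding sum_distrib_left sum_negf[symmetric] by (intro sum.cong) (simp_all add: mult.left_commute)
      also have "\<dots> = - of_real (\<Sum>p\<in>S. \<mu> p * bip m (coeff_R c) (fst p) (snd p))" by simp
      also have "\<dots> = 0" unfolding annihilates_bip[OF k] by simp
      finally show ?thesis by (simp del: of_nat_add)
    qed
    have Y: "?Y i = t i * ?X i" if "i < Suc m" for i
    proof -
      have "?Y i - t i * ?X i = (\<Sum>p\<in>S. of_real (\<mu> p) * f_top p)"
        unfolding f_top_factor[OF that] sum_distrib_left sum_subtractf[symmetric]
        by (intro sum.cong) (simp_all add: algebra_simps)
      with f0 show ?thesis by simp
    qed
    have "(\<Sum>p\<in>S. \<Sum>q\<in>S. of_real (\<mu> p) * of_real (\<mu> q) * ?K p q) =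
       (\<Sum>p\<in>S. \<Sum>q\<in>S. \<Sum>i<Suc m. - (of_real (\<mu> p) * of_real (\<mu> q) * (of_nat (m + 3) *
          (t i * (of_real (fst p) * L i p) * (of_real (snd q) * L i q)))))
        + (\<Sum>p\<in>S. \<Sum>q\<in>S. of_real (\<mu> p) * of_real (\<mu> q) * ?E p q)"
      unfolding E(2) sum_distrib_left sum.distrib[symmetric] distrib_left
      by (intro sum.cong HOL.refl arg_cong2[where f = "(+)"]) (simp add: mult_ac)
    also have "(\<Sum>p\<in>S. \<Sum>q\<in>S. of_real (\<mu> p) * of_real (\<mu> q) * ?E p q) = 0"
      by (rule kernel_span_pairing_zero[OF span k])
    also have "(\<Sum>p\<in>S. \<Sum>q\<in>S. \<Sum>i<Suc m. - (of_real (\<mu> p) * of_real (\<mu> q) * (of_nat (m + 3) *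
          (t i * (of_real (fst p) * L i p) * (of_real (snd q) * L i q)))))
        = (\<Sum>i<Suc m. \<Sum>p\<in>S. \<Sum>q\<in>S. - (of_real (\<mu> p) * of_real (\<mu> q) * (of_nat (m + 3) *
          (t i * (of_real (fst p) * L i p) * (of_real (snd q) * L i q)))))"
      by (subst sum.swap[of _ S "{..<Suc m}"], subst sum.swap[of _ "{..<Suc m}" S]) (rule HOL.refl)
    also have "\<dots> = (\<Sum>i<Suc m. - (of_nat (m + 3) * (t i * (?X i * ?Y i))))"
      unfolding sum_product unfolding sum_distrib_left unfolding sum_negf[symmetric]
      by (intro sum.cong HOL.refl) (simp add: mult_ac)
    also have "\<dots> = of_nat (m + 3) * (\<Sum>i<Suc m. - ((t i)\<^sup>2) * (?X i)\<^sup>2)"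
      unfolding sum_distrib_left[of "of_nat (m + 3)"]
      by (intro sum.cong HOL.refl) (subst Y, simp, simp add: power2_eq_square mult_ac)
    finally show "(\<Sum>p\<in>S. \<Sum>q\<in>S. of_real (\<mu> p) * of_real (\<mu> q) * ?K p q) =
        of_nat (m + 3) * (\<Sum>i<Suc m. - ((t i)\<^sup>2) * (?X i)\<^sup>2)"
      by (simp del: sum.lessThan_Suc)
  qed (use finite_S in auto)
  moreover have "{i \<in> {..<Suc m}. Im (t i) = 0 \<and> Re (- ((t i)\<^sup>2)) > 0} = {}"
    by (auto simp: not_less)
  ultimately show ?thesis by (metis add.right_neutral card.empty)
qed

lemma card_upper:
  "2 * card upper + card {i \<in> {..<Suc m}. Im (t i) = 0 \<and> \<sigma> * Re (t i) > 0} \<le> Suc m"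
proof -
  define U where "U = {i \<in> {..<Suc m}. Im (t i) > 0}"
  define W where "W = {i \<in> {..<Suc m}. Im (t i) < 0}"
  define N where "N = {i \<in> {..<Suc m}. Im (t i) = 0 \<and> \<sigma> * Re (t i) > 0}"
  have "upper \<subseteq> t ` U" by (auto simp: upper_def U_def)
  then have 1: "card upper \<le> card U"
    by (rule surj_card_le[rotated]) (simp add: U_def)
  have "upper \<subseteq> (cnj \<circ> t) ` W"
  proof
    fix z assume z: "z \<in> upper"
    then obtain i where i: "i < Suc m" "z = t i" by (auto simp: upper_def)
    from cnj_root[OF i(1)] obtain j where "j < Suc m" "cnj z = t j" using i by auto
    then have "j \<in> W" "z = (cnj \<circ> t) j" using z
      by (auto simp: W_def upper_def) (metis cnj.sel(2) neg_less_0_iff_less, metis complex_cnj_cnj)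
    then show "z \<in> (cnj \<circ> t) ` W" by blast
  qed
  then have 2: "card upper \<le> card W"
    by (rule surj_card_le[rotated]) (simp add: W_def)
  have "card U + card W + card N = card (U \<union> W \<union> N)"
    by (subst card_Un_disjoint, (auto simp: U_def W_def N_def)[3])+ simp
  also have "\<dots> \<le> card {..<Suc m}" by (intro card_mono) (auto simp: U_def W_def N_def)
  finally have "card U + card W + card N \<le> Suc m" by simp
  with 1 2 show ?thesis unfolding N_def by linarith
qed

lemma card_diagonal:
  assumes "T \<subseteq> S" and "\<And>p. p \<in> T \<Longrightarrow> \<sigma> * jac (Suc m) c (fst p) (snd p) > 0"
  shows "card S + card T \<le> Suc m * (Suc m + 1)"
proof -
  have "Suc m * (Suc m + 1) div 2 + m * (m + 1) div 2 = Suc m * Suc m"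
  proof -
    have "even (m * (m + 1))" by simp
    then obtain k where k: "m * (m + 1) = 2 * k" by (rule evenE)
    have "Suc m * (Suc m + 1) = 2 * (k + m + 1)" using k by (simp add: algebra_simps)
    then show ?thesis using k by (simp add: algebra_simps)
  qed
  with card_all card_diagonal_quadrants[OF assms] card_upper[of \<sigma>] show ?thesis
    by (simp add: algebra_simps)
qed

end

section \<open>Periodic orbits of planar polynomial Hamiltonian systems\<close>

lemma real_polynomial_function_lipschitz:
  fixes f :: "'a::euclidean_space \<Rightarrow> real"
  assumes "real_polynomial_function f" "bounded B"
  shows "\<exists>C. \<forall>x\<in>B. \<forall>y\<in>B. \<bar>f x - f y\<bar> \<le> C * norm (x - y)"
  using assms(1)
proof induction
  case (linear f)
  then obtain K where "\<And>x. norm (f x) \<le> norm x * K" using bounded_linear.bounded by blast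
  then have "\<bar>f x - f y\<bar> \<le> K * norm (x - y)" for x y
    using linear by (metis bounded_linear.linear linear_diff mult.commute real_norm_def)
  then show ?case by blast
next
  case (const c)
  then show ?case by (intro exI[of _ 0]) simp
next
  case (add f g)
  then obtain C C' where "\<forall>x\<in>B. \<forall>y\<in>B. \<bar>f x - f y\<bar> \<le> C * norm (x - y)"
    "\<forall>x\<in>B. \<forall>y\<in>B. \<bar>g x - g y\<bar> \<le> C' * norm (x - y)" by blast
  then have "\<forall>x\<in>B. \<forall>y\<in>B. \<bar>f x + g x - (f y + g y)\<bar> \<le> (C + C') * norm (x - y)"
    by (smt (verit) distrib_right)
  then show ?case by blast
next
  case (mult f g)
  then obtain C C' where C: "\<forall>x\<in>B. \<forall>y\<in>B. \<bar>f x - f y\<bar> \<le> C * norm (x - y)"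
    "\<forall>x\<in>B. \<forall>y\<in>B. \<bar>g x - g y\<bar> \<le> C' * norm (x - y)" by blast
  have bdd: "\<exists>M. \<forall>x\<in>B. \<bar>h x\<bar> \<le> M" if "real_polynomial_function h" for h :: "'a \<Rightarrow> real"
  proof -
    have "continuous_on (closure B) h"
      using continuous_real_polymonial_function[OF that] by (simp add: continuous_at_imp_continuous_on)
    then have "compact (h ` closure B)"
      using assms(2) by (intro compact_continuous_image) (simp_all add: compact_closure)
    then have "bounded (h ` closure B)" by (rule compact_imp_bounded)
    then obtain M where "\<forall>y\<in>h ` closure B. norm y \<le> M" unfolding bounded_iff by blast
    then show ?thesis using closure_subset[of B] by (intro exI[of _ M]) (auto simp: subset_iff)
  qed
  obtain M M' where M: "\<forall>x\<in>B. \<bar>f x\<bar> \<le> M" "\<forall>x\<in>B. \<bar>g x\<bar> \<le> M'"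
    using bdd mult by meson
  have "\<bar>f x * g x - f y * g y\<bar> \<le> (M * C' + M' * C) * norm (x - y)" if "x \<in> B" "y \<in> B" for x y
  proof -
    have "f x * g x - f y * g y = f x * (g x - g y) + g y * (f x - f y)" by (simp add: algebra_simps)
    also have "\<bar>\<dots>\<bar> \<le> \<bar>f x\<bar> * \<bar>g x - g y\<bar> + \<bar>g y\<bar> * \<bar>f x - f y\<bar>"
      by (metis abs_mult abs_triangle_ineq)
    also have "\<dots> \<le> M * (C' * norm (x - y)) + M' * (C * norm (x - y))"
      using C M that by (intro add_mono mult_mono') auto
    finally show ?thesis by (simp add: algebra_simps)
  qed
  then show ?case by blast
qed

text \<open>
  By the Lipschitz condition the squared distance \<open>u\<close> of the two solutions satisfies
  \<open>\<bar>u'\<bar> \<le> 2 C u\<close>, so \<open>exp (- 2 C t) u\<close> decreases for \<open>t \<ge> 0\<close> and \<open>exp (2 C t) u\<close> increases for \<open>t \<le> 0\<close>.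
\<close>

lemma ode_unique:
  fixes \<gamma> \<delta> :: "real \<Rightarrow> 'a::real_inner"
  assumes g: "\<And>t. (\<gamma> has_vector_derivative X (\<gamma> t)) (at t)"
    and d: "\<And>t. (\<delta> has_vector_derivative X (\<delta> t)) (at t)"
    and lip: "\<And>t. norm (X (\<gamma> t) - X (\<delta> t)) \<le> C * norm (\<gamma> t - \<delta> t)"
    and start: "\<gamma> 0 = \<delta> 0"
  shows "\<gamma> t = \<delta> t"
proof -
  \<comment> \<open>The squared distance, because the distance itself need not be differentiable.\<close>
  define u where "u t = (\<gamma> t - \<delta> t) \<bullet> (\<gamma> t - \<delta> t)" for t
  define u' where "u' t = 2 * ((\<gamma> t - \<delta> t) \<bullet> (X (\<gamma> t) - X (\<delta> t)))" for t
  have du: "(u has_real_derivative u' t) (at t)" for t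
  proof -
    have "((\<lambda>t. \<gamma> t - \<delta> t) has_derivative (\<lambda>s. s *\<^sub>R (X (\<gamma> t) - X (\<delta> t)))) (at t)"
      using has_vector_derivative_diff[OF g d, of t] by (simp add: has_vector_derivative_def)
    from has_derivative_inner[OF this this] show ?thesis
      unfolding u_def u'_def has_field_derivative_def
      by (rule has_derivative_eq_rhs) (simp add: inner_commute algebra_simps fun_eq_iff)
  qed
  have bound: "\<bar>u' t\<bar> \<le> 2 * C * u t" for t
  proof -
    have "\<bar>u' t\<bar> \<le> 2 * (norm (\<gamma> t - \<delta> t) * norm (X (\<gamma> t) - X (\<delta> t)))"
      unfolding u'_def using Cauchy_Schwarz_ineq2 by (auto simp: abs_mult)
    also have "\<dots> \<le> 2 * (norm (\<gamma> t - \<delta> t) * (C * norm (\<gamma> t - \<delta> t)))"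
      using lip by (intro mult_left_mono) auto
    also have "\<dots> = 2 * C * u t" by (simp add: u_def dot_square_norm power2_eq_square)
    finally show ?thesis .
  qed
  have u0: "u 0 = 0" using start by (simp add: u_def)
  have "u t \<le> 0"
  proof (cases "t \<ge> 0")
    case True
    have "exp (-(2*C) * t) * u t \<le> exp (-(2*C) * 0) * u 0"
    proof (rule DERIV_nonpos_imp_nonincreasing[OF True, where f = "\<lambda>t. exp (-(2*C) * t) * u t"])
      fix s
      have "((\<lambda>t. exp (-(2*C) * t) * u t) has_real_derivative exp (-(2*C) * s) * (u' s - 2 * C * u s)) (at s)"
        by (rule derivative_eq_intros du HOL.refl | simp add: algebra_simps)+
      moreover have "exp (-(2*C) * s) * (u' s - 2 * C * u s) \<le> 0"
        using bound[of s] by (intro mult_nonneg_nonpos) auto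
      ultimately show "\<exists>y. ((\<lambda>t. exp (-(2*C) * t) * u t) has_real_derivative y) (at s) \<and> y \<le> 0" by blast
    qed
    then show ?thesis by (simp add: u0 mult_le_0_iff)
  next
    case False
    then have "t \<le> 0" by simp
    have "exp ((2*C) * t) * u t \<le> exp ((2*C) * 0) * u 0"
    proof (rule DERIV_nonneg_imp_nondecreasing[OF \<open>t \<le> 0\<close>, where f = "\<lambda>t. exp ((2*C) * t) * u t"])
      fix s
      have "((\<lambda>t. exp ((2*C) * t) * u t) has_real_derivative exp ((2*C) * s) * (u' s + 2 * C * u s)) (at s)"
        by (rule derivative_eq_intros du HOL.refl | simp add: algebra_simps)+
      moreover have "exp ((2*C) * s) * (u' s + 2 * C * u s) \<ge> 0"
        using bound[of s] by (intro mult_nonneg_nonneg) auto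
      ultimately show "\<exists>y. ((\<lambda>t. exp ((2*C) * t) * u t) has_real_derivative y) (at s) \<and> 0 \<le> y" by blast
    qed
    then show ?thesis by (simp add: u0 mult_le_0_iff)
  qed
  then show ?thesis unfolding u_def by (metis eq_iff_diff_eq_0 inner_gt_zero_iff not_le)
qed

locale planar_hamiltonian =
  fixes h hx hy :: "real \<times> real \<Rightarrow> real"
  assumes poly_h: "real_polynomial_function h"
    and poly_hx: "real_polynomial_function hx"
    and poly_hy: "real_polynomial_function hy"
    and h_deriv: "(h has_derivative (\<lambda>v. hx q * fst v + hy q * snd v)) (at q)"
begin

definition field :: "real \<times> real \<Rightarrow> real \<times> real" where
  "field q = (- hy q, hx q)"

lemma field_lipschitz:
  assumes "bounded B"
  obtains C where "\<And>x y. x \<in> B \<Longrightarrow> y \<in> B \<Longrightarrow> norm (field x - field y) \<le> C * norm (x - y)"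
proof -
  obtain C C' where C: "\<forall>x\<in>B. \<forall>y\<in>B. \<bar>hx x - hx y\<bar> \<le> C * norm (x - y)"
    "\<forall>x\<in>B. \<forall>y\<in>B. \<bar>hy x - hy y\<bar> \<le> C' * norm (x - y)"
    using real_polynomial_function_lipschitz[OF poly_hx assms]
      real_polynomial_function_lipschitz[OF poly_hy assms] by blast
  have "norm (field x - field y) \<le> (C' + C) * norm (x - y)" if "x \<in> B" "y \<in> B" for x y
  proof -
    have "norm (field x - field y) \<le> \<bar>hy y - hy x\<bar> + \<bar>hx x - hx y\<bar>"
      using norm_Pair_le[of "hy y - hy x" "hx x - hx y"] by (simp add: field_def)
    also have "\<bar>hy y - hy x\<bar> \<le> C' * norm (x - y)" using C(2) that by (simp add: abs_minus_commute)
    also have "\<bar>hx x - hx y\<bar> \<le> C * norm (x - y)" using C(1) that by simp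
    finally show ?thesis by (simp add: algebra_simps)
  qed
  with that show ?thesis by blast
qed

definition solution :: "(real \<Rightarrow> real \<times> real) \<Rightarrow> bool" where
  "solution \<gamma> \<longleftrightarrow> (\<forall>t. (\<gamma> has_vector_derivative field (\<gamma> t)) (at t))"

lemma solution_shift:
  assumes "solution \<gamma>" shows "solution (\<lambda>t. \<gamma> (t + a))"
  unfolding solution_def
proof
  fix t
  have "((\<gamma> \<circ> (\<lambda>t. t + a)) has_vector_derivative 1 *\<^sub>R field (\<gamma> (t + a))) (at t)"
    by (rule vector_diff_chain_at)
       (use assms in \<open>auto simp: solution_def intro!: derivative_eq_intros\<close>)
  then show "((\<lambda>t. \<gamma> (t + a)) has_vector_derivative field (\<gamma> (t + a))) (at t)"
    by (simp add: o_def)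
qed

lemma solution_continuous: "solution \<gamma> \<Longrightarrow> continuous_on A \<gamma>"
  unfolding solution_def
  by (meson continuous_at_imp_continuous_on has_vector_derivative_continuous)

lemma solution_unique:
  assumes "solution \<gamma>" "solution \<delta>" "bounded (range \<gamma>)" "bounded (range \<delta>)" "\<gamma> a = \<delta> b"
  shows "\<gamma> (t + a) = \<delta> (t + b)"
proof -
  have "bounded (range \<gamma> \<union> range \<delta>)" using assms by simp
  then obtain C where C: "\<And>x y. x \<in> range \<gamma> \<union> range \<delta> \<Longrightarrow> y \<in> range \<gamma> \<union> range \<delta> \<Longrightarrow>
      norm (field x - field y) \<le> C * norm (x - y)"
    using field_lipschitz by blast
  show ?thesis
    by (rule ode_unique[where X = field and C = C and \<gamma> = "\<lambda>t. \<gamma> (t + a)" and \<delta> = "\<lambda>t. \<delta> (t + b)"])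
      (use solution_shift assms C in \<open>auto simp: solution_def\<close>)
qed

lemma h_conserved:
  assumes "solution \<gamma>" shows "h (\<gamma> s) = h (\<gamma> t)"
proof (rule DERIV_isconst_all[of "\<lambda>t. h (\<gamma> t)"])
  show "\<forall>t. ((\<lambda>t. h (\<gamma> t)) has_real_derivative 0) (at t)"
  proof
    fix t
    have "(\<gamma> has_derivative (\<lambda>s. s *\<^sub>R field (\<gamma> t))) (at t)"
      using assms by (simp add: solution_def has_vector_derivative_def)
    from has_derivative_compose[OF this h_deriv]
    show "((\<lambda>t. h (\<gamma> t)) has_real_derivative 0) (at t)"
      unfolding has_field_derivative_def
      by (rule has_derivative_eq_rhs) (simp add: field_def algebra_simps fun_eq_iff)
  qed
qed

lemma periodic_orbitE:
  assumes "periodic_orbit field \<Gamma>"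
  obtains \<gamma> T where "T > 0" "solution \<gamma>" "\<And>t. \<gamma> (t + T) = \<gamma> t" "\<exists>t. \<gamma> t \<noteq> \<gamma> 0" "\<Gamma> = range \<gamma>"
    "compact \<Gamma>"
proof -
  obtain \<gamma> T where g: "T > 0" "solution \<gamma>" "\<And>t. \<gamma> (t + T) = \<gamma> t" "\<exists>t. \<gamma> t \<noteq> \<gamma> 0" "\<Gamma> = range \<gamma>"
    using assms unfolding periodic_orbit_def solution_def by blast
  have nat: "\<gamma> (t + of_nat k * T) = \<gamma> t" for t k
  proof (induction k)
    case (Suc k)
    have "\<gamma> (t + of_nat (Suc k) * T) = \<gamma> ((t + of_nat k * T) + T)" by (simp add: algebra_simps)
    with Suc g(3) show ?case by simp
  qed simp
  have int: "\<gamma> (t + of_int k * T) = \<gamma> t" for t k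
  proof (cases "k \<ge> 0")
    case True then show ?thesis using nat[of t "nat k"] by simp
  next
    case False then show ?thesis using nat[of "t + of_int k * T" "nat (-k)"] by (simp add: algebra_simps)
  qed
  have "\<gamma> t \<in> \<gamma> ` {0..T}" for t
  proof -
    define k where "k = \<lfloor>t / T\<rfloor>"
    have "of_int k \<le> t / T" "t / T < of_int k + 1" unfolding k_def by linarith+
    then have "0 \<le> t - of_int k * T" "t - of_int k * T \<le> T"
      using g(1) by (simp_all add: field_simps)
    moreover have "\<gamma> t = \<gamma> (t - of_int k * T)" using int[of "t - of_int k * T" k] by simp
    ultimately show ?thesis by auto
  qed
  then have "range \<gamma> = \<gamma> ` {0..T}" by auto
  moreover have "compact (\<gamma> ` {0..T})"
    by (intro compact_continuous_image solution_continuous g(2)) simp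
  ultimately show ?thesis using that g by simp
qed

lemma periodic_orbits_disjoint:
  assumes "periodic_orbit field \<Gamma>" "periodic_orbit field \<Delta>" "q \<in> \<Gamma>" "q \<in> \<Delta>"
  shows "\<Gamma> = \<Delta>"
proof -
  obtain \<gamma> where g: "solution \<gamma>" "\<Gamma> = range \<gamma>" "compact \<Gamma>" using assms(1) by (blast elim: periodic_orbitE)
  obtain \<delta> where d: "solution \<delta>" "\<Delta> = range \<delta>" "compact \<Delta>" using assms(2) by (blast elim: periodic_orbitE)
  obtain a b where ab: "\<gamma> a = \<delta> b" using assms g d by auto
  have eq: "\<gamma> (t + a) = \<delta> (t + b)" for t
    using solution_unique[OF g(1) d(1) _ _ ab] g d compact_imp_bounded by blast
  have "\<gamma> t \<in> range \<delta>" "\<delta> t \<in> range \<gamma>" for t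
    using eq[of "t - a"] eq[of "t - b"] rangeI[of \<delta> "t - a + b"] rangeI[of \<gamma> "t - b + a"]
    by simp_all
  then show ?thesis using g d by blast
qed

lemma periodic_orbit_regular:
  assumes "periodic_orbit field \<Gamma>" "q \<in> \<Gamma>"
  shows "field q \<noteq> 0"
proof
  assume q: "field q = 0"
  obtain \<gamma> where g: "solution \<gamma>" "\<exists>t. \<gamma> t \<noteq> \<gamma> 0" "\<Gamma> = range \<gamma>" "compact \<Gamma>"
    using assms(1) by (blast elim: periodic_orbitE)
  obtain a where a: "\<gamma> a = q" using assms g by auto
  have "solution (\<lambda>t. q)" unfolding solution_def by (simp add: q)
  moreover have "bounded (range (\<lambda>t::real. q))" "bounded (range \<gamma>)" using g compact_imp_bounded by auto
  ultimately have "\<gamma> (t + a) = q" for t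
    using solution_unique[OF g(1), of "\<lambda>t. q" a 0 t] a by simp
  then have "\<gamma> t = q" for t by (metis diff_add_cancel)
  then show False using g(2) by simp
qed

text \<open>
  The loop runs through the orbit once, during its minimal period.  A minimal period exists because the
  velocity is nonzero at the start, which excludes arbitrarily small return times.
\<close>

lemma periodic_orbit_contains_loop:
  assumes "periodic_orbit field \<Gamma>"
  obtains c where "simple_path c" "pathfinish c = pathstart c" "path_image c \<subseteq> \<Gamma>"
proof -
  obtain \<gamma> T where g: "T > 0" "solution \<gamma>" "\<And>t. \<gamma> (t + T) = \<gamma> t" "\<exists>t. \<gamma> t \<noteq> \<gamma> 0" "\<Gamma> = range \<gamma>"
    "compact \<Gamma>" using assms by (blast elim: periodic_orbitE)
  have bdd: "bounded (range \<gamma>)" using g compact_imp_bounded by blast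
  obtain e where e: "e > 0" "\<And>t. 0 < t \<Longrightarrow> t < e \<Longrightarrow> \<gamma> t \<noteq> \<gamma> 0"
  proof -
    define v where "v = field (\<gamma> 0)"
    have v: "v \<noteq> 0" unfolding v_def using periodic_orbit_regular[OF assms] g by blast
    have "((\<lambda>t. \<gamma> t \<bullet> v) has_derivative (\<lambda>s. (s *\<^sub>R v) \<bullet> v)) (at 0)"
      using g(2) unfolding solution_def has_vector_derivative_def v_def
      by (intro has_derivative_inner_left) auto
    then have "((\<lambda>t. \<gamma> t \<bullet> v) has_real_derivative v \<bullet> v) (at 0)"
      by (simp add: has_field_derivative_def mult.commute[of _ "v \<bullet> v"])
    from DERIV_pos_inc_right[OF this] v obtain e where "e > 0"
      "\<forall>t>0. t < e \<longrightarrow> \<gamma> 0 \<bullet> v < \<gamma> (0 + t) \<bullet> v" by auto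
    then show ?thesis using that by (metis add_0 less_irrefl)
  qed
  define K where "K = {t \<in> {e..T}. \<gamma> t = \<gamma> 0}"
  have "\<gamma> T = \<gamma> 0" using g(3)[of 0] by simp
  then have "T \<in> K" using e g(1) unfolding K_def by (auto simp: not_less[symmetric])
  moreover have "compact K"
  proof -
    have "closed K" unfolding K_def
      by (intro continuous_closed_preimage_constant solution_continuous g(2)) simp
    then show ?thesis unfolding K_def
      by (metis (no_types, lifting) bounded_subset bounded_closed_interval compact_eq_bounded_closed mem_Collect_eq subsetI)
  qed
  ultimately obtain \<tau> where \<tau>: "\<tau> \<in> K" "\<And>t. t \<in> K \<Longrightarrow> \<tau> \<le> t"
    using compact_attains_inf[of K] by blast
  have \<tau>0: "\<tau> > 0" "\<gamma> \<tau> = \<gamma> 0" "\<tau> \<le> T" using \<tau>(1) e(1) by (auto simp: K_def)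
  have noreturn: "\<gamma> t \<noteq> \<gamma> 0" if "0 < t" "t < \<tau>" for t
    using that e(2)[of t] \<tau>(2)[of t] \<tau>0 by (force simp: K_def)
  have inj: "b - a \<ge> \<tau>" if "\<gamma> a = \<gamma> b" "a < b" for a b
  proof -
    have "\<gamma> (t + a) = \<gamma> (t + b)" for t using solution_unique[OF g(2) g(2) bdd bdd that(1)] .
    from this[of "-a"] have "\<gamma> (b - a) = \<gamma> 0" by simp
    then show ?thesis using noreturn[of "b - a"] that by (meson diff_gt_0_iff_gt not_le)
  qed
  define c where "c s = \<gamma> (\<tau> * s)" for s
  have "path c" unfolding path_def c_def
    by (rule continuous_on_compose2[OF solution_continuous[OF g(2), of UNIV]]) (auto intro!: continuous_intros)
  moreover have "loop_free c"
    unfolding loop_free_def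
  proof (intro ballI impI)
    fix x y :: real assume xy: "x \<in> {0..1}" "y \<in> {0..1}" and eq: "c x = c y"
    have *: "y - x \<ge> 1" if "c x = c y" "x < y" for x y
    proof -
      have "\<tau> * y - \<tau> * x \<ge> \<tau>" using inj[of "\<tau> * x" "\<tau> * y"] that \<tau>0 by (simp add: c_def)
      then have "\<tau> * (y - x) \<ge> \<tau> * 1" by (simp add: algebra_simps)
      then show ?thesis using \<tau>0 by (simp only: mult_le_cancel_left_pos)
    qed
    from *[OF eq] *[OF eq[symmetric]] xy
    show "x = y \<or> x = 0 \<and> y = 1 \<or> x = 1 \<and> y = 0" by (cases x y rule: linorder_cases) auto
  qed
  ultimately have "simple_path c" by (simp add: simple_path_def)
  moreover have "pathfinish c = pathstart c" by (simp add: pathfinish_def pathstart_def c_def \<tau>0)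
  moreover have "path_image c \<subseteq> \<Gamma>" using g by (auto simp: path_image_def c_def)
  ultimately show ?thesis using that by blast
qed

end

section \<open>Centers are strict extrema of the Hamiltonian\<close>

lemma real_polynomial_function_on_lines:
  fixes f :: "real \<times> real \<Rightarrow> real"
  assumes "real_polynomial_function f"
  shows "real_polynomial_function (\<lambda>y. f (a, y))" "real_polynomial_function (\<lambda>x. f (x, b))"
proof -
  have "polynomial_function (\<lambda>y::real. (a, y))" "polynomial_function (\<lambda>x::real. (x, b))"
    unfolding polynomial_function_iff_Basis_inner Basis_prod_def by (auto simp: inner_prod_def)
  from real_polynomial_function_compose[OF this(1) assms] real_polynomial_function_compose[OF this(2) assms]
  show "real_polynomial_function (\<lambda>y. f (a, y))" "real_polynomial_function (\<lambda>x. f (x, b))"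
    by (simp_all add: o_def)
qed

lemma real_polynomial_function_zeros:
  fixes f :: "real \<Rightarrow> real"
  assumes "real_polynomial_function f"
  shows "finite {x. f x = 0} \<or> (\<forall>x. f x = 0)"
proof -
  obtain a n where f: "f = (\<lambda>x. \<Sum>i\<le>n. a i * x ^ i)"
    using assms unfolding real_polynomial_function_iff_sum by blast
  show ?thesis
  proof (cases "\<exists>k\<le>n. a k \<noteq> 0")
    case True
    then show ?thesis unfolding f using polyfun_finite_roots by blast
  next
    case False
    then show ?thesis unfolding f by simp
  qed
qed

context planar_hamiltonian
begin

lemma field_zero_at_extremum:
  assumes "open W" "q \<in> W" "(\<forall>z\<in>W. h z \<le> h q) \<or> (\<forall>z\<in>W. h q \<le> h z)"
  shows "field q = 0"
proof -
  have "(\<lambda>v. hx q * fst v + hy q * snd v) = (\<lambda>v. 0)"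
    by (rule differential_zero_maxmin[OF assms(2,1) h_deriv assms(3)])
  from fun_cong[OF this, of "(1, 0)"] fun_cong[OF this, of "(0, 1)"]
  show ?thesis by (simp add: field_def zero_prod_def)
qed

text \<open>
  Inside the Jordan curve the Hamiltonian, being constant on the curve, has a critical point as soon as
  it takes values other than \<open>h p\<close>.  The only candidate \<open>p\<close> has the value \<open>h p\<close>, so the Hamiltonian is
  constant inside and all points there are critical.
\<close>

lemma no_small_loop:
  assumes orbit: "periodic_orbit field \<Gamma>" "\<Gamma> \<subseteq> Q" "convex Q"
    and crit: "\<And>q. q \<in> Q \<Longrightarrow> field q = 0 \<Longrightarrow> q = p"
    and level: "\<And>q. q \<in> \<Gamma> \<Longrightarrow> h q = h p"
  shows False
proof -
  obtain c where c: "simple_path c" "pathfinish c = pathstart c" "path_image c \<subseteq> \<Gamma>"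
    using periodic_orbit_contains_loop[OF orbit(1)] .
  define to_complex where "to_complex = (\<lambda>(a, b). Complex a b)"
  define of_complex where "of_complex z = (Re z, Im z)" for z
  have inv: "of_complex (to_complex q) = q" "to_complex (of_complex z) = z" for q z
    by (auto simp: to_complex_def of_complex_def split: prod.split)
  have cont: "continuous_on A to_complex" for A
  proof -
    have eq: "to_complex = (\<lambda>q. of_real (fst q) + \<i> * of_real (snd q))"
      by (auto simp: to_complex_def complex_eq_iff fun_eq_iff)
    show ?thesis unfolding eq by (intro continuous_intros)
  qed
  have cont': "continuous_on A of_complex" for A
    unfolding of_complex_def by (intro continuous_intros)
  define d where "d = to_complex \<circ> c"
  have inj: "inj_on to_complex A" for A by (metis inj_on_inverseI inv(1))
  have d: "simple_path d" "pathfinish d = pathstart d"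
    unfolding d_def using c
    by (auto intro!: simple_path_continuous_image cont inj simp: pathfinish_compose pathstart_compose)
  have im_d: "path_image d = to_complex ` path_image c"
    unfolding d_def by (rule path_image_compose)
  define I where "I = inside (path_image d)"
  have I: "I \<noteq> {}" "open I" "bounded I" "frontier I = path_image d"
    using Jordan_inside_outside[OF d] by (auto simp: I_def)
  have clI: "closure I = I \<union> path_image d"
    using I(2,4) closure_Un_frontier[of I] by simp
  have lev: "h (of_complex z) = h p" if "z \<in> path_image d" for z
    using that level c(3) inv by (auto simp: im_d)
  have IQ: "of_complex z \<in> Q" if "z \<in> I" for z
  proof -
    have conv: "convex (to_complex ` Q)"
    proof (rule convex_linear_image[OF _ assms(3)])
      show "linear to_complex"
        by (rule linearI) (auto simp: to_complex_def complex_eq_iff split: prod.split)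
    qed
    have "path_image d \<subseteq> to_complex ` Q" unfolding im_d using c(3) orbit(2) by blast
    from outside_subset_convex[OF conv this] have "I \<subseteq> to_complex ` Q"
      unfolding I_def using inside_Int_outside[of "path_image d"] by blast
    with that inv show ?thesis by auto
  qed
  define J where "J = to_complex -` I"
  have "open J" unfolding J_def using cont[of UNIV] I(2) by (simp add: open_vimage)
  have zero: "z = to_complex p"
    if "z \<in> I" "(\<forall>w\<in>closure I. h (of_complex w) \<le> h (of_complex z)) \<or>
      (\<forall>w\<in>closure I. h (of_complex z) \<le> h (of_complex w))" for z
  proof -
    have "field (of_complex z) = 0"
      by (rule field_zero_at_extremum[OF \<open>open J\<close>])
        (use that inv closure_subset[of I] in \<open>auto simp: J_def\<close>, (metis inv subsetD)+)
    then have "of_complex z = p" using crit IQ that by blast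
    then show ?thesis using inv by metis
  qed
  have comp: "compact (closure I)" using I by (simp add: compact_closure)
  have ch: "continuous_on (closure I) (\<lambda>z. h (of_complex z))"
    by (rule continuous_on_compose2[of UNIV h])
      (use continuous_real_polymonial_function[OF poly_h] cont' in \<open>auto simp: continuous_at_imp_continuous_on\<close>)
  have ne: "closure I \<noteq> {}" using I by simp
  obtain z1 where z1: "z1 \<in> closure I" "\<forall>w\<in>closure I. h (of_complex w) \<le> h (of_complex z1)"
    using continuous_attains_sup[OF comp ne ch] by blast
  obtain z2 where z2: "z2 \<in> closure I" "\<forall>w\<in>closure I. h (of_complex z2) \<le> h (of_complex w)"
    using continuous_attains_inf[OF comp ne ch] by blast
  have "h (of_complex z1) = h p" using zero[of z1] z1 lev inv(1)[of p] unfolding clI by auto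
  moreover have "h (of_complex z2) = h p" using zero[of z2] z2 lev inv(1)[of p] unfolding clI by auto
  ultimately have const: "h (of_complex w) = h p" if "w \<in> closure I" for w
    using z1(2) z2(2) that by (metis antisym)
  have "z = to_complex p" if "z \<in> I" for z
    using zero[OF that] const that closure_subset[of I] by (metis order_refl subsetD)
  then have "I = {to_complex p}" using I(1) by blast
  then show False using I(2) not_open_singleton by metis
qed

text \<open>
  Choose a square around \<open>p\<close> none of whose sides lies in the level set of \<open>p\<close>; then its boundary meets the
  level set in a finite set.  Only finitely many orbits pass through that set, and they keep away from
  \<open>p\<close>.  An orbit on the level of \<open>p\<close> through a point closer to \<open>p\<close> stays inside the square,
  which \<open>no_small_loop\<close> excludes.
\<close>

lemma center_isolated_in_level:
  assumes "is_center field p"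
  shows "\<exists>r>0. \<forall>q\<in>cball p r. q \<noteq> p \<longrightarrow> h q \<noteq> h p"
proof -
  obtain U \<O> where U: "p \<in> interior U" "\<forall>\<Gamma>\<in>\<O>. periodic_orbit field \<Gamma>" "U - {p} = \<Union>\<O>"
    using assms unfolding is_center_def by blast
  obtain e where e: "e > 0" "ball p e \<subseteq> U"
    using U(1) unfolding mem_interior by blast
  have crit: "q = p" if "q \<in> ball p e" "field q = 0" for q
    using that e(2) U periodic_orbit_regular by (metis DiffI Union_iff singletonD subsetD)
  define g where "g q = h q - h p" for q
  have poly_g: "real_polynomial_function g"
    unfolding g_def by (intro real_polynomial_function_diff poly_h real_polynomial_function.intros(2))
  obtain q0 where q0: "g q0 \<noteq> 0"
  proof (rule ccontr)
    assume "\<not> thesis"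
    then have "h q = h p" for q using that[of q] unfolding g_def by linarith
    then have "field q = 0" for q
      by (intro field_zero_at_extremum[of UNIV]) auto
    then have "ball p e \<subseteq> {p}" using crit by blast
    then have "ball p e = {p}" using e(1) by auto
    then show False by (metis not_open_singleton open_ball)
  qed
  note lines = real_polynomial_function_on_lines[OF poly_g, THEN real_polynomial_function_zeros]
  have finA: "finite {a. \<forall>y. g (a, y) = 0}"
  proof (rule ccontr)
    assume inf: "infinite {a. \<forall>y. g (a, y) = 0}"
    have "infinite {a. g (a, snd q0) = 0}" by (rule infinite_super[OF _ inf]) auto
    then have "g (fst q0, snd q0) = 0" using lines(2) by blast
    with q0 show False by simp
  qed
  have finB: "finite {b. \<forall>x. g (x, b) = 0}"
  proof (rule ccontr)
    assume inf: "infinite {b. \<forall>x. g (x, b) = 0}"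
    have "infinite {b. g (fst q0, b) = 0}" by (rule infinite_super[OF _ inf]) auto
    then have "g (fst q0, snd q0) = 0" using lines(1) by blast
    with q0 show False by simp
  qed
  let ?A = "{a. \<forall>y. g (a, y) = 0}" and ?B = "{b. \<forall>x. g (x, b) = 0}"
  \<comment> \<open>The half widths for which one of the four sides lies in the level set.\<close>
  define bad where "bad = (\<lambda>a. a - fst p) ` ?A \<union> (\<lambda>a. fst p - a) ` ?A
      \<union> (\<lambda>b. b - snd p) ` ?B \<union> (\<lambda>b. snd p - b) ` ?B"
  have "finite bad" unfolding bad_def using finA finB by simp
  then have "infinite ({0<..<e/2} - bad)" using e by (intro Diff_infinite_finite) simp_all
  then obtain s where s: "0 < s" "s < e / 2" "s \<notin> bad"
    by (metis Diff_iff greaterThanLessThan_iff finite.emptyI equals0I)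
  have good: "finite {y. g (fst p + s, y) = 0}" "finite {y. g (fst p - s, y) = 0}"
    "finite {x. g (x, snd p + s) = 0}" "finite {x. g (x, snd p - s) = 0}"
  proof -
    have "fst p + s \<notin> ?A" "fst p - s \<notin> ?A" "snd p + s \<notin> ?B" "snd p - s \<notin> ?B"
      using s(3) unfolding bad_def by (auto simp: image_iff)
    then show "finite {y. g (fst p + s, y) = 0}" "finite {y. g (fst p - s, y) = 0}"
      "finite {x. g (x, snd p + s) = 0}" "finite {x. g (x, snd p - s) = 0}"
      using lines by blast+
  qed
  define Q where "Q = {q. \<bar>fst q - fst p\<bar> \<le> s \<and> \<bar>snd q - snd p\<bar> \<le> s}"
  define Q0 where "Q0 = {q. \<bar>fst q - fst p\<bar> < s \<and> \<bar>snd q - snd p\<bar> < s}"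
  have opens: "open Q0" "closed Q"
    unfolding Q_def Q0_def
    by (intro open_Collect_conj open_Collect_less closed_Collect_conj closed_Collect_le continuous_intros)+
  have Q0Q: "Q0 \<subseteq> Q" by (auto simp: Q_def Q0_def)
  have "convex Q"
  proof -
    have "Q = {fst p - s..fst p + s} \<times> {snd p - s..snd p + s}" by (auto simp: Q_def)
    then show ?thesis by (simp add: convex_Times)
  qed
  have Qe: "Q \<subseteq> ball p e"
  proof
    fix q assume q: "q \<in> Q"
    have "dist p q \<le> \<bar>fst p - fst q\<bar> + \<bar>snd p - snd q\<bar>"
      unfolding dist_norm by (metis norm_Pair_le real_norm_def prod.collapse fst_diff snd_diff)
    with q s show "q \<in> ball p e" by (auto simp: Q_def)
  qed
  define E where "E = (Q - Q0) \<inter> {q. g q = 0}"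
  have "finite E"
  proof (rule finite_subset)
    show "E \<subseteq> Pair (fst p + s) ` {y. g (fst p + s, y) = 0} \<union> Pair (fst p - s) ` {y. g (fst p - s, y) = 0}
       \<union> (\<lambda>x. (x, snd p + s)) ` {x. g (x, snd p + s) = 0} \<union> (\<lambda>x. (x, snd p - s)) ` {x. g (x, snd p - s) = 0}"
    proof
      fix q assume q: "q \<in> E"
      obtain a b where ab: "q = (a, b)" by fastforce
      from q have "\<bar>a - fst p\<bar> = s \<or> \<bar>b - snd p\<bar> = s" by (auto simp: E_def Q_def Q0_def ab)
      then have "a = fst p + s \<or> a = fst p - s \<or> b = snd p + s \<or> b = snd p - s" by linarith
      with q show "q \<in> Pair (fst p + s) ` {y. g (fst p + s, y) = 0} \<union> Pair (fst p - s) ` {y. g (fst p - s, y) = 0}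
       \<union> (\<lambda>x. (x, snd p + s)) ` {x. g (x, snd p + s) = 0} \<union> (\<lambda>x. (x, snd p - s)) ` {x. g (x, snd p - s) = 0}"
        by (auto simp: E_def ab)
    qed
  qed (use good in simp)
  define G where "G = {\<Gamma> \<in> \<O>. \<Gamma> \<inter> E \<noteq> {}}"
  have "finite G"
  proof -
    have "G \<subseteq> (\<Union>q\<in>E. {\<Gamma> \<in> \<O>. q \<in> \<Gamma>})" by (auto simp: G_def)
    moreover have "finite {\<Gamma> \<in> \<O>. q \<in> \<Gamma>}" for q
    proof (cases "{\<Gamma> \<in> \<O>. q \<in> \<Gamma>} = {}")
      case False
      then obtain \<Gamma> where "\<Gamma> \<in> \<O>" "q \<in> \<Gamma>" by blast
      then have "{\<Gamma> \<in> \<O>. q \<in> \<Gamma>} \<subseteq> {\<Gamma>}" using periodic_orbits_disjoint U(2) by blast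
      then show ?thesis by (rule finite_subset) simp
    qed (simp only: finite.emptyI)
    ultimately show ?thesis using \<open>finite E\<close> by (meson finite_UN_I finite_subset)
  qed
  have "closed (\<Union>G)"
  proof (rule closed_Union)
    show "\<forall>\<Gamma>\<in>G. closed \<Gamma>"
      using U(2) unfolding G_def by (metis (no_types, lifting) compact_imp_closed mem_Collect_eq periodic_orbitE)
  qed fact
  moreover have "p \<notin> \<Union>G" using U(3) by (auto simp: G_def)
  ultimately have "open (- \<Union>G)" "p \<in> - \<Union>G" by auto
  then obtain \<delta> where \<delta>: "\<delta> > 0" "ball p \<delta> \<subseteq> - \<Union>G" by (meson openE)
  define r where "r = min \<delta> s / 2"
  have r: "r > 0" "r < \<delta>" "r < s" using \<delta> s by (auto simp: r_def)
  have "h q \<noteq> h p" if q: "q \<in> cball p r" "q \<noteq> p" for q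
  proof
    assume hq: "h q = h p"
    have "\<bar>fst q - fst p\<bar> \<le> dist q p" "\<bar>snd q - snd p\<bar> \<le> dist q p"
      using dist_fst_le[of q p] dist_snd_le[of q p] by (simp_all add: dist_real_def)
    then have "q \<in> Q0" using q r by (auto simp: Q0_def dist_commute)
    then have "q \<in> U - {p}" using q Q0Q Qe e(2) by blast
    then obtain \<Gamma> where \<Gamma>: "\<Gamma> \<in> \<O>" "q \<in> \<Gamma>" using U(3) by blast
    then have per: "periodic_orbit field \<Gamma>" using U(2) by blast
    obtain \<gamma> where g: "solution \<gamma>" "\<Gamma> = range \<gamma>" using per by (blast elim: periodic_orbitE)
    have lev: "h z = h p" if "z \<in> \<Gamma>" for z using that \<Gamma>(2) hq unfolding g(2) by (metis h_conserved[OF g(1)] rangeE)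
    have "\<Gamma> \<inter> E = {}"
    proof (rule ccontr)
      assume "\<Gamma> \<inter> E \<noteq> {}"
      then have "q \<in> \<Union>G" using \<Gamma> by (auto simp: G_def)
      moreover have "q \<in> ball p \<delta>" using q r by auto
      ultimately show False using \<delta>(2) by blast
    qed
    then have cover: "\<Gamma> \<subseteq> Q0 \<union> - Q" using lev by (auto simp: E_def g_def)
    have "connected \<Gamma>" unfolding g(2)
      by (intro connected_continuous_image solution_continuous g(1)) simp
    then have "Q0 \<inter> \<Gamma> = {} \<or> - Q \<inter> \<Gamma> = {}"
      using cover opens Q0Q by (intro connectedD) auto
    then have "\<Gamma> \<subseteq> Q" using \<Gamma>(2) \<open>q \<in> Q0\<close> by blast
    from no_small_loop[OF per this \<open>convex Q\<close> _ lev] crit Qe show False by blast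
  qed
  with r(1) show ?thesis by blast
qed

end

section \<open>Extrema after a small perturbation\<close>

lemma bip_has_derivative:
  "((\<lambda>q. bip D c (fst q) (snd q)) has_derivative
     (\<lambda>v. bip_x D c (fst q) (snd q) * fst v + bip_y D c (fst q) (snd q) * snd v)) (at q)"
proof -
  have "((\<lambda>q. c i j * (fst q ^ i * snd q ^ j)) has_derivative
      (\<lambda>v. c i j * (of_nat i * fst q ^ (i - 1) * snd q ^ j) * fst v
         + c i j * (fst q ^ i * (of_nat j * snd q ^ (j - 1))) * snd v)) (at q)" for i j
    by (rule derivative_eq_intros HOL.refl | simp add: algebra_simps)+
  then show ?thesis
    unfolding bip_def bip_x_def bip_y_def sum_distrib_right sum.distrib[symmetric] case_prod_unfold
    by (intro has_derivative_sum)
qed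

lemma bip_coeff_P: "bip D (coeff_P c) x y = bip D c x y + y * bip_y D c x y"
  unfolding bip_def bip_y_def coeff_P_def sum_distrib_left sum.distrib[symmetric]
proof (intro sum.cong HOL.refl, clarify)
  fix i j
  show "real (Suc j) * c i j * (x ^ i * y ^ j) =
      c i j * (x ^ i * y ^ j) + y * (c i j * (x ^ i * (real j * y ^ (j - 1))))"
    by (cases j) (simp_all add: algebra_simps)
qed

lemma bip_coeff_Q: "bip D (coeff_Q c) x y = bip D c x y + x * bip_x D c x y"
  unfolding bip_def bip_x_def coeff_Q_def sum_distrib_left sum.distrib[symmetric]
proof (intro sum.cong HOL.refl, clarify)
  fix i j
  show "real (Suc i) * c i j * (x ^ i * y ^ j) =
      c i j * (x ^ i * y ^ j) + x * (c i j * (real i * x ^ (i - 1) * y ^ j))"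
    by (cases i) (simp_all add: algebra_simps)
qed

text \<open>
  The equality of the mixed second derivatives of \<open>x y F\<close> in terms of \<open>P\<close> and \<open>Q\<close>.
\<close>

lemma mixed_partials:
  "y * bip_y D (coeff_Q c) x y - x * bip_x D (coeff_P c) x y =
   bip D (coeff_P c) x y - bip D (coeff_Q c) x y"
proof -
  have *: "real k * z ^ k = z * (of_nat k * z ^ (k - 1))" for k z by (cases k) simp_all
  show ?thesis
    unfolding bip_def bip_x_def bip_y_def coeff_P_def coeff_Q_def sum_distrib_left
      sum_subtractf[symmetric]
  proof (intro sum.cong HOL.refl, clarify)
    fix i j
    have "y * (real (Suc i) * c i j * (x ^ i * (real j * y ^ (j - 1)))) -
        x * (real (Suc j) * c i j * (real i * x ^ (i - 1) * y ^ j)) =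
        real (Suc i) * c i j * (x ^ i * (y * (real j * y ^ (j - 1)))) -
        real (Suc j) * c i j * ((x * (real i * x ^ (i - 1))) * y ^ j)"
      by (simp only: mult_ac)
    also have "\<dots> = real (Suc j) * c i j * (x ^ i * y ^ j) - real (Suc i) * c i j * (x ^ i * y ^ j)"
      unfolding *[symmetric] by (simp add: algebra_simps)
    finally show "y * (real (Suc i) * c i j * (x ^ i * (real j * y ^ (j - 1)))) -
        x * (real (Suc j) * c i j * (real i * x ^ (i - 1) * y ^ j)) =
        real (Suc j) * c i j * (x ^ i * y ^ j) - real (Suc i) * c i j * (x ^ i * y ^ j)" .
  qed
qed

definition ham :: "nat \<Rightarrow> (nat \<Rightarrow> nat \<Rightarrow> real) \<Rightarrow> real \<times> real \<Rightarrow> real" where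
  "ham D c q = fst q * snd q * bip D c (fst q) (snd q)"

lemma real_polynomial_function_fst_snd:
  "real_polynomial_function (fst :: real \<times> real \<Rightarrow> real)"
  "real_polynomial_function (snd :: real \<times> real \<Rightarrow> real)"
  by (auto intro: real_polynomial_function.intros bounded_linear_fst bounded_linear_snd)

lemma real_polynomial_function_bip:
  "real_polynomial_function (\<lambda>q. bip D c (fst q) (snd q))"
  unfolding bip_def case_prod_unfold
  by (intro real_polynomial_function_sum finite_exponents real_polynomial_function.intros(2,4)
      real_polynomial_function_power real_polynomial_function_fst_snd)

lemma planar_hamiltonian_ham:
  "planar_hamiltonian (ham D c)
     (\<lambda>q. snd q * bip D (coeff_Q c) (fst q) (snd q))
     (\<lambda>q. fst q * bip D (coeff_P c) (fst q) (snd q))"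
proof
  show "real_polynomial_function (ham D c)"
    unfolding ham_def
    by (intro real_polynomial_function.intros(4) real_polynomial_function_bip real_polynomial_function_fst_snd)
  show "real_polynomial_function (\<lambda>q. snd q * bip D (coeff_Q c) (fst q) (snd q))"
    "real_polynomial_function (\<lambda>q. fst q * bip D (coeff_P c) (fst q) (snd q))"
    by (intro real_polynomial_function.intros(4) real_polynomial_function_bip real_polynomial_function_fst_snd)+
  fix q
  show "(ham D c has_derivative (\<lambda>v. snd q * bip D (coeff_Q c) (fst q) (snd q) * fst v
      + fst q * bip D (coeff_P c) (fst q) (snd q) * snd v)) (at q)"
    unfolding ham_def[abs_def] bip_coeff_P bip_coeff_Q
    by (rule derivative_eq_intros bip_has_derivative HOL.refl | simp add: algebra_simps)+
qed

lemma second_derivative_nonneg_at_min: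
  fixes u u' :: "real \<Rightarrow> real"
  assumes u: "\<And>s. (u has_real_derivative u' s) (at s)"
    and u': "(u' has_real_derivative k) (at 0)" "u' 0 = 0"
    and min: "d > 0" "\<And>s. \<bar>s\<bar> < d \<Longrightarrow> u 0 \<le> u s"
  shows "k \<ge> 0"
proof (rule ccontr)
  assume "\<not> k \<ge> 0"
  then obtain e where e: "e > 0" "\<forall>h>0. h < e \<longrightarrow> u' 0 > u' (0 + h)"
    using DERIV_neg_dec_right[OF u'(1)] by auto
  \<comment> \<open>A point where the derivative is still negative and the minimum property applies.\<close>
  define s where "s = min d e / 2"
  have s: "0 < s" "s < d" "s < e" using min e by (auto simp: s_def)
  have "u 0 > u s"
  proof (rule DERIV_neg_imp_decreasing_open[OF s(1)])
    show "continuous_on {0..s} u" using u by (meson DERIV_continuous_on has_field_derivative_at_within)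
  qed (use u e u' s in force)
  with min(2)[of s] s show False by simp
qed

lemma discriminant_of_nonneg_form:
  fixes A B C :: real
  assumes "\<And>a b. a\<^sup>2 * A + 2 * (a * b) * B + b\<^sup>2 * C \<ge> 0"
  shows "B\<^sup>2 \<le> A * C"
proof (cases "A = 0")
  case True
  have "B = 0"
  proof (rule ccontr)
    assume "B \<noteq> 0"
    then show False using assms[of "-(C + 1) / (2 * B)" 1] True by (simp add: field_simps)
  qed
  then show ?thesis using True by simp
next
  case False
  then have "A > 0" using assms[of 1 0] by simp
  have "0 \<le> A * (A * C - B\<^sup>2)" using assms[of "-B" A] by (simp add: power2_eq_square algebra_simps)
  then show ?thesis using \<open>A > 0\<close> by (simp add: zero_le_mult_iff)
qed

text \<open>
  The factor \<open>\<sigma>\<close> allows for minima and maxima at the same time.  The second derivatives along all lines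
  through the extremum make the Hessian semidefinite, whence its determinant is nonnegative.
\<close>

lemma extremum_of_ham:
  assumes W: "open W" "q \<in> W" and ext: "\<And>z. z \<in> W \<Longrightarrow> \<sigma> * ham D c q \<le> \<sigma> * ham D c z"
    and \<sigma>: "\<sigma> \<noteq> 0" and nz: "fst q \<noteq> 0" "snd q \<noteq> 0"
  shows "bip D (coeff_P c) (fst q) (snd q) = 0" "bip D (coeff_Q c) (fst q) (snd q) = 0"
    and "- (fst q * snd q) * jac D c (fst q) (snd q) \<ge> 0"
proof -
  interpret planar_hamiltonian "ham D c" "\<lambda>q. snd q * bip D (coeff_Q c) (fst q) (snd q)"
     "\<lambda>q. fst q * bip D (coeff_P c) (fst q) (snd q)" by (rule planar_hamiltonian_ham)
  define x y where "x = fst q" and "y = snd q"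
  have "(\<forall>z\<in>W. ham D c z \<le> ham D c q) \<or> (\<forall>z\<in>W. ham D c q \<le> ham D c z)"
    using ext \<sigma> by (cases "\<sigma> > 0") auto
  then have "field q = 0" by (rule field_zero_at_extremum[OF W])
  then have PQ: "bip D (coeff_P c) x y = 0" "bip D (coeff_Q c) x y = 0"
    using nz by (auto simp: field_def zero_prod_def x_def y_def)
  then show "bip D (coeff_P c) (fst q) (snd q) = 0" "bip D (coeff_Q c) (fst q) (snd q) = 0"
    by (simp_all add: x_def y_def)
  define Px Py Qx Qy where "Px = bip_x D (coeff_P c) x y" and "Py = bip_y D (coeff_P c) x y"
    and "Qx = bip_x D (coeff_Q c) x y" and "Qy = bip_y D (coeff_Q c) x y"
  have sym: "y * Qy = x * Px"
    using mixed_partials[of y D c x] PQ by (simp add: Px_def Qy_def)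
  obtain e where e: "e > 0" "ball q e \<subseteq> W" using W openE by blast
  have "a\<^sup>2 * (\<sigma> * (y * Qx)) + 2 * (a * b) * (\<sigma> * (y * Qy)) + b\<^sup>2 * (\<sigma> * (x * Py)) \<ge> 0" for a b
  proof -
    define u where "u s = \<sigma> * ham D c (q + s *\<^sub>R (a, b))" for s
    define H1 where "H1 z = snd z * bip D (coeff_Q c) (fst z) (snd z)" for z
    define H2 where "H2 z = fst z * bip D (coeff_P c) (fst z) (snd z)" for z
    define u' where "u' s = \<sigma> * (H1 (q + s *\<^sub>R (a, b)) * a + H2 (q + s *\<^sub>R (a, b)) * b)" for s
    have line: "((\<lambda>s. q + s *\<^sub>R (a, b)) has_derivative (\<lambda>s. s *\<^sub>R (a, b))) (at s)" for s
      by (rule derivative_eq_intros HOL.refl | simp)+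
    have "(u has_real_derivative u' s) (at s)" for s
      using has_derivative_mult_right[OF has_derivative_compose[OF line h_deriv], of \<sigma> s]
      unfolding u_def u'_def H1_def H2_def has_field_derivative_def
      by (rule has_derivative_eq_rhs) (simp add: fun_eq_iff algebra_simps)
    moreover have "(u' has_real_derivative
       (a\<^sup>2 * (\<sigma> * (y * Qx)) + 2 * (a * b) * (\<sigma> * (y * Qy)) + b\<^sup>2 * (\<sigma> * (x * Py)))) (at 0)"
    proof -
      have H1: "(H1 has_derivative (\<lambda>v. y * (Qx * fst v + Qy * snd v))) (at q)"
        unfolding H1_def[abs_def]
        by (rule derivative_eq_intros bip_has_derivative HOL.refl
            | simp add: Qx_def Qy_def x_def[symmetric] y_def[symmetric] PQ)+
      have H2: "(H2 has_derivative (\<lambda>v. x * (Px * fst v + Py * snd v))) (at q)"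
        unfolding H2_def[abs_def]
        by (rule derivative_eq_intros bip_has_derivative HOL.refl
            | simp add: Px_def Py_def x_def[symmetric] y_def[symmetric] PQ)+
      have q0: "q + 0 *\<^sub>R (a, b) = q" by (simp only: scaleR_zero_left add_0_right)
      have l1: "((\<lambda>s. H1 (q + s *\<^sub>R (a, b))) has_derivative (\<lambda>s. y * (Qx * fst (s *\<^sub>R (a, b)) + Qy * snd (s *\<^sub>R (a, b))))) (at 0)"
        by (rule has_derivative_compose[OF line, of H1 _ 0]) (simp only: q0 H1)
      have l2: "((\<lambda>s. H2 (q + s *\<^sub>R (a, b))) has_derivative (\<lambda>s. x * (Px * fst (s *\<^sub>R (a, b)) + Py * snd (s *\<^sub>R (a, b))))) (at 0)"
        by (rule has_derivative_compose[OF line, of H2 _ 0]) (simp only: q0 H2)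
      show ?thesis
        unfolding u'_def has_field_derivative_def
      proof (rule has_derivative_eq_rhs)
        show "((\<lambda>s. \<sigma> * (H1 (q + s *\<^sub>R (a, b)) * a + H2 (q + s *\<^sub>R (a, b)) * b)) has_derivative
          (\<lambda>s. \<sigma> * ((y * (Qx * fst (s *\<^sub>R (a, b)) + Qy * snd (s *\<^sub>R (a, b)))) * a +
             (x * (Px * fst (s *\<^sub>R (a, b)) + Py * snd (s *\<^sub>R (a, b)))) * b))) (at 0)"
          by (intro has_derivative_mult_right has_derivative_add has_derivative_mult_left l1 l2)
        have "\<sigma> * (y * (Qx * (s * a) + Qy * (s * b)) * a + x * (Px * (s * a) + Py * (s * b)) * b) =
          s * (a * a * (\<sigma> * (y * Qx)) + a * b * (\<sigma> * (y * Qy)) + a * b * (\<sigma> * (x * Px)) + b * b * (\<sigma> * (x * Py)))"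
          for s by (simp add: algebra_simps)
        then show "(\<lambda>s. \<sigma> * ((y * (Qx * fst (s *\<^sub>R (a, b)) + Qy * snd (s *\<^sub>R (a, b)))) * a +
             (x * (Px * fst (s *\<^sub>R (a, b)) + Py * snd (s *\<^sub>R (a, b)))) * b)) =
          (*) (a\<^sup>2 * (\<sigma> * (y * Qx)) + 2 * (a * b) * (\<sigma> * (y * Qy)) + b\<^sup>2 * (\<sigma> * (x * Py)))"
          unfolding sym[symmetric] by (simp add: fun_eq_iff power2_eq_square algebra_simps)
      qed
    qed
    moreover have "u' 0 = 0" by (simp add: zero_prod_def[symmetric] u'_def H1_def H2_def PQ x_def[symmetric] y_def[symmetric])
    moreover have "e / (norm (a, b) + 1) > 0" using e(1) by (intro divide_pos_pos add_nonneg_pos) auto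
    moreover have "u 0 \<le> u s" if "\<bar>s\<bar> < e / (norm (a, b) + 1)" for s
    proof -
      have "norm (s *\<^sub>R (a, b)) \<le> \<bar>s\<bar> * (norm (a, b) + 1)"
        unfolding norm_scaleR distrib_left by simp
      also have "\<dots> < e" using that by (simp add: pos_less_divide_eq add_nonneg_pos)
      finally have "q + s *\<^sub>R (a, b) \<in> ball q e"
        unfolding mem_ball dist_norm by (metis add_diff_cancel_left' norm_minus_commute)
      then have "q + s *\<^sub>R (a, b) \<in> W" using e(2) by blast
      then show ?thesis using ext unfolding u_def scaleR_zero_left add_0_right by blast
    qed
    ultimately show ?thesis by (rule second_derivative_nonneg_at_min)
  qed
  then have "(\<sigma> * (y * Qy))\<^sup>2 \<le> \<sigma> * (y * Qx) * (\<sigma> * (x * Py))"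
    by (rule discriminant_of_nonneg_form)
  moreover have "(\<sigma> * (y * Qy))\<^sup>2 = \<sigma>\<^sup>2 * ((y * Qy) * (x * Px))"
    unfolding sym[symmetric] by (simp add: power2_eq_square algebra_simps)
  moreover have "\<sigma> * (y * Qx) * (\<sigma> * (x * Py)) = \<sigma>\<^sup>2 * ((y * Qx) * (x * Py))"
    by (simp add: power2_eq_square algebra_simps)
  ultimately have "\<sigma>\<^sup>2 * ((y * Qx) * (x * Py) - (y * Qy) * (x * Px)) \<ge> 0"
    unfolding right_diff_distrib by linarith
  then have "(y * Qx) * (x * Py) - (y * Qy) * (x * Px) \<ge> 0"
    using \<sigma> by (simp add: zero_le_mult_iff)
  then show "- (fst q * snd q) * jac D c (fst q) (snd q) \<ge> 0"
    unfolding jac_def x_def[symmetric] y_def[symmetric] Px_def[symmetric] Py_def[symmetric]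
      Qx_def[symmetric] Qy_def[symmetric] by (simp add: algebra_simps)
qed

definition single :: "real \<Rightarrow> nat \<Rightarrow> nat \<Rightarrow> nat \<Rightarrow> nat \<Rightarrow> real" where
  "single a k l i j = (if i = k \<and> j = l then a else 0)"

lemma bip_single:
  assumes "k + l \<le> D"
  shows "bip D (single a k l) x y = a * (x ^ k * y ^ l)"
    and "bip_x D (single a k l) x y = a * (of_nat k * x ^ (k - 1) * y ^ l)"
    and "bip_y D (single a k l) x y = a * (x ^ k * (of_nat l * y ^ (l - 1)))"
proof -
  have sum: "(\<Sum>(i,j)\<in>exponents (Suc D). single a k l i j * G i j) = a * G k l" for G :: "nat \<Rightarrow> nat \<Rightarrow> real"
  proof -
    have "(\<Sum>(i,j)\<in>exponents (Suc D). single a k l i j * G i j) =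
        (\<Sum>q\<in>exponents (Suc D). if q = (k, l) then a * G k l else 0)"
      by (intro sum.cong) (auto simp: single_def split: if_splits)
    also have "\<dots> = a * G k l"
    proof -
      have "(k, l) \<in> exponents (Suc D)" using assms by (simp add: exponents_def)
      then show ?thesis by simp
    qed
    finally show ?thesis .
  qed
  show "bip D (single a k l) x y = a * (x ^ k * y ^ l)"
    "bip_x D (single a k l) x y = a * (of_nat k * x ^ (k - 1) * y ^ l)"
    "bip_y D (single a k l) x y = a * (x ^ k * (of_nat l * y ^ (l - 1)))"
    unfolding bip_def bip_x_def bip_y_def by (rule sum)+
qed

lemma coeff_PQ_add_single:
  "coeff_P (\<lambda>i j. c i j + c' i j) = (\<lambda>i j. coeff_P c i j + coeff_P c' i j)"
  "coeff_Q (\<lambda>i j. c i j + c' i j) = (\<lambda>i j. coeff_Q c i j + coeff_Q c' i j)"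
  "coeff_P (single a k l) = single (of_nat (Suc l) * a) k l"
  "coeff_Q (single a k l) = single (of_nat (Suc k) * a) k l"
  by (auto simp: coeff_P_def coeff_Q_def single_def fun_eq_iff algebra_simps)

definition add_linear :: "real \<Rightarrow> real \<Rightarrow> (nat \<Rightarrow> nat \<Rightarrow> real) \<Rightarrow> nat \<Rightarrow> nat \<Rightarrow> real" where
  "add_linear \<beta> \<gamma> c i j = c i j + (single \<beta> 1 0 i j + single \<gamma> 0 1 i j)"

lemma bip_add_linear:
  assumes "D \<ge> 1"
  shows "bip D (add_linear \<beta> \<gamma> c) x y = bip D c x y + (\<beta> * x + \<gamma> * y)"
    and "bip D (coeff_P (add_linear \<beta> \<gamma> c)) x y = bip D (coeff_P c) x y + (\<beta> * x + 2 * \<gamma> * y)"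
    and "bip D (coeff_Q (add_linear \<beta> \<gamma> c)) x y = bip D (coeff_Q c) x y + (2 * \<beta> * x + \<gamma> * y)"
    and "bip_x D (coeff_P (add_linear \<beta> \<gamma> c)) x y = bip_x D (coeff_P c) x y + \<beta>"
    and "bip_x D (coeff_Q (add_linear \<beta> \<gamma> c)) x y = bip_x D (coeff_Q c) x y + 2 * \<beta>"
    and "bip_y D (coeff_P (add_linear \<beta> \<gamma> c)) x y = bip_y D (coeff_P c) x y + 2 * \<gamma>"
    and "bip_y D (coeff_Q (add_linear \<beta> \<gamma> c)) x y = bip_y D (coeff_Q c) x y + \<gamma>"
proof -
  have eq: "add_linear \<beta> \<gamma> c = (\<lambda>i j. c i j + (\<lambda>i j. single \<beta> 1 0 i j + single \<gamma> 0 1 i j) i j)"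
    by (simp add: add_linear_def fun_eq_iff)
  show "bip D (add_linear \<beta> \<gamma> c) x y = bip D c x y + (\<beta> * x + \<gamma> * y)"
    "bip D (coeff_P (add_linear \<beta> \<gamma> c)) x y = bip D (coeff_P c) x y + (\<beta> * x + 2 * \<gamma> * y)"
    "bip D (coeff_Q (add_linear \<beta> \<gamma> c)) x y = bip D (coeff_Q c) x y + (2 * \<beta> * x + \<gamma> * y)"
    "bip_x D (coeff_P (add_linear \<beta> \<gamma> c)) x y = bip_x D (coeff_P c) x y + \<beta>"
    "bip_x D (coeff_Q (add_linear \<beta> \<gamma> c)) x y = bip_x D (coeff_Q c) x y + 2 * \<beta>"
    "bip_y D (coeff_P (add_linear \<beta> \<gamma> c)) x y = bip_y D (coeff_P c) x y + 2 * \<gamma>"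
    "bip_y D (coeff_Q (add_linear \<beta> \<gamma> c)) x y = bip_y D (coeff_Q c) x y + \<gamma>"
    using assms unfolding eq coeff_PQ_add_single bip_add by (simp_all add: bip_single)
qed

text \<open>
  The left-hand side is the Jacobian determinant of the map from a point to the \<open>(\<beta>, \<gamma>)\<close> for which
  the point is critical, the right-hand side is a multiple of the Jacobian of the perturbed \<open>(P, Q)\<close>;
  \<open>a\<close>, \<open>b\<close>, \<open>d\<close>, \<open>e\<close> stand for \<open>P\<^sub>x\<close>, \<open>P\<^sub>y\<close>, \<open>Q\<^sub>x\<close>, \<open>Q\<^sub>y\<close>.
\<close>

lemma scaled_determinant:
  fixes a b d e \<beta> \<gamma> x y :: real
  shows "(a - 2 * d - 3 * \<beta>) / (3 * x) * ((e - 2 * b - 3 * \<gamma>) / (3 * y)) -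
      (b - 2 * e) / (3 * x) * ((d - 2 * a) / (3 * y)) =
    - (((a + \<beta>) * (e + \<gamma>) - (b + 2 * \<gamma>) * (d + 2 * \<beta>)) / (3 * x * y))"
proof -
  have "(a - 2 * d - 3 * \<beta>) / (3 * x) * ((e - 2 * b - 3 * \<gamma>) / (3 * y)) -
      (b - 2 * e) / (3 * x) * ((d - 2 * a) / (3 * y)) =
      ((a - 2 * d - 3 * \<beta>) * (e - 2 * b - 3 * \<gamma>) - (b - 2 * e) * (d - 2 * a)) / (9 * x * y)"
  proof -
    have "A / (3 * x) * (B / (3 * y)) - C / (3 * x) * (E / (3 * y)) = (A * B - C * E) / (9 * x * y)"
      for A B C E :: real by (simp add: diff_divide_distrib)
    then show ?thesis .
  qed
  also have "(a - 2 * d - 3 * \<beta>) * (e - 2 * b - 3 * \<gamma>) - (b - 2 * e) * (d - 2 * a) =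
      - 3 * ((a + \<beta>) * (e + \<gamma>) - (b + 2 * \<gamma>) * (d + 2 * \<beta>))"
    by algebra
  also have "\<dots> / (9 * x * y) =
      - (((a + \<beta>) * (e + \<gamma>) - (b + 2 * \<gamma>) * (d + 2 * \<beta>)) / (3 * x * y))"
  proof -
    have "- 3 * k / (9 * x * y) = - (k / (3 * x * y))" for k :: real by simp
    then show ?thesis .
  qed
  finally show ?thesis .
qed

text \<open>
  Off the axes the equations \<open>P = Q = 0\<close> for \<open>F + \<beta> x + \<gamma> y\<close> can be solved for \<open>(\<beta>, \<gamma>)\<close>, which is thereby a
  function of the point.  Its critical points are the degenerate ones, and by Sard's theorem its critical
  values form a null set.
\<close>

lemma generic_linear_perturbation:
  assumes D: "D \<ge> 1" and "\<delta> > 0"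
  shows "\<exists>\<beta> \<gamma>. \<bar>\<beta>\<bar> < \<delta> \<and> \<bar>\<gamma>\<bar> < \<delta> \<and>
    (\<forall>x y. x \<noteq> 0 \<longrightarrow> y \<noteq> 0 \<longrightarrow> bip D (coeff_P (add_linear \<beta> \<gamma> c)) x y = 0 \<longrightarrow>
       bip D (coeff_Q (add_linear \<beta> \<gamma> c)) x y = 0 \<longrightarrow> jac D (add_linear \<beta> \<gamma> c) x y \<noteq> 0)"
proof -
  define P where "P (v :: real^2) = bip D (coeff_P c) (v$1) (v$2)" for v
  define Q where "Q (v :: real^2) = bip D (coeff_Q c) (v$1) (v$2)" for v
  define Px where "Px (v :: real^2) = bip_x D (coeff_P c) (v$1) (v$2)" for v
  define Py where "Py (v :: real^2) = bip_y D (coeff_P c) (v$1) (v$2)" for v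
  define Qx where "Qx (v :: real^2) = bip_x D (coeff_Q c) (v$1) (v$2)" for v
  define Qy where "Qy (v :: real^2) = bip_y D (coeff_Q c) (v$1) (v$2)" for v
  define f1 where "f1 v = (P v - 2 * Q v) / (3 * v$1)" for v
  define f2 where "f2 v = (Q v - 2 * P v) / (3 * v$2)" for v
  define f where "f v = (vector [f1 v, f2 v] :: real^2)" for v
  define f1' where "f1' v w = ((Px v - 2 * Qx v - 3 * f1 v) * w$1 + (Py v - 2 * Qy v) * w$2) / (3 * v$1)"
    for v w :: "real^2"
  define f2' where "f2' v w = ((Qx v - 2 * Px v) * w$1 + (Qy v - 2 * Py v - 3 * f2 v) * w$2) / (3 * v$2)"
    for v w :: "real^2"
  define f' where "f' v w = (vector [f1' v w, f2' v w] :: real^2)" for v w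
  have pair: "((\<lambda>v::real^2. (v$1, v$2)) has_derivative (\<lambda>w. (w$1, w$2))) (at v)" for v
    by (intro has_derivative_Pair bounded_linear_imp_has_derivative bounded_linear_vec_nth)
  have dP: "(P has_derivative (\<lambda>w. Px v * w$1 + Py v * w$2)) (at v)" for v
    using has_derivative_compose[OF pair bip_has_derivative] unfolding P_def[abs_def] Px_def Py_def by simp
  have dQ: "(Q has_derivative (\<lambda>w. Qx v * w$1 + Qy v * w$2)) (at v)" for v
    using has_derivative_compose[OF pair bip_has_derivative] unfolding Q_def[abs_def] Qx_def Qy_def by simp
  have comp: "((\<lambda>v::real^2. v$i) has_derivative (\<lambda>w. w$i)) (at v)" for i v
    by (intro bounded_linear_imp_has_derivative bounded_linear_vec_nth)
  have d1: "(f1 has_derivative f1' v) (at v)" if "v$1 \<noteq> 0" for v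
    unfolding f1_def[abs_def]
    by (rule has_derivative_eq_rhs, (rule derivative_eq_intros dP dQ comp HOL.refl | simp add: that)+)
      (use that in \<open>simp add: fun_eq_iff f1'_def f1_def field_simps power2_eq_square\<close>)
  have d2: "(f2 has_derivative f2' v) (at v)" if "v$2 \<noteq> 0" for v
    unfolding f2_def[abs_def]
    by (rule has_derivative_eq_rhs, (rule derivative_eq_intros dP dQ comp HOL.refl | simp add: that)+)
      (use that in \<open>simp add: fun_eq_iff f2'_def f2_def field_simps power2_eq_square\<close>)
  have df: "(f has_derivative f' v) (at v)" if "v$1 \<noteq> 0" "v$2 \<noteq> 0" for v
  proof (subst has_derivative_componentwise_within, intro ballI)
    fix b :: "real^2" assume "b \<in> Basis"
    then obtain i where b: "b = axis i 1" by (auto simp: Basis_vec_def)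
    have "i = 1 \<or> i = 2" using exhaust_2 by blast
    then show "((\<lambda>v. f v \<bullet> b) has_derivative (\<lambda>w. f' v w \<bullet> b)) (at v)"
      using d1 d2 that by (auto simp: b inner_axis f_def f'_def)
  qed
  define S where "S = {v::real^2. v$1 \<noteq> 0 \<and> v$2 \<noteq> 0 \<and> det (matrix (f' v)) = 0}"
  have "negligible (f ` S)"
  proof (rule baby_Sard)
    show "(f has_derivative f' v) (at v within S)" if "v \<in> S" for v
      using that df by (auto simp: S_def intro: has_derivative_at_withinI)
    show "rank (matrix (f' v)) < CARD(2)" if "v \<in> S" for v
      using that det_eq_0_rank[of "matrix (f' v)"] by (simp add: S_def)
  qed simp
  moreover have "\<not> negligible (ball (0::real^2) \<delta>)"
    using \<open>\<delta> > 0\<close> by (intro open_not_negligible) auto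
  ultimately obtain w where w: "w \<in> ball 0 \<delta>" "w \<notin> f ` S"
    using negligible_subset by blast
  define \<beta> \<gamma> where "\<beta> = w$1" and "\<gamma> = w$2"
  have small: "\<bar>\<beta>\<bar> < \<delta>" "\<bar>\<gamma>\<bar> < \<delta>"
    using w(1) component_le_norm_cart[of w 1] component_le_norm_cart[of w 2]
    by (auto simp: \<beta>_def \<gamma>_def)
  have "jac D (add_linear \<beta> \<gamma> c) x y \<noteq> 0"
    if nz: "x \<noteq> 0" "y \<noteq> 0"
      and P0: "bip D (coeff_P (add_linear \<beta> \<gamma> c)) x y = 0"
      and Q0: "bip D (coeff_Q (add_linear \<beta> \<gamma> c)) x y = 0" for x y
  proof -
    define v where "v = (vector [x, y] :: real^2)"
    have v: "v$1 = x" "v$2 = y" by (simp_all add: v_def)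
    have P: "P v = - (\<beta> * x + 2 * \<gamma> * y)" "Q v = - (2 * \<beta> * x + \<gamma> * y)"
      using P0 Q0 unfolding bip_add_linear[OF D] P_def Q_def v by linarith+
    have f12: "f1 v = \<beta>" "f2 v = \<gamma>"
      unfolding f1_def f2_def P v using nz by (simp_all add: field_simps)
    have "f v = w"
      unfolding f_def f12 by (simp add: vec_eq_iff forall_2 \<beta>_def \<gamma>_def)
    then have "v \<notin> S" using w(2) by blast
    then have det: "det (matrix (f' v)) \<noteq> 0" using nz v by (auto simp: S_def)
    have "det (matrix (f' v)) =
      ((Px v - 2 * Qx v - 3 * \<beta>) / (3 * x)) * ((Qy v - 2 * Py v - 3 * \<gamma>) / (3 * y))
      - ((Py v - 2 * Qy v) / (3 * x)) * ((Qx v - 2 * Px v) / (3 * y))"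
      by (simp add: det_2 matrix_def f'_def f1'_def f2'_def f12 v axis_def)
    also have "\<dots> = - (jac D (add_linear \<beta> \<gamma> c) x y / (3 * x * y))"
      unfolding scaled_determinant jac_def bip_add_linear[OF D] Px_def Py_def Qx_def Qy_def v ..
    finally show ?thesis using det nz by auto
  qed
  with small show ?thesis by blast
qed

definition add_top :: "nat \<Rightarrow> real \<Rightarrow> (nat \<Rightarrow> nat \<Rightarrow> real) \<Rightarrow> nat \<Rightarrow> nat \<Rightarrow> real" where
  "add_top D a c i j = c i j + single a 0 D i j"

lemma bip_add_top: "bip D (add_top D a c) x y = bip D c x y + a * y ^ D"
proof -
  have "add_top D a c = (\<lambda>i j. c i j + single a 0 D i j)" by (simp add: add_top_def fun_eq_iff)
  then show ?thesis by (simp add: bip_add bip_single)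
qed

text \<open>
  On a small circle around an isolated point \<open>p\<close> of the level set, \<open>H - H p\<close> has constant sign and is
  bounded away from zero.  A perturbation that is smaller than a quarter of this bound cannot move the
  extremum over the disc to the circle.  The coefficient of \<open>y\<^sup>D\<close> is perturbed first, the linear
  coefficients afterwards; for \<open>D \<ge> 2\<close> the latter do not affect the leading form.
\<close>

theorem perturb_to_nondegenerate:
  assumes D: "D \<ge> 2" and fin: "finite Z"
    and nz: "\<And>p. p \<in> Z \<Longrightarrow> fst p \<noteq> 0 \<and> snd p \<noteq> 0"
    and iso: "\<And>p. p \<in> Z \<Longrightarrow> \<exists>r>0. \<forall>q\<in>cball p r. q \<noteq> p \<longrightarrow> ham D c q \<noteq> ham D c p"
  obtains c' \<phi> where "c' 0 D \<noteq> 0" "inj_on \<phi> Z"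
    "\<And>p. p \<in> Z \<Longrightarrow> sgn (fst (\<phi> p)) = sgn (fst p) \<and> sgn (snd (\<phi> p)) = sgn (snd p) \<and>
      bip D (coeff_P c') (fst (\<phi> p)) (snd (\<phi> p)) = 0 \<and> bip D (coeff_Q c') (fst (\<phi> p)) (snd (\<phi> p)) = 0 \<and>
      - (fst (\<phi> p) * snd (\<phi> p)) * jac D c' (fst (\<phi> p)) (snd (\<phi> p)) > 0"
proof -
  have contH: "continuous_on A (ham D c'')" for A c''
    using planar_hamiltonian.poly_h[OF planar_hamiltonian_ham] continuous_real_polymonial_function
    by (metis continuous_at_imp_continuous_on)
  have "\<forall>\<^sub>F r in at_right 0. \<forall>p\<in>Z. (\<forall>q\<in>cball p r. q \<noteq> p \<longrightarrow> ham D c q \<noteq> ham D c p) \<and>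
      r < \<bar>fst p\<bar> \<and> r < \<bar>snd p\<bar> \<and> (\<forall>p'\<in>Z - {p}. 2 * r < dist p p')"
  proof (rule eventually_ball_finite[OF fin], intro ballI eventually_conj)
    fix p assume p: "p \<in> Z"
    from iso[OF p] obtain r0 where "r0 > 0" "\<forall>q\<in>cball p r0. q \<noteq> p \<longrightarrow> ham D c q \<noteq> ham D c p" by blast
    then show "\<forall>\<^sub>F r in at_right 0. \<forall>q\<in>cball p r. q \<noteq> p \<longrightarrow> ham D c q \<noteq> ham D c p"
      unfolding eventually_at_right_field by (intro exI[of _ r0]) auto
    show "\<forall>\<^sub>F r in at_right 0. r < \<bar>fst p\<bar>" "\<forall>\<^sub>F r in at_right 0. r < \<bar>snd p\<bar>"
      using nz[OF p] unfolding eventually_at_right_field by (meson zero_less_abs_iff)+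
    show "\<forall>\<^sub>F r in at_right 0. \<forall>p'\<in>Z - {p}. 2 * r < dist p p'"
    proof (rule eventually_ball_finite)
      show "\<forall>p'\<in>Z - {p}. \<forall>\<^sub>F r in at_right 0. 2 * r < dist p p'"
      proof
        fix p' assume "p' \<in> Z - {p}"
        then have "dist p p' / 2 > 0" by auto
        then show "\<forall>\<^sub>F r in at_right 0. 2 * r < dist p p'"
          unfolding eventually_at_right_field by (intro exI[of _ "dist p p' / 2"]) auto
      qed
    qed (use fin in simp)
  qed
  then have "\<forall>\<^sub>F r in at_right 0. r > 0 \<and> (\<forall>p\<in>Z. (\<forall>q\<in>cball p r. q \<noteq> p \<longrightarrow> ham D c q \<noteq> ham D c p) \<and>
      r < \<bar>fst p\<bar> \<and> r < \<bar>snd p\<bar> \<and> (\<forall>p'\<in>Z - {p}. 2 * r < dist p p'))"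
    by (intro eventually_conj eventually_at_right_less)
  then obtain r :: real where "r > 0" and
    rr: "\<forall>p\<in>Z. (\<forall>q\<in>cball p r. q \<noteq> p \<longrightarrow> ham D c q \<noteq> ham D c p) \<and>
      r < \<bar>fst p\<bar> \<and> r < \<bar>snd p\<bar> \<and> (\<forall>p'\<in>Z - {p}. 2 * r < dist p p')"
    using eventually_happens'[OF trivial_limit_at_right_real] by blast
  have r: "r > 0"
    "\<And>p q. p \<in> Z \<Longrightarrow> q \<in> cball p r \<Longrightarrow> q \<noteq> p \<Longrightarrow> ham D c q \<noteq> ham D c p"
    "\<And>p. p \<in> Z \<Longrightarrow> r < \<bar>fst p\<bar> \<and> r < \<bar>snd p\<bar>"
    "\<And>p p'. p \<in> Z \<Longrightarrow> p' \<in> Z \<Longrightarrow> p' \<noteq> p \<Longrightarrow> 2 * r < dist p p'"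
    using rr \<open>r > 0\<close> by blast+
  have "\<exists>\<sigma> m. \<sigma> \<noteq> 0 \<and> \<bar>\<sigma>\<bar> = 1 \<and> m > 0 \<and> (\<forall>q\<in>sphere p r. \<sigma> * (ham D c q - ham D c p) \<ge> m)" if p: "p \<in> Z" for p
  proof -
    have ne: "sphere p r \<noteq> {}" using r(1) by simp
    have cont: "continuous_on (sphere p r) (\<lambda>q. ham D c q - ham D c p)"
      by (intro continuous_intros contH)
    have nz': "ham D c q - ham D c p \<noteq> 0" if "q \<in> sphere p r" for q
      using r(2)[OF p, of q] that r(1) by auto
    let ?I = "(\<lambda>q. ham D c q - ham D c p) ` sphere p r"
    have conn: "connected ?I"
      by (intro connected_continuous_image cont connected_sphere) simp
    have same_sign: False if "u \<in> sphere p r" "v \<in> sphere p r" "ham D c u - ham D c p \<le> 0" "0 \<le> ham D c v - ham D c p" for u v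
    proof -
      have "0 \<in> ?I"
        by (rule connectedD_interval[OF conn imageI[OF that(1)] imageI[OF that(2)] that(3,4)])
      with nz' show False by force
    qed
    have "\<exists>\<sigma>. \<bar>\<sigma>\<bar> = 1 \<and> (\<forall>q\<in>sphere p r. \<sigma> * (ham D c q - ham D c p) > 0)"
    proof (cases "\<exists>q\<in>sphere p r. ham D c q - ham D c p > 0")
      case True
      then have "\<forall>q\<in>sphere p r. 1 * (ham D c q - ham D c p) > 0"
        using same_sign by (metis less_imp_le mult_1 not_le)
      then show ?thesis by (intro exI[of _ 1]) auto
    next
      case False
      then have "\<forall>q\<in>sphere p r. (-1) * (ham D c q - ham D c p) > 0"
        using nz' by (metis linorder_neqE_linordered_idom mult_minus1 neg_0_less_iff_less)
      then show ?thesis by (intro exI[of _ "-1"]) auto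
    qed
    then obtain \<sigma> :: real where \<sigma>: "\<bar>\<sigma>\<bar> = 1" "\<forall>q\<in>sphere p r. \<sigma> * (ham D c q - ham D c p) > 0" by blast
    have "continuous_on (sphere p r) (\<lambda>q. \<sigma> * (ham D c q - ham D c p))" by (intro continuous_intros cont)
    from continuous_attains_inf[OF compact_sphere ne this] obtain q0 where "q0 \<in> sphere p r"
      "\<forall>q\<in>sphere p r. \<sigma> * (ham D c q0 - ham D c p) \<le> \<sigma> * (ham D c q - ham D c p)" by blast
    then show ?thesis using \<sigma>
      by (intro exI[of _ \<sigma>] exI[of _ "\<sigma> * (ham D c q0 - ham D c p)"]) auto
  qed
  then obtain \<sigma> m where \<sigma>m: "\<And>p. p \<in> Z \<Longrightarrow> \<sigma> p \<noteq> 0 \<and> \<bar>\<sigma> p\<bar> = (1::real) \<and> m p > (0::real) \<and>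
      (\<forall>q\<in>sphere p r. \<sigma> p * (ham D c q - ham D c p) \<ge> m p)" by metis
  define m0 where "m0 = Min (insert 1 (m ` Z))"
  have m0: "m0 > 0" "\<And>p. p \<in> Z \<Longrightarrow> m0 \<le> m p" using fin \<sigma>m by (auto simp: m0_def)
  have "bounded (\<Union>p\<in>Z. cball p r)" using fin by (intro bounded_UN) auto
  then obtain M0 where M0: "\<And>q. q \<in> (\<Union>p\<in>Z. cball p r) \<Longrightarrow> norm q \<le> M0" unfolding bounded_iff by blast
  define M where "M = max 1 M0"
  have M: "M \<ge> 1" "\<And>p q. p \<in> Z \<Longrightarrow> q \<in> cball p r \<Longrightarrow> \<bar>fst q\<bar> \<le> M \<and> \<bar>snd q\<bar> \<le> M"
  proof -
    show "M \<ge> 1" by (simp add: M_def)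
    fix p q assume "p \<in> Z" "q \<in> cball p r"
    then have "norm q \<le> M" using M0[of q] by (force simp: M_def)
    then show "\<bar>fst q\<bar> \<le> M \<and> \<bar>snd q\<bar> \<le> M"
      using norm_fst_le[of "fst q" "snd q"] norm_snd_le[of "snd q" "fst q"] by auto
  qed
  define B where "B = M * M * (M ^ D + M + M)"
  have B: "B > 0" using M(1) by (simp add: B_def add_pos_pos)
  \<comment> \<open>On the discs the perturbation changes the Hamiltonian by at most \<open>\<delta> B = m0 / 4\<close>.\<close>
  define \<delta> where "\<delta> = m0 / (4 * B)"
  have \<delta>: "\<delta> > 0" using m0 B by (simp add: \<delta>_def)
  \<comment> \<open>Makes the coefficient of \<open>y\<^sup>D\<close> nonzero, as required for the splitting of the leading form.\<close>
  define a where "a = (if c 0 D = 0 then \<delta> / 2 else 0)"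
  have a: "\<bar>a\<bar> \<le> \<delta>" "c 0 D + a \<noteq> 0" using \<delta> by (auto simp: a_def)
  obtain \<beta> \<gamma> where bg: "\<bar>\<beta>\<bar> < \<delta>" "\<bar>\<gamma>\<bar> < \<delta>" and
    nondeg: "\<And>x y. x \<noteq> 0 \<Longrightarrow> y \<noteq> 0 \<Longrightarrow> bip D (coeff_P (add_linear \<beta> \<gamma> (add_top D a c))) x y = 0 \<Longrightarrow>
       bip D (coeff_Q (add_linear \<beta> \<gamma> (add_top D a c))) x y = 0 \<Longrightarrow>
       jac D (add_linear \<beta> \<gamma> (add_top D a c)) x y \<noteq> 0"
    using generic_linear_perturbation[of D \<delta> "add_top D a c"] D \<delta> by (metis Suc_1 Suc_leD One_nat_def)
  define c' where "c' = add_linear \<beta> \<gamma> (add_top D a c)"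
  have D1: "D \<ge> 1" using D by simp
  have close: "\<bar>ham D c' q - ham D c q\<bar> \<le> m0 / 4" if "p \<in> Z" "q \<in> cball p r" for p q
  proof -
    have x: "\<bar>fst q\<bar> \<le> M" and y: "\<bar>snd q\<bar> \<le> M" using M(2)[OF that] by auto
    have "ham D c' q - ham D c q = fst q * snd q * (a * snd q ^ D + \<beta> * fst q + \<gamma> * snd q)"
      unfolding ham_def c'_def bip_add_linear(1)[OF D1] bip_add_top by (simp add: algebra_simps)
    also have "\<bar>\<dots>\<bar> \<le> M * M * (\<delta> * M ^ D + \<delta> * M + \<delta> * M)"
    proof -
      have "\<bar>a * snd q ^ D + \<beta> * fst q + \<gamma> * snd q\<bar> \<le> \<bar>a\<bar> * \<bar>snd q\<bar> ^ D + \<bar>\<beta>\<bar> * \<bar>fst q\<bar> + \<bar>\<gamma>\<bar> * \<bar>snd q\<bar>"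
        by (metis (no_types, opaque_lifting) abs_mult abs_triangle_ineq add_mono dual_order.trans order_refl power_abs)
      also have "\<dots> \<le> \<delta> * M ^ D + \<delta> * M + \<delta> * M"
        using a bg x y \<delta> by (intro add_mono mult_mono power_mono) auto
      finally show ?thesis unfolding abs_mult using x y M(1) by (intro mult_mono) auto
    qed
    also have "\<dots> = \<delta> * B" by (simp add: B_def algebra_simps)
    also have "\<dots> = m0 / 4" using B by (simp add: \<delta>_def)
    finally show ?thesis .
  qed
  have "\<exists>z. z \<in> ball p r \<and> bip D (coeff_P c') (fst z) (snd z) = 0 \<and>
      bip D (coeff_Q c') (fst z) (snd z) = 0 \<and> - (fst z * snd z) * jac D c' (fst z) (snd z) \<ge> 0"
    if p: "p \<in> Z" for p
  proof -
    have "continuous_on (cball p r) (\<lambda>q. \<sigma> p * ham D c' q)" by (intro continuous_intros contH)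
    moreover have "cball p r \<noteq> {}" using r(1) by simp
    ultimately obtain z where z: "z \<in> cball p r" "\<forall>q\<in>cball p r. \<sigma> p * ham D c' z \<le> \<sigma> p * ham D c' q"
      using continuous_attains_inf[OF compact_cball] by blast
    have "z \<notin> sphere p r"
    proof
      assume zs: "z \<in> sphere p r"
      have "m0 \<le> \<sigma> p * (ham D c z - ham D c p)" using \<sigma>m[OF p] zs m0(2)[OF p] by force
      moreover have "\<bar>\<sigma> p * (ham D c' z - ham D c z)\<bar> \<le> m0 / 4" "\<bar>\<sigma> p * (ham D c' p - ham D c p)\<bar> \<le> m0 / 4"
        using close[OF p z(1)] close[OF p, of p] \<sigma>m[OF p] r(1) by (simp_all add: abs_mult)
      moreover have "\<sigma> p * ham D c' z \<le> \<sigma> p * ham D c' p" using z(2) r(1) by simp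
      ultimately show False using m0(1) unfolding right_diff_distrib abs_le_iff by linarith
    qed
    then have zb: "z \<in> ball p r" using z(1) by auto
    have "\<bar>fst z - fst p\<bar> \<le> dist z p" "\<bar>snd z - snd p\<bar> \<le> dist z p"
      using dist_fst_le[of z p] dist_snd_le[of z p] by (simp_all add: dist_real_def)
    then have nzz: "fst z \<noteq> 0" "snd z \<noteq> 0" using zb r(3)[OF p] by (auto simp: dist_commute)
    from extremum_of_ham[OF open_ball zb _ _ nzz, of "\<sigma> p" D c'] z(2) \<sigma>m[OF p] zb
    show ?thesis by (intro exI[of _ z]) auto
  qed
  then obtain \<phi> where \<phi>: "\<And>p. p \<in> Z \<Longrightarrow> \<phi> p \<in> ball p r \<and> bip D (coeff_P c') (fst (\<phi> p)) (snd (\<phi> p)) = 0 \<and>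
      bip D (coeff_Q c') (fst (\<phi> p)) (snd (\<phi> p)) = 0 \<and>
      - (fst (\<phi> p) * snd (\<phi> p)) * jac D c' (fst (\<phi> p)) (snd (\<phi> p)) \<ge> 0"
    by metis
  show ?thesis
  proof (rule that)
    show "c' 0 D \<noteq> 0" using a(2) D by (simp add: c'_def add_linear_def add_top_def single_def)
    show "inj_on \<phi> Z"
    proof (rule inj_onI)
      fix p p' assume p: "p \<in> Z" "p' \<in> Z" and eq: "\<phi> p = \<phi> p'"
      have "dist p (\<phi> p) < r" "dist p' (\<phi> p) < r" using \<phi>[OF p(1)] \<phi>[OF p(2)] eq by simp_all
      then have "dist p p' < 2 * r" using dist_triangle2[of p p' "\<phi> p"] by linarith
      with r(4)[OF p] show "p = p'" by force
    qed
    fix p assume p: "p \<in> Z"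
    have "\<bar>fst (\<phi> p) - fst p\<bar> \<le> dist (\<phi> p) p" "\<bar>snd (\<phi> p) - snd p\<bar> \<le> dist (\<phi> p) p"
      using dist_fst_le[of "\<phi> p" p] dist_snd_le[of "\<phi> p" p] by (simp_all add: dist_real_def)
    moreover have "dist (\<phi> p) p < r" using \<phi>[OF p] by (simp add: dist_commute)
    ultimately have "\<bar>fst (\<phi> p) - fst p\<bar> < \<bar>fst p\<bar>" "\<bar>snd (\<phi> p) - snd p\<bar> < \<bar>snd p\<bar>"
      using r(3)[OF p] by linarith+
    then have sg: "sgn (fst (\<phi> p)) = sgn (fst p)" "sgn (snd (\<phi> p)) = sgn (snd p)"
      by (auto simp: sgn_if abs_if split: if_splits)
    then have "fst (\<phi> p) \<noteq> 0" "snd (\<phi> p) \<noteq> 0" using nz[OF p] by (metis sgn_0_0)+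
    with nondeg[OF this] \<phi>[OF p] have "- (fst (\<phi> p) * snd (\<phi> p)) * jac D c' (fst (\<phi> p)) (snd (\<phi> p)) \<noteq> 0"
      by (simp add: c'_def)
    with sg \<phi>[OF p] show "sgn (fst (\<phi> p)) = sgn (fst p) \<and> sgn (snd (\<phi> p)) = sgn (snd p) \<and>
      bip D (coeff_P c') (fst (\<phi> p)) (snd (\<phi> p)) = 0 \<and> bip D (coeff_Q c') (fst (\<phi> p)) (snd (\<phi> p)) = 0 \<and>
      - (fst (\<phi> p) * snd (\<phi> p)) * jac D c' (fst (\<phi> p)) (snd (\<phi> p)) > 0"
      by linarith
  qed
qed

section \<open>Configurations of centers\<close>

lemma total_degree2_bound:
  assumes "coeff (coeff F j) i \<noteq> 0"
  shows "i + j \<le> total_degree2 F"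
proof -
  have "{i + j |i j. coeff (coeff F j) i \<noteq> 0} \<subseteq>
      (\<lambda>(i, j). i + j) ` (\<Union>j\<le>degree F. {..degree (coeff F j)} \<times> {j})"
    by (force intro: le_degree)
  then have "finite {i + j |i j. coeff (coeff F j) i \<noteq> 0}"
    by (rule finite_subset) simp
  with assms show ?thesis unfolding total_degree2_def by (intro Max_ge) auto
qed

definition coeffs2 :: "real poly poly \<Rightarrow> nat \<Rightarrow> nat \<Rightarrow> real" where
  "coeffs2 F i j = coeff (coeff F j) i"

lemma eval2_eq_bip:
  assumes "total_degree2 F \<le> D"
  shows "eval2 F x y = bip D (coeffs2 F) x y"
proof -
  have deg: "i + j \<le> D" if "coeff (coeff F j) i \<noteq> 0" for i j
    using total_degree2_bound[OF that] assms by simp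
  have "degree F \<le> D"
  proof (rule degree_le, intro allI impI)
    fix j assume "D < j"
    then have "coeff (coeff F j) i = 0" for i using deg[of j i] by force
    then show "coeff F j = 0" by (simp add: poly_eq_iff)
  qed
  then have F: "F = (\<Sum>j\<le>D. monom (coeff F j) j)" by (simp add: poly_as_sum_of_monoms')
  have inner: "poly (coeff F j) x = (\<Sum>i\<le>D. coeff (coeff F j) i * x ^ i)" for j
  proof -
    have "degree (coeff F j) \<le> D"
      by (rule degree_le) (use deg in force)
    then have "coeff F j = (\<Sum>i\<le>D. monom (coeff (coeff F j) i) i)" by (simp add: poly_as_sum_of_monoms')
    then have "poly (coeff F j) x = poly (\<Sum>i\<le>D. monom (coeff (coeff F j) i) i) x" by simp
    then show ?thesis by (simp add: poly_sum poly_monom)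
  qed
  have "eval2 F x y = poly (poly (\<Sum>j\<le>D. monom (coeff F j) j) [:y:]) x"
    unfolding eval2_def using F by simp
  also have "\<dots> = (\<Sum>j\<le>D. (\<Sum>i\<le>D. coeff (coeff F j) i * x ^ i) * y ^ j)"
    by (simp add: poly_sum poly_monom inner)
  also have "\<dots> = (\<Sum>i\<le>D. \<Sum>j\<le>D. coeffs2 F i j * (x ^ i * y ^ j))"
    unfolding sum_distrib_right coeffs2_def by (subst sum.swap) (simp add: mult.assoc)
  also have "\<dots> = (\<Sum>(i,j)\<in>{..D} \<times> {..D}. coeffs2 F i j * (x ^ i * y ^ j))"
    by (simp add: sum.cartesian_product)
  also have "\<dots> = bip D (coeffs2 F) x y"
    unfolding bip_def
  proof (rule sum.mono_neutral_right)
    show "\<forall>q\<in>{..D} \<times> {..D} - exponents (Suc D). (case q of (i, j) \<Rightarrow> coeffs2 F i j * (x ^ i * y ^ j)) = 0"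
      using deg unfolding coeffs2_def exponents_def by force
  qed (auto simp: exponents_def)
  finally show ?thesis .
qed

lemma eval2_pCons: "eval2 (pCons a F) x y = poly a x + y * eval2 F x y"
  by (simp add: eval2_def)

lemma eval2_has_partial_x:
  "((\<lambda>x. eval2 F x y) has_real_derivative eval2 (partial_x F) x y) (at x)"
proof (induction F)
  case 0
  then show ?case by (simp add: eval2_def partial_x_def)
next
  case (pCons a F)
  have "partial_x (pCons a F) = pCons (pderiv a) (partial_x F)"
    unfolding partial_x_def by (rule map_poly_pCons) simp
  then show ?case
    unfolding eval2_pCons by (auto intro!: derivative_eq_intros pCons.IH simp: eval2_pCons)
qed

lemma eval2_has_partial_y:
  "((\<lambda>y. eval2 F x y) has_real_derivative eval2 (partial_y F) x y) (at y)"
proof (induction F)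
  case 0
  then show ?case by (simp add: eval2_def partial_y_def)
next
  case (pCons a F)
  have "eval2 (partial_y (pCons a F)) x y = eval2 F x y + y * eval2 (partial_y F) x y"
    unfolding partial_y_def pderiv_pCons by (simp add: eval2_def)
  then show ?case
    unfolding eval2_pCons by (auto intro!: derivative_eq_intros pCons.IH)
qed

lemma kolmogorov_field_eq:
  assumes "total_degree2 F \<le> D"
  shows "kolmogorov_field F = planar_hamiltonian.field
     (\<lambda>q. snd q * bip D (coeff_Q (coeffs2 F)) (fst q) (snd q))
     (\<lambda>q. fst q * bip D (coeff_P (coeffs2 F)) (fst q) (snd q))"
proof
  fix q :: "real \<times> real"
  let ?c = "coeffs2 F"
  obtain x y where q: "q = (x, y)" by fastforce
  have lx: "((\<lambda>s. (s, y)) has_derivative (\<lambda>s. (s, 0))) (at x)"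
   and ly: "((\<lambda>s. (x, s)) has_derivative (\<lambda>s. (0, s))) (at y)"
    by (auto intro!: derivative_eq_intros)
  have "((\<lambda>s. bip D ?c s y) has_real_derivative bip_x D ?c x y) (at x)"
    using has_derivative_compose[OF lx bip_has_derivative]
    by (simp add: has_field_derivative_def)
  moreover have "((\<lambda>s. bip D ?c s y) has_real_derivative eval2 (partial_x F) x y) (at x)"
    using eval2_has_partial_x[of F y x] unfolding eval2_eq_bip[OF assms] .
  ultimately have px: "eval2 (partial_x F) x y = bip_x D ?c x y" by (metis DERIV_unique)
  have "((\<lambda>s. bip D ?c x s) has_real_derivative bip_y D ?c x y) (at y)"
    using has_derivative_compose[OF ly bip_has_derivative]
    by (simp add: has_field_derivative_def)
  moreover have "((\<lambda>s. bip D ?c x s) has_real_derivative eval2 (partial_y F) x y) (at y)"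
    using eval2_has_partial_y[of F x y] unfolding eval2_eq_bip[OF assms] .
  ultimately have py: "eval2 (partial_y F) x y = bip_y D ?c x y" by (metis DERIV_unique)
  show "kolmogorov_field F q = planar_hamiltonian.field
     (\<lambda>q. snd q * bip D (coeff_Q ?c) (fst q) (snd q))
     (\<lambda>q. fst q * bip D (coeff_P ?c) (fst q) (snd q)) q"
    unfolding planar_hamiltonian.field_def[OF planar_hamiltonian_ham]
    by (simp add: q kolmogorov_field_def px py eval2_eq_bip[OF assms] bip_coeff_P bip_coeff_Q)
qed

text \<open>
  The second claim holds because the Hamiltonian vanishes on the axes: a center on an axis would not be
  isolated in its level set.
\<close>

lemma center_properties:
  assumes "total_degree2 F \<le> D" "p \<in> centers (kolmogorov_field F)"
  shows "\<exists>r>0. \<forall>q\<in>cball p r. q \<noteq> p \<longrightarrow> ham D (coeffs2 F) q \<noteq> ham D (coeffs2 F) p"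
    and "fst p \<noteq> 0 \<and> snd p \<noteq> 0"
proof -
  interpret planar_hamiltonian "ham D (coeffs2 F)"
     "\<lambda>q. snd q * bip D (coeff_Q (coeffs2 F)) (fst q) (snd q)"
     "\<lambda>q. fst q * bip D (coeff_P (coeffs2 F)) (fst q) (snd q)"
    by (rule planar_hamiltonian_ham)
  show "\<exists>r>0. \<forall>q\<in>cball p r. q \<noteq> p \<longrightarrow> ham D (coeffs2 F) q \<noteq> ham D (coeffs2 F) p"
    by (rule center_isolated_in_level)
      (use assms kolmogorov_field_eq[OF assms(1)] in \<open>simp add: centers_def\<close>)
  then obtain r where r: "r > 0" "\<And>q. q \<in> cball p r \<Longrightarrow> q \<noteq> p \<Longrightarrow> ham D (coeffs2 F) q \<noteq> ham D (coeffs2 F) p"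
    by blast
  \<comment> \<open>If \<open>p\<close> were on an axis, one of these points would be on the same axis.\<close>
  define q1 q2 where "q1 = (fst p, snd p + r)" and "q2 = (fst p + r, snd p)"
  have "q1 \<in> cball p r" "q1 \<noteq> p" "q2 \<in> cball p r" "q2 \<noteq> p"
    using r(1) by (auto simp: q1_def q2_def dist_prod_def prod_eq_iff dist_real_def)
  then have "ham D (coeffs2 F) q1 \<noteq> ham D (coeffs2 F) p" "ham D (coeffs2 F) q2 \<noteq> ham D (coeffs2 F) p"
    using r(2) by blast+
  then show "fst p \<noteq> 0 \<and> snd p \<noteq> 0"
    by (auto simp: ham_def q1_def q2_def)
qed

text \<open>
  The six counting inequalities, with \<open>B = D (D + 1)\<close>: four for pairs of adjacent quadrants, two for pairs of
  opposite quadrants.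
\<close>

definition admissible :: "nat \<Rightarrow> configuration \<Rightarrow> bool" where
  "admissible B = (\<lambda>(k1, k2, k3, k4).
     2 * (k1 + k2) \<le> B \<and> 2 * (k2 + k3) \<le> B \<and> 2 * (k3 + k4) \<le> B \<and> 2 * (k4 + k1) \<le> B \<and>
     2 * (k1 + k3) + (k2 + k4) \<le> B \<and> 2 * (k2 + k4) + (k1 + k3) \<le> B)"

lemma admissible_equiv:
  assumes "config_equiv k l" "admissible B k"
  shows "admissible B l"
  using assms by (induction rule: config_equiv.induct) (simp_all add: admissible_def)

lemma config_total_equiv:
  assumes "config_equiv k l"
  shows "(case k of (k1, k2, k3, k4) \<Rightarrow> k1 + k2 + k3 + k4) = (case l of (k1, k2, k3, k4) \<Rightarrow> k1 + k2 + k3 + k4)"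
  using assms by (induction rule: config_equiv.induct) auto

lemma configuration_admissible:
  assumes D: "D \<ge> 2" "total_degree2 F = D" and fin: "finite (centers (kolmogorov_field F))"
  shows "admissible (D * (D + 1)) (configuration_of (kolmogorov_field F))"
    and "(case configuration_of (kolmogorov_field F) of (k1, k2, k3, k4) \<Rightarrow> k1 + k2 + k3 + k4) =
      card (centers (kolmogorov_field F))"
proof -
  define Z where "Z = centers (kolmogorov_field F)"
  have Z: "fst p \<noteq> 0 \<and> snd p \<noteq> 0"
    "\<exists>r>0. \<forall>q\<in>cball p r. q \<noteq> p \<longrightarrow> ham D (coeffs2 F) q \<noteq> ham D (coeffs2 F) p" if "p \<in> Z" for p
    using center_properties[of F D p] that D by (auto simp: Z_def)
  obtain c \<phi> where c: "c 0 D \<noteq> 0" "inj_on \<phi> Z" and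
    \<phi>: "\<And>p. p \<in> Z \<Longrightarrow> sgn (fst (\<phi> p)) = sgn (fst p) \<and> sgn (snd (\<phi> p)) = sgn (snd p) \<and>
      bip D (coeff_P c) (fst (\<phi> p)) (snd (\<phi> p)) = 0 \<and> bip D (coeff_Q c) (fst (\<phi> p)) (snd (\<phi> p)) = 0 \<and>
      - (fst (\<phi> p) * snd (\<phi> p)) * jac D c (fst (\<phi> p)) (snd (\<phi> p)) > 0"
    using perturb_to_nondegenerate[OF D(1) _ Z] fin unfolding Z_def[symmetric] by blast
  obtain m where m: "D = Suc m" using D by (cases D) auto
  have deg: "degree (top_poly D c) = D"
    by (rule antisym[OF degree_top_poly le_degree]) (simp add: coeff_top_poly c(1))
  obtain t where "smult (lead_coeff (top_poly D c)) (\<Prod>i<degree (top_poly D c). [:- t i, 1:]) = top_poly D c"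
    by (rule complex_poly_decompose')
  then have t: "smult (of_real (c 0 D)) (\<Prod>i<D. [:- t i, 1:]) = top_poly D c"
    unfolding deg by (simp add: coeff_top_poly)
  interpret nondegenerate_extrema m c t "\<phi> ` Z"
    by unfold_locales (use c t \<phi> fin in \<open>auto simp: m Z_def simp del: prod.lessThan_Suc\<close>)
  have card_image: "card (\<phi> ` W) = card W" "\<phi> ` W \<subseteq> \<phi> ` Z" if "W \<subseteq> Z" for W
    using that c(2) by (auto intro: card_image inj_on_subset)
  have signs: "fst (\<phi> p) > 0 \<longleftrightarrow> fst p > 0" "fst (\<phi> p) < 0 \<longleftrightarrow> fst p < 0"
    "snd (\<phi> p) > 0 \<longleftrightarrow> snd p > 0" "snd (\<phi> p) < 0 \<longleftrightarrow> snd p < 0" if "p \<in> Z" for p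
    using \<phi>[OF that] by (metis sgn_greater sgn_less)+
  let ?J = "\<lambda>p. jac D c (fst (\<phi> p)) (snd (\<phi> p))"
  have half: "2 * card W \<le> D * (D + 1)"
    if "W \<subseteq> Z" "\<And>p. p \<in> W \<Longrightarrow> (\<alpha> * fst (\<phi> p) + \<beta> * snd (\<phi> p)) * ?J p > 0" for W \<alpha> \<beta>
  proof -
    have "card (\<phi> ` W) \<le> Suc m * (Suc m + 1) div 2"
      by (rule card_half_plane[OF card_image(2)[OF that(1)]]) (use that(2) in \<open>auto simp: m\<close>)
    then show ?thesis unfolding card_image(1)[OF that(1)] m by linarith
  qed
  have diag: "card Z + card W \<le> D * (D + 1)"
    if "W \<subseteq> Z" "\<And>p. p \<in> W \<Longrightarrow> \<sigma> * ?J p > 0" for W \<sigma>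
  proof -
    have "card (\<phi> ` Z) + card (\<phi> ` W) \<le> Suc m * (Suc m + 1)"
      by (rule card_diagonal[OF card_image(2)[OF that(1)]]) (use that(2) in \<open>auto simp: m\<close>)
    then show ?thesis unfolding card_image(1)[OF that(1)] card_image(1)[OF order_refl] m .
  qed
  define Q1 where "Q1 = Z \<inter> {0<..} \<times> {0<..}"
  define Q2 where "Q2 = Z \<inter> {..<0} \<times> {0<..}"
  define Q3 where "Q3 = Z \<inter> {..<0} \<times> {..<0}"
  define Q4 where "Q4 = Z \<inter> {0<..} \<times> {..<0}"
  note Q = Q1_def Q2_def Q3_def Q4_def
  have mem: "p \<in> Q1 \<Longrightarrow> fst (\<phi> p) > 0 \<and> snd (\<phi> p) > 0" "p \<in> Q2 \<Longrightarrow> fst (\<phi> p) < 0 \<and> snd (\<phi> p) > 0"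
    "p \<in> Q3 \<Longrightarrow> fst (\<phi> p) < 0 \<and> snd (\<phi> p) < 0" "p \<in> Q4 \<Longrightarrow> fst (\<phi> p) > 0 \<and> snd (\<phi> p) < 0" for p
    using signs[of p] by (auto simp: Q)
  have sub: "Q1 \<subseteq> Z" "Q2 \<subseteq> Z" "Q3 \<subseteq> Z" "Q4 \<subseteq> Z" by (auto simp: Q)
  have fins: "finite Q1" "finite Q2" "finite Q3" "finite Q4" using fin by (auto simp: Q Z_def)
  have disj: "Q1 \<inter> Q2 = {}" "Q2 \<inter> Q3 = {}" "Q3 \<inter> Q4 = {}" "Q4 \<inter> Q1 = {}" "Q1 \<inter> Q3 = {}" "Q2 \<inter> Q4 = {}"
    "(Q1 \<union> Q3) \<inter> (Q2 \<union> Q4) = {}"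
    by (auto simp: Q)
  have pos: "- (fst (\<phi> p) * snd (\<phi> p)) * ?J p > 0" if "p \<in> Z" for p using \<phi>[OF that] by blast
  have J: "- snd (\<phi> p) * ?J p > 0" if "p \<in> Z" "fst (\<phi> p) > 0" for p
    by (rule zero_less_mult_pos[OF _ that(2)]) (use pos[OF that(1)] in \<open>simp add: mult_ac\<close>)
  have J': "snd (\<phi> p) * ?J p > 0" if "p \<in> Z" "fst (\<phi> p) < 0" for p
    by (rule zero_less_mult_pos[of "- fst (\<phi> p)"]) (use pos[OF that(1)] that(2) in \<open>simp_all add: mult_ac\<close>)
  have K: "- fst (\<phi> p) * ?J p > 0" if "p \<in> Z" "snd (\<phi> p) > 0" for p
    by (rule zero_less_mult_pos[OF _ that(2)]) (use pos[OF that(1)] in \<open>simp add: mult_ac\<close>)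
  have K': "fst (\<phi> p) * ?J p > 0" if "p \<in> Z" "snd (\<phi> p) < 0" for p
    by (rule zero_less_mult_pos[of "- snd (\<phi> p)"]) (use pos[OF that(1)] that(2) in \<open>simp_all add: mult_ac\<close>)
  have D13: "- 1 * ?J p > 0" if "p \<in> Z" "fst (\<phi> p) * snd (\<phi> p) > 0" for p
    by (rule zero_less_mult_pos[OF _ that(2)]) (use pos[OF that(1)] in \<open>simp add: mult_ac\<close>)
  have D24: "1 * ?J p > 0" if "p \<in> Z" "fst (\<phi> p) * snd (\<phi> p) < 0" for p
    by (rule zero_less_mult_pos[of "- (fst (\<phi> p) * snd (\<phi> p))"]) (use pos[OF that(1)] that(2) in \<open>simp_all\<close>)
  have "2 * card (Q1 \<union> Q2) \<le> D * (D + 1)"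
    by (rule half[of _ "-1" 0]) (use sub mem K in \<open>auto simp: subset_iff\<close>)
  moreover have "2 * card (Q2 \<union> Q3) \<le> D * (D + 1)"
    by (rule half[of _ 0 1]) (use sub mem J' in \<open>auto simp: subset_iff\<close>)
  moreover have "2 * card (Q3 \<union> Q4) \<le> D * (D + 1)"
    by (rule half[of _ 1 0]) (use sub mem K' in \<open>auto simp: subset_iff\<close>)
  moreover have "2 * card (Q4 \<union> Q1) \<le> D * (D + 1)"
    by (rule half[of _ 0 "-1"]) (use sub mem J in \<open>auto simp: subset_iff\<close>)
  moreover have "card Z + card (Q1 \<union> Q3) \<le> D * (D + 1)"
    by (rule diag[of _ "-1"]) (use sub mem D13 in \<open>auto simp: subset_iff zero_less_mult_iff\<close>)
  moreover have "card Z + card (Q2 \<union> Q4) \<le> D * (D + 1)"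
    by (rule diag[of _ 1]) (use sub mem D24 in \<open>auto simp: subset_iff mult_less_0_iff\<close>)
  moreover have cards: "card (Q1 \<union> Q2) = card Q1 + card Q2" "card (Q2 \<union> Q3) = card Q2 + card Q3"
    "card (Q3 \<union> Q4) = card Q3 + card Q4" "card (Q4 \<union> Q1) = card Q4 + card Q1"
    "card (Q1 \<union> Q3) = card Q1 + card Q3" "card (Q2 \<union> Q4) = card Q2 + card Q4"
    using fins disj by (simp_all add: card_Un_disjoint)
  moreover have total: "card Z = card Q1 + card Q2 + card Q3 + card Q4"
  proof -
    have "p \<in> (Q1 \<union> Q3) \<union> (Q2 \<union> Q4)" if "p \<in> Z" for p
      using Z(1)[OF that] that by (cases p) (auto simp: Q)
    then have "Z = (Q1 \<union> Q3) \<union> (Q2 \<union> Q4)" using sub by blast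
    then have "card Z = card (Q1 \<union> Q3) + card (Q2 \<union> Q4)"
      using fins disj(7) by (metis card_Un_disjoint finite_Un)
    then show ?thesis using cards by simp
  qed
  moreover have config: "configuration_of (kolmogorov_field F) = (card Q1, card Q2, card Q3, card Q4)"
    unfolding configuration_of_def Z_def[symmetric] Q ..
  ultimately show "admissible (D * (D + 1)) (configuration_of (kolmogorov_field F))"
    unfolding admissible_def config by simp
  show "(case configuration_of (kolmogorov_field F) of (k1, k2, k3, k4) \<Rightarrow> k1 + k2 + k3 + k4) =
      card (centers (kolmogorov_field F))"
    using total unfolding config Z_def by simp
qed

text \<open>
  For \<open>k = [(n - 1) / 2]\<close> and \<open>M = [(n\<^sup>2 - 2 n + 2) / 2]\<close>, the maximal number of centers is \<open>M + 2 k\<close>.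
\<close>

lemma extremal_configuration:
  fixes i1 i2 i3 i4 k M :: nat
  assumes "k \<ge> 1" "M \<ge> 1" and total: "i1 + i2 + i3 + i4 = M + 2 * k"
    and adjacent: "i1 + i2 \<ge> k" "i1 + i4 \<ge> k"
    and opposite: "i1 + i3 \<le> M" "i2 + i4 \<le> M"
    and least: "i1 \<le> i2" "i1 \<le> i3" "i1 \<le> i4" and order: "i2 \<le> i4"
  shows "i2 \<noteq> 0" "i3 \<noteq> 0" "i4 \<noteq> 0"
    and "min (i1 + i3) (i2 + i4) \<ge> 2 * k"
    and "i1 = 0 \<Longrightarrow> i2 \<ge> k" "i1 = 0 \<Longrightarrow> i3 \<ge> 2 * k"
    and "max i4 i3 \<le> M"
    and "M \<in> {i1, i2, i3, i4} \<Longrightarrow> (i1, i2, i3, i4) = (0, k, M, k)"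
proof -
  have opp: "i1 + i3 \<ge> 2 * k" "i2 + i4 \<ge> 2 * k" using total opposite by linarith+
  show nz: "i2 \<noteq> 0" "i3 \<noteq> 0" "i4 \<noteq> 0" using assms(1) adjacent opp least by linarith+
  show "min (i1 + i3) (i2 + i4) \<ge> 2 * k" using opp by simp
  show "i2 \<ge> k" "i3 \<ge> 2 * k" if "i1 = 0" using that adjacent opp by linarith+
  show "max i4 i3 \<le> M" using opposite by simp
  assume "M \<in> {i1, i2, i3, i4}"
  then consider "i1 = M" | "i2 = M" | "i4 = M" | "i3 = M" by blast
  then show "(i1, i2, i3, i4) = (0, k, M, k)"
  proof cases
    case 4
    then have "i1 = 0" "i2 + i4 = 2 * k" using opposite total by linarith+
    then have "i2 = k" "i4 = k" using adjacent by linarith+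
    then show ?thesis using 4 \<open>i1 = 0\<close> by simp
  qed (use nz opposite least order in linarith)+
qed

lemma admissible_arithmetic:
  fixes n i1 i2 i3 i4 :: nat
  assumes n: "n \<ge> 3" and adm: "admissible ((n - 1) * (n - 1 + 1)) (i1, i2, i3, i4)"
    and total: "i1 + i2 + i3 + i4 = (n\<^sup>2 - 1) div 2"
    and least: "i1 \<le> i2" "i1 \<le> i3" "i1 \<le> i4" and order: "i2 \<le> i4"
  shows "(i2 \<noteq> 0 \<and> i3 \<noteq> 0 \<and> i4 \<noteq> 0)
    \<and> ((odd n \<longrightarrow> min (i1 + i3) (i2 + i4) \<ge> n - 1) \<and>
       (even n \<longrightarrow> min (i1 + i3) (i2 + i4) \<ge> n - 2))
    \<and> (i1 = 0 \<longrightarrow> i2 \<ge> (n - 1) div 2 \<and>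
                  (even n \<longrightarrow> i3 \<ge> n - 2) \<and> (odd n \<longrightarrow> i3 \<ge> n - 1))
    \<and> ((n\<^sup>2 + 4) div 8 \<le> max i4 i3 \<and>
       max i4 i3 \<le> (n\<^sup>2 - 2 * n + 2) div 2 \<and>
       i1 \<le> (n\<^sup>2 - 1) div 8)
    \<and> ((n\<^sup>2 - 2 * n + 2) div 2 \<in> {i1, i2, i3, i4} \<longrightarrow>
       (i1, i2, i3, i4) =
         (0, (n - 1) div 2, (n\<^sup>2 - 2 * n + 2) div 2, (n - 1) div 2))"
proof (cases "odd n")
  case True
  then obtain k where k: "n = 2 * k + 1" by (rule oddE)
  define s where "s = k * k"
  have "k \<ge> 1" using n k by simp
  then have s: "s \<ge> k" by (simp add: s_def)
  have n2: "n\<^sup>2 = 4 * s + 4 * k + 1" unfolding k s_def by (simp add: power2_eq_square algebra_simps)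
  have D: "(n - 1) * (n - 1 + 1) = 4 * s + 2 * k" unfolding k s_def by (simp add: algebra_simps)
  have M: "(n\<^sup>2 - 2 * n + 2) div 2 = 2 * s"
  proof -
    have "4 * s + 4 * k + 1 - 2 * n + 2 = 2 * (2 * s) + 1" using s \<open>k \<ge> 1\<close> k by linarith
    then show ?thesis unfolding n2 by simp
  qed
  have T: "i1 + i2 + i3 + i4 = 2 * s + 2 * k" using total unfolding n2 by simp
  have 4: "(n\<^sup>2 + 4) div 8 = (4 * s + 4 * k + 5) div 8" "(n\<^sup>2 - 1) div 8 = (4 * s + 4 * k) div 8"
    unfolding n2 by simp_all
  have h: "(n - 1) div 2 = k" unfolding k by simp
  have adm': "i1 + i2 \<le> 2 * s + k" "i2 + i3 \<le> 2 * s + k" "i3 + i4 \<le> 2 * s + k" "i4 + i1 \<le> 2 * s + k"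
    "2 * i1 + 2 * i3 + (i2 + i4) \<le> 4 * s + 2 * k" "2 * i2 + 2 * i4 + (i1 + i3) \<le> 4 * s + 2 * k"
    using adm unfolding admissible_def prod.case D by simp_all
  have pre: "k \<ge> 1" "2 * s \<ge> 1" "i1 + i2 + i3 + i4 = 2 * s + 2 * k" "i1 + i2 \<ge> k" "i1 + i4 \<ge> k"
    "i1 + i3 \<le> 2 * s" "i2 + i4 \<le> 2 * s" "i1 \<le> i2" "i1 \<le> i3" "i1 \<le> i4" "i2 \<le> i4"
    using adm' T \<open>k \<ge> 1\<close> s least order by linarith+
  have n1: "n - 1 = 2 * k" unfolding k by simp
  have lower: "(4 * s + 4 * k + 5) div 8 \<le> max i4 i3"
  proof -
    have "i1 \<le> max i4 i3" "i2 \<le> max i4 i3" "i3 \<le> max i4 i3" "i4 \<le> max i4 i3"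
      using least order by auto
    then have "4 * s + 4 * k + 5 < 8 * max i4 i3 + 8" using T by linarith
    then have "(4 * s + 4 * k + 5) div 8 < max i4 i3 + 1" by (intro less_mult_imp_div_less) simp
    then show ?thesis by simp
  qed
  have least4: "i1 \<le> (4 * s + 4 * k) div 8"
  proof -
    have "8 * i1 \<le> 4 * s + 4 * k" using T least by linarith
    then show ?thesis using div_le_mono[of "8 * i1" "4 * s + 4 * k" 8] by simp
  qed
  show ?thesis
    using extremal_configuration(1-6)[OF pre] extremal_configuration(7,8)[OF pre] True lower least4 n1
    unfolding M 4 h by auto
next
  case False
  obtain k where k: "n = 2 * (k + 1)" 
  proof
    show "n = 2 * (n div 2 - 1 + 1)" using n False by presburger
  qed
  define s where "s = k * k"
  have "k \<ge> 1" using n k by simp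
  then have s: "s \<ge> k" by (simp add: s_def)
  have n2: "n\<^sup>2 = 4 * s + 8 * k + 4" unfolding k s_def by (simp add: power2_eq_square algebra_simps)
  have D: "(n - 1) * (n - 1 + 1) = 4 * s + 6 * k + 2" unfolding k s_def by (simp add: algebra_simps)
  have M: "(n\<^sup>2 - 2 * n + 2) div 2 = 2 * s + 2 * k + 1"
  proof -
    have "4 * s + 8 * k + 4 - 2 * n + 2 = 2 * (2 * s + 2 * k + 1)" unfolding k by simp
    then show ?thesis unfolding n2 by simp
  qed
  have T: "i1 + i2 + i3 + i4 = 2 * s + 4 * k + 1" using total unfolding n2 by simp
  have 4: "(n\<^sup>2 + 4) div 8 = (4 * s + 8 * k + 8) div 8" "(n\<^sup>2 - 1) div 8 = (4 * s + 8 * k + 3) div 8"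
    unfolding n2 by simp_all
  have h: "(n - 1) div 2 = k" unfolding k by simp
  have adm': "i1 + i2 \<le> 2 * s + 3 * k + 1" "i2 + i3 \<le> 2 * s + 3 * k + 1" "i3 + i4 \<le> 2 * s + 3 * k + 1" "i4 + i1 \<le> 2 * s + 3 * k + 1"
    "2 * i1 + 2 * i3 + (i2 + i4) \<le> 4 * s + 6 * k + 2" "2 * i2 + 2 * i4 + (i1 + i3) \<le> 4 * s + 6 * k + 2"
    using adm unfolding admissible_def prod.case D by simp_all
  have pre: "k \<ge> 1" "(2 * s + 2 * k + 1) \<ge> 1" "i1 + i2 + i3 + i4 = (2 * s + 2 * k + 1) + 2 * k" "i1 + i2 \<ge> k" "i1 + i4 \<ge> k"
    "i1 + i3 \<le> (2 * s + 2 * k + 1)" "i2 + i4 \<le> (2 * s + 2 * k + 1)" "i1 \<le> i2" "i1 \<le> i3" "i1 \<le> i4" "i2 \<le> i4"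
    using adm' T \<open>k \<ge> 1\<close> s least order by linarith+
  have n1: "n - 2 = 2 * k" unfolding k by simp
  have lower: "(4 * s + 8 * k + 8) div 8 \<le> max i4 i3"
  proof -
    have "i1 \<le> max i4 i3" "i2 \<le> max i4 i3" "i3 \<le> max i4 i3" "i4 \<le> max i4 i3"
      using least order by auto
    then have "4 * s + 8 * k + 8 < 8 * max i4 i3 + 8" using T by linarith
    then have "(4 * s + 8 * k + 8) div 8 < max i4 i3 + 1" by (intro less_mult_imp_div_less) simp
    then show ?thesis by simp
  qed
  have least4: "i1 \<le> (4 * s + 8 * k + 3) div 8"
  proof -
    have "8 * i1 \<le> 4 * s + 8 * k + 3" using T least by linarith
    then show ?thesis using div_le_mono[of "8 * i1" "4 * s + 8 * k + 3" 8] by simp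
  qed
  show ?thesis
    using extremal_configuration(1-6)[OF pre] extremal_configuration(7,8)[OF pre] False lower least4 n1
    unfolding M 4 h by auto
qed

theorem theorem4p2:
  fixes n i1 i2 i3 i4 :: nat and F :: "real poly poly"
  assumes "n \<ge> 3"
    and "total_degree2 F = n - 1"
    and "finite (centers (kolmogorov_field F))"
    and "card (centers (kolmogorov_field F)) = (n\<^sup>2 - 1) div 2"
    and "config_equiv (configuration_of (kolmogorov_field F)) (i1, i2, i3, i4)"
    and "i1 = Min {i1, i2, i3, i4}"
    and "i2 \<le> i4"
  shows "(i2 \<noteq> 0 \<and> i3 \<noteq> 0 \<and> i4 \<noteq> 0)
    \<and> ((odd n \<longrightarrow> min (i1 + i3) (i2 + i4) \<ge> n - 1) \<and>
       (even n \<longrightarrow> min (i1 + i3) (i2 + i4) \<ge> n - 2))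
    \<and> (i1 = 0 \<longrightarrow> i2 \<ge> (n - 1) div 2 \<and>
                  (even n \<longrightarrow> i3 \<ge> n - 2) \<and> (odd n \<longrightarrow> i3 \<ge> n - 1))
    \<and> ((n\<^sup>2 + 4) div 8 \<le> Max {i1, i2, i3, i4} \<and>
       Max {i1, i2, i3, i4} \<le> (n\<^sup>2 - 2 * n + 2) div 2 \<and>
       i1 \<le> (n\<^sup>2 - 1) div 8)
    \<and> ((n\<^sup>2 - 2 * n + 2) div 2 \<in> {i1, i2, i3, i4} \<longrightarrow>
       (i1, i2, i3, i4) =
         (0, (n - 1) div 2, (n\<^sup>2 - 2 * n + 2) div 2, (n - 1) div 2))"
proof -
  have D: "n - 1 \<ge> 2" using assms(1) by simp
  note conf = configuration_admissible[OF D assms(2,3)]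
  have adm: "admissible ((n - 1) * (n - 1 + 1)) (i1, i2, i3, i4)"
    using admissible_equiv[OF assms(5) conf(1)] .
  have total: "i1 + i2 + i3 + i4 = (n\<^sup>2 - 1) div 2"
    using conf(2) config_total_equiv[OF assms(5)] assms(4) by simp
  have "Min {i1, i2, i3, i4} \<le> i2" "Min {i1, i2, i3, i4} \<le> i3" "Min {i1, i2, i3, i4} \<le> i4"
    by (intro Min_le; simp)+
  then have least: "i1 \<le> i2" "i1 \<le> i3" "i1 \<le> i4" using assms(6) by metis+
  have "Max {i1, i2, i3, i4} = max i4 i3"
    using least assms(7) by (auto simp: max_def)
  then show ?thesis
    using admissible_arithmetic[OF assms(1) adm total least assms(7)] by metis
qed

end
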